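(* The mapping $\mathcal{H}\times\mathcal{H}\to L^2_r(G)$, $(\psi,\phi)\mapsto W(\psi,\phi)=a_{\psi\otimes\phi}$, is linear in the first argument and anti-linear in the second argument.
   Context: Setting. $G$ is a connected exponential Lie group with Lie algebra $\mathfrak{g}$ ($\exp:\mathfrak{g}\to G$ is a diffeomorphism, with inverse $\log$). The co-adjoint map $K$ is $\langle K(g)Y,X\rangle=\langle Y,\mathrm{Ad}_{g^{-1}}X\rangle$ for $Y\in\mathfrak g^*$. Fix $F\in\mathfrak{g}^*$ with trivial stabilizer $\{g\in G:K(g)F=F\}=\{e\}$, and let $\mathcal{O}_F=K(G)F$ (so $\dim\mathcal{O}_F=\dim G=2n$). $(\pi,\mathcal{H})$ is the irreducible unitary representation attached to $\mathcal{O}_F$ by the Kirillov orbit method: $\pi=\mathrm{ind}_H^G\chi_F$ with $H=\exp\mathfrak{h}$, $\mathfrak{h}$ a subalgebra of maximal dimension with $\langle F,[\mathfrak{h},\mathfrak{h}]\rangle=0$ satisfying the Pukanszky condition $K(H)F=F+\mathfrak{h}^{\perp}$, and $\chi_F(\exp X)=e^{-2\pi i\langle F,X\rangle}$; it is square integrable. Measures. $\mu_l,\mu_r$ are left and right Haar measures with $d\mu_l=\Delta\, d\mu_r$, $\Delta$ the modular function; $L^p_r(G)=L^p(G,\mu_r)$. Inner products are linear in the first variable. Duflo-Moore operator. With $\mathcal{W}_\phi\psi(x)=\langle\psi,\pi(x)^*\phi\rangle_{\mathcal H}$, $\mathcal{D}^{-1}$ is the unique positive densely defined operator on $\mathcal{H}$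 with $\langle \mathcal{W}_{\phi_1}\psi_1,\mathcal{W}_{\phi_2}\psi_2\rangle_{L^2_r}=\langle\psi_1,\psi_2\rangle\overline{\langle\mathcal{D}^{-1}\phi_1,\mathcal{D}^{-1}\phi_2\rangle}$ for $\phi_i\in\mathrm{Dom}(\mathcal{D}^{-1})$, $\psi_i\in\mathcal H$; $\mathcal{D}$ is its inverse. Fourier-Wigner transform. $\mathcal{S}^1,\mathcal{S}^2$ are the trace class and Hilbert-Schmidt operators on $\mathcal H$. $\mathcal{F}_{\mathrm{W}}(A)(x)=\mathrm{tr}(A\mathcal{D}\pi(x))$ for $A\in\mathcal{S}^2$ such that $A\mathcal{D}$ extends to a trace class operator, extended continuously to an isometry $\mathcal{S}^2\to L^2_r(G)$. Fourier-Kirillov transform. Fix a basis $X_1,\dots,X_{2n}$ of $\mathfrak{g}$, the corresponding Lebesgue measure $dX$ on $\mathfrak g$ and dual Lebesgue measure $dY$ on $\mathfrak{g}^*$; $\mathrm{Pf}_F$ is the Pfaffian of the matrix $(F([X_i,X_j]))_{i,j}$. $\Theta(X)=\left|\det\frac{e^{\mathrm{ad}X}-1}{\mathrm{ad}X}\right|$ and $\mu_r$ is normalized by $d\mu_r(\exp X)=\Theta(X)\,dX$. The map $\kappa:G\to\mathcal{O}_F$, $\kappa(x)=K(x^{-1})F$, is a diffeomorphism, and the basis is chosen so that $\kappa$ carries $\mu_r$ to $|\mathrm{Pf}_F|\,\Delta(\kappa^{-1}(Y))\,dY$ on $\mathcal{O}_F$ (this compatibility of normalizations amounts to $|\mathrm{Pf}_F|=1$).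 On $L^2_r(G)$, with the integral understood in the $L^2$ (Plancherel) sense, $$\mathcal{F}_{\mathrm{KO}}(f)(x)=\frac{1}{\sqrt{|\mathrm{Pf}_F|\Delta(x)}}\int_{\mathfrak g}f(\exp X)e^{2\pi i\langle\kappa(x),X\rangle}\sqrt{\Theta(X)}\,dX.$$ Dequantization and Wigner distribution. $a_S=\mathcal{F}_{\mathrm{KO}}(\mathcal{F}_{\mathrm{W}}(S))$ for $S\in\mathcal{S}^2(\mathcal H)$; $\psi\otimes\phi$ is the rank-one operator $\xi\mapsto\langle\xi,\phi\rangle\psi$; $W(\psi,\phi)=a_{\psi\otimes\phi}$. *)

theory Defs
  imports "HOL-Analysis.Analysis" "HOL-Algebra.Group"
begin

section \<open>Complex Hilbert spaces\<close>

text \<open>The inner product is linear in the first variable.\<close>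

class chilbert_space = real_inner + complete_space +
  fixes scaleC :: "complex \<Rightarrow> 'a \<Rightarrow> 'a" (infixr "*\<^sub>C" 75)
    and cinner :: "'a \<Rightarrow> 'a \<Rightarrow> complex"
  assumes scaleC_add_right: "a *\<^sub>C (x + y) = a *\<^sub>C x + a *\<^sub>C y"
    and scaleC_add_left: "(a + b) *\<^sub>C x = a *\<^sub>C x + b *\<^sub>C x"
    and scaleC_scaleC: "a *\<^sub>C (b *\<^sub>C x) = (a * b) *\<^sub>C x"
    and scaleR_scaleC: "r *\<^sub>R x = complex_of_real r *\<^sub>C x"
    and cinner_add_left: "cinner (x + y) z = cinner x z + cinner y z"
    and cinner_scaleC_left: "cinner (a *\<^sub>C x) y = a * cinner x y"
    and cinner_commute: "cinner x y = cnj (cinner y x)"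
    and inner_eq_Re_cinner: "x \<bullet> y = Re (cinner x y)"

definition csubspace :: "'h::chilbert_space set \<Rightarrow> bool" where
  "csubspace V \<longleftrightarrow> 0 \<in> V \<and> (\<forall>x\<in>V. \<forall>y\<in>V. x + y \<in> V) \<and> (\<forall>c. \<forall>x\<in>V. c *\<^sub>C x \<in> V)"

definition clinear_on :: "'h::chilbert_space set \<Rightarrow> ('h \<Rightarrow> 'h) \<Rightarrow> bool" where
  "clinear_on V A \<longleftrightarrow>
     (\<forall>x\<in>V. \<forall>y\<in>V. A (x + y) = A x + A y) \<and> (\<forall>c. \<forall>x\<in>V. A (c *\<^sub>C x) = c *\<^sub>C A x)"

definition bounded_op :: "('h::chilbert_space \<Rightarrow> 'h) \<Rightarrow> bool" where
  "bounded_op A \<longleftrightarrow> clinear_on UNIV A \<and> (\<exists>C. \<forall>x. norm (A x) \<le> C * norm x)"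

definition adj :: "('h::chilbert_space \<Rightarrow> 'h) \<Rightarrow> 'h \<Rightarrow> 'h" where
  "adj A = (THE B. \<forall>x y. cinner (A x) y = cinner x (B y))"

definition unitary_op :: "('h::chilbert_space \<Rightarrow> 'h) \<Rightarrow> bool" where
  "unitary_op U \<longleftrightarrow> clinear_on UNIV U \<and> surj U \<and> (\<forall>x y. cinner (U x) (U y) = cinner x y)"

definition onb :: "'h::chilbert_space set \<Rightarrow> bool" where
  "onb E \<longleftrightarrow> (\<forall>e\<in>E. \<forall>f\<in>E. cinner e f = (if e = f then 1 else 0)) \<and>
     (\<forall>x. (\<forall>e\<in>E. cinner x e = 0) \<longrightarrow> x = 0)"

text \<open>Trace class: the trace series converges absolutely in every orthonormal basis, the definition
  customary in representation theory.\<close>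

definition trace_class :: "('h::chilbert_space \<Rightarrow> 'h) \<Rightarrow> bool" where
  "trace_class B \<longleftrightarrow> bounded_op B \<and>
     (\<forall>E. onb E \<longrightarrow> (\<lambda>e. cmod (cinner (B e) e)) summable_on E)"

definition hilbert_schmidt :: "('h::chilbert_space \<Rightarrow> 'h) \<Rightarrow> bool" where
  "hilbert_schmidt A \<longleftrightarrow> bounded_op A \<and>
     (\<forall>E. onb E \<longrightarrow> (\<lambda>e. (norm (A e))\<^sup>2) summable_on E)"

text \<open>The trace and the Hilbert-Schmidt norm do not depend on the orthonormal basis chosen.\<close>

definition trace_op :: "('h::chilbert_space \<Rightarrow> 'h) \<Rightarrow> complex" where
  "trace_op B = (\<Sum>\<^sub>\<infinity>e\<in>(SOME E. onb E). cinner (B e) e)"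

definition hs_norm :: "('h::chilbert_space \<Rightarrow> 'h) \<Rightarrow> real" where
  "hs_norm A = sqrt (\<Sum>\<^sub>\<infinity>e\<in>(SOME E. onb E). (norm (A e))\<^sup>2)"

definition rank_one :: "'h::chilbert_space \<Rightarrow> 'h \<Rightarrow> 'h \<Rightarrow> 'h" where
  "rank_one \<psi> \<phi> = (\<lambda>\<xi>. cinner \<xi> \<phi> *\<^sub>C \<psi>)"

text \<open>An unbounded operator is given by its domain \<open>V\<close> and a function \<open>T\<close>, whose values outside
  \<open>V\<close> are irrelevant.  The last clause says that the graph of the adjoint is the graph of \<open>T\<close>.\<close>

definition positive_selfadjoint :: "'h::chilbert_space set \<Rightarrow> ('h \<Rightarrow> 'h) \<Rightarrow> bool" where
  "positive_selfadjoint V T \<longleftrightarrow>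
     csubspace V \<and> closure V = UNIV \<and> clinear_on V T \<and>
     (\<forall>x\<in>V. Im (cinner (T x) x) = 0 \<and> Re (cinner (T x) x) \<ge> 0) \<and>
     (\<forall>y z. (\<forall>x\<in>V. cinner (T x) y = cinner x z) \<longleftrightarrow> y \<in> V \<and> z = T y)"


section \<open>Square-integrable functions\<close>

text \<open>Elements of \<open>L\<^sup>2\<close> are represented by functions; equality in \<open>L\<^sup>2\<close> is equality almost
  everywhere.\<close>

definition L2 :: "'a measure \<Rightarrow> ('a \<Rightarrow> complex) set" where
  "L2 M = {f \<in> borel_measurable M. integrable M (\<lambda>x. (cmod (f x))\<^sup>2)}"

definition L2_tendsto :: "'a measure \<Rightarrow> (nat \<Rightarrow> 'a \<Rightarrow> complex) \<Rightarrow> ('a \<Rightarrow> complex) \<Rightarrow> bool" where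
  "L2_tendsto M f g \<longleftrightarrow> (\<forall>k. f k \<in> L2 M) \<and> g \<in> L2 M \<and>
     (\<lambda>k. \<integral>x. (cmod (f k x - g x))\<^sup>2 \<partial>M) \<longlonglongrightarrow> 0"

definition L2_inner :: "'a measure \<Rightarrow> ('a \<Rightarrow> complex) \<Rightarrow> ('a \<Rightarrow> complex) \<Rightarrow> complex" where
  "L2_inner M f g = (\<integral>x. f x * cnj (g x) \<partial>M)"


section \<open>Exponential Lie groups\<close>

primrec C_k :: "nat \<Rightarrow> ('a::euclidean_space \<Rightarrow> 'b::euclidean_space) \<Rightarrow> bool" where
  "C_k 0 f \<longleftrightarrow> continuous_on UNIV f"
| "C_k (Suc k) f \<longleftrightarrow> (\<forall>x. f differentiable (at x)) \<and>
     (\<forall>v. C_k k (\<lambda>x. frechet_derivative f (at x) v))"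

text \<open>\<open>Pf A = 1/(2\<^sup>n n!) \<Sum>\<^sub>\<sigma> sgn \<sigma> \<Prod>\<^sub>i A\<^bsub>\<sigma>(2i-1),\<sigma>(2i)\<^esub>\<close> for a \<open>2n \<times> 2n\<close> matrix.\<close>

definition pfaffian :: "nat \<Rightarrow> (nat \<Rightarrow> nat \<Rightarrow> real) \<Rightarrow> real" where
  "pfaffian n A = 1 / (2 ^ n * fact n) *
     (\<Sum>\<sigma> | \<sigma> permutes {1..2*n}. of_int (sign \<sigma>) * (\<Prod>i=1..n. A (\<sigma> (2*i - 1)) (\<sigma> (2*i))))"

text \<open>
  The Lie algebra is the vector space \<open>real ^ 'm\<close>; its standard basis and inner product play no
  role, and its bracket is derived from the group law.  As the exponential map \<open>Exp\<close> of an
  exponential Lie group is a diffeomorphism, its inverse \<open>Log\<close> is a global chart, and we let it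
  carry the smooth structure of \<open>G\<close>: the group law is smooth in this chart, and \<open>Exp\<close> is the
  exponential map because \<open>t \<mapsto> Exp (t *\<^sub>R Z)\<close> is a one-parameter subgroup with velocity \<open>Z\<close>.
  Inversion is \<open>Z \<mapsto> - Z\<close> in the chart.
\<close>

locale exponential_lie_group = group G
  for G :: "('g, 'b) monoid_scheme" (structure) +
  fixes Exp :: "real ^ 'm \<Rightarrow> 'g"
  assumes Exp_bij: "bij_betw Exp UNIV (carrier G)"
    and Exp_add: "Exp ((s + t) *\<^sub>R Z) = Exp (s *\<^sub>R Z) \<otimes> Exp (t *\<^sub>R Z)"
    and mult_smooth: "C_k k (\<lambda>(Y, Z). inv_into UNIV Exp (Exp Y \<otimes> Exp Z))"
begin

definition Log :: "'g \<Rightarrow> real ^ 'm" where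
  "Log = inv_into UNIV Exp"

definition Ad :: "'g \<Rightarrow> real ^ 'm \<Rightarrow> real ^ 'm" where
  "Ad g Z = vector_derivative (\<lambda>t. Log (g \<otimes> Exp (t *\<^sub>R Z) \<otimes> m_inv G g)) (at 0)"

definition bracket :: "real ^ 'm \<Rightarrow> real ^ 'm \<Rightarrow> real ^ 'm" where
  "bracket Y Z = vector_derivative (\<lambda>t. Ad (Exp (t *\<^sub>R Y)) Z) (at 0)"

definition K :: "'g \<Rightarrow> ((real ^ 'm) \<Rightarrow>\<^sub>L real) \<Rightarrow> ((real ^ 'm) \<Rightarrow>\<^sub>L real)" where
  "K g Y = Blinfun (\<lambda>Z. Y (Ad (m_inv G g) Z))"

definition orbit :: "((real ^ 'm) \<Rightarrow>\<^sub>L real) \<Rightarrow> ((real ^ 'm) \<Rightarrow>\<^sub>L real) set" where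
  "orbit F = (\<lambda>g. K g F) ` carrier G"

definition \<kappa> :: "((real ^ 'm) \<Rightarrow>\<^sub>L real) \<Rightarrow> 'g \<Rightarrow> ((real ^ 'm) \<Rightarrow>\<^sub>L real)" where
  "\<kappa> F x = K (m_inv G x) F"

text \<open>\<open>\<Theta> Z = \<bar>det ((e\<^bsup>ad Z\<^esup> - 1) / ad Z)\<bar>\<close>, the quotient being the entire series in \<open>ad Z\<close>.\<close>

definition \<Theta> :: "real ^ 'm \<Rightarrow> real" where
  "\<Theta> Z = \<bar>det (matrix (\<lambda>V. \<Sum>k. (1 / fact (Suc k)) *\<^sub>R (bracket Z ^^ k) V))\<bar>"

definition borel_G :: "'g measure" where
  "borel_G = vimage_algebra (carrier G) Log borel"

text \<open>Left Haar measures of a closed subgroup \<open>H\<close> are regarded as measures on \<open>G\<close>.\<close>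

definition left_haar :: "'g set \<Rightarrow> 'g measure \<Rightarrow> bool" where
  "left_haar H \<nu> \<longleftrightarrow> sets \<nu> = sets borel_G \<and>
     (\<exists>A\<in>sets \<nu>. emeasure \<nu> A \<noteq> 0) \<and>
     (\<forall>A\<in>sets \<nu>. A \<inter> H = {} \<longrightarrow> emeasure \<nu> A = 0) \<and>
     (\<forall>C. compact C \<longrightarrow> emeasure \<nu> (Exp ` C) < \<infinity>) \<and>
     (\<forall>h\<in>H. \<forall>A\<in>sets \<nu>. emeasure \<nu> ((\<lambda>x. h \<otimes> x) ` A) = emeasure \<nu> A)"

text \<open>The convention for the modular function is the one for which \<open>d\<mu>\<^sub>l = \<Delta> d\<mu>\<^sub>r\<close>.\<close>

definition modular :: "'g set \<Rightarrow> 'g measure \<Rightarrow> ('g \<Rightarrow> real) \<Rightarrow> bool" where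
  "modular H \<nu> \<delta> \<longleftrightarrow> (\<forall>h\<in>H. \<delta> h > 0 \<and>
     (\<forall>A\<in>sets \<nu>. emeasure \<nu> ((\<lambda>x. x \<otimes> h) ` A) = ennreal (\<delta> h) * emeasure \<nu> A))"

end


section \<open>Measures, polarizations and the Fourier-Kirillov transform\<close>

locale based_exponential_lie_group = exponential_lie_group G Exp
  for G :: "('g, 'b) monoid_scheme" (structure) and Exp :: "real ^ 'm \<Rightarrow> 'g" +
  fixes n :: nat and X :: "nat \<Rightarrow> real ^ 'm"
  assumes X_inj: "inj_on X {1..2*n}"
    and X_independent: "independent (X ` {1..2*n})"
    and X_span: "span (X ` {1..2*n}) = UNIV"
begin

definition dX :: "(real ^ 'm) measure" where
  "dX = distr (\<Pi>\<^sub>M i\<in>{1..2*n}. lborel) borel (\<lambda>c. \<Sum>i=1..2*n. c i *\<^sub>R X i)"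

definition dY :: "((real ^ 'm) \<Rightarrow>\<^sub>L real) measure" where
  "dY = distr (\<Pi>\<^sub>M i\<in>{1..2*n}. lborel) borel (\<lambda>c. THE Y. \<forall>i\<in>{1..2*n}. blinfun_apply Y (X i) = c i)"

definition \<mu>\<^sub>r :: "'g measure" where
  "\<mu>\<^sub>r = distr (density dX (\<lambda>Z. ennreal (\<Theta> Z))) borel_G Exp"

definition Pf :: "((real ^ 'm) \<Rightarrow>\<^sub>L real) \<Rightarrow> real" where
  "Pf F = pfaffian n (\<lambda>i j. F (bracket (X i) (X j)))"

definition isotropic_subalgebra :: "((real ^ 'm) \<Rightarrow>\<^sub>L real) \<Rightarrow> (real ^ 'm) set \<Rightarrow> bool" where
  "isotropic_subalgebra F \<hh> \<longleftrightarrow> subspace \<hh> \<and>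
     (\<forall>Y\<in>\<hh>. \<forall>Z\<in>\<hh>. bracket Y Z \<in> \<hh> \<and> F (bracket Y Z) = 0)"

definition pukanszky_polarization :: "((real ^ 'm) \<Rightarrow>\<^sub>L real) \<Rightarrow> (real ^ 'm) set \<Rightarrow> bool" where
  "pukanszky_polarization F \<hh> \<longleftrightarrow> isotropic_subalgebra F \<hh> \<and>
     (\<forall>\<hh>'. isotropic_subalgebra F \<hh>' \<longrightarrow> dim \<hh>' \<le> dim \<hh>) \<and>
     (\<lambda>g. K g F) ` (Exp ` \<hh>) = {F + Y | Y. \<forall>Z\<in>\<hh>. blinfun_apply Y Z = 0}"

definition char_F :: "((real ^ 'm) \<Rightarrow>\<^sub>L real) \<Rightarrow> 'g \<Rightarrow> complex" where
  "char_F F x = cis (- 2 * pi * F (Log x))"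

definition fourier :: "(real ^ 'm \<Rightarrow> complex) \<Rightarrow> ((real ^ 'm) \<Rightarrow>\<^sub>L real) \<Rightarrow> complex" where
  "fourier h Y = (\<integral>Z. h Z * cis (2 * pi * Y Z) \<partial>dX)"

text \<open>\<open>H\<close> is a version of the Fourier-Plancherel transform of \<open>h\<close>: the \<open>L\<^sup>2\<close> limit of Fourier
  integrals of functions in \<open>L\<^sup>1 \<inter> L\<^sup>2\<close> converging to \<open>h\<close> in \<open>L\<^sup>2\<close>.\<close>

definition is_fourier_L2 ::
    "(real ^ 'm \<Rightarrow> complex) \<Rightarrow> (((real ^ 'm) \<Rightarrow>\<^sub>L real) \<Rightarrow> complex) \<Rightarrow> bool" where
  "is_fourier_L2 h H \<longleftrightarrow> (\<exists>hs. (\<forall>k. integrable dX (hs k)) \<and>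
     L2_tendsto dX hs h \<and> L2_tendsto dY (\<lambda>k. fourier (hs k)) H)"

definition fourier_kirillov ::
    "('g \<Rightarrow> real) \<Rightarrow> ((real ^ 'm) \<Rightarrow>\<^sub>L real) \<Rightarrow> ('g \<Rightarrow> complex) \<Rightarrow> 'g \<Rightarrow> complex" where
  "fourier_kirillov \<Delta> F f x = complex_of_real (1 / sqrt (\<bar>Pf F\<bar> * \<Delta> x)) *
     (SOME H. is_fourier_L2 (\<lambda>Z. f (Exp Z) * complex_of_real (sqrt (\<Theta> Z))) H) (\<kappa> F x)"


section \<open>Unitary representations\<close>

definition unitary_rep :: "('g \<Rightarrow> 'h::chilbert_space \<Rightarrow> 'h) \<Rightarrow> bool" where
  "unitary_rep \<pi> \<longleftrightarrow> (\<forall>x\<in>carrier G. unitary_op (\<pi> x)) \<and>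
     (\<forall>x\<in>carrier G. \<forall>y\<in>carrier G. \<pi> (x \<otimes> y) = \<pi> x \<circ> \<pi> y) \<and>
     (\<forall>v. continuous_on UNIV (\<lambda>Z. \<pi> (Exp Z) v))"

definition irreducible_rep :: "('g \<Rightarrow> 'h::chilbert_space \<Rightarrow> 'h) \<Rightarrow> bool" where
  "irreducible_rep \<pi> \<longleftrightarrow> (\<exists>v::'h. v \<noteq> 0) \<and>
     (\<forall>V. csubspace V \<and> closed V \<and> (\<forall>x\<in>carrier G. \<pi> x ` V \<subseteq> V) \<longrightarrow> V = {0} \<or> V = UNIV)"

text \<open>
  The space of \<open>ind\<^sub>H\<^sup>G \<xi>\<close>: functions with \<open>f (x h) = \<xi>(h)\<^sup>-\<^sup>1 (\<Delta>\<^sub>H(h) / \<Delta>\<^sub>G(h))\<^bsup>1/2\<^esup> f x\<close> on which \<open>G\<close> acts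
  by left translation.  The density \<open>\<bar>f\<bar>\<^sup>2\<close> is integrated over \<open>G/H\<close> by means of a weight
  \<open>\<beta> \<ge> 0\<close> on \<open>G\<close> with \<open>\<integral>\<^sub>H \<beta>(x h) dh = 1\<close> for all \<open>x\<close>; the result does not depend on \<open>\<beta>\<close>.
\<close>

definition induced_space ::
    "'g measure \<Rightarrow> ('g \<Rightarrow> real) \<Rightarrow> 'g set \<Rightarrow> ('g \<Rightarrow> real) \<Rightarrow> ('g \<Rightarrow> complex) \<Rightarrow> ('g \<Rightarrow> real)
      \<Rightarrow> ('g \<Rightarrow> complex) set" where
  "induced_space \<mu> \<Delta> H \<delta> \<xi> \<beta> = {f \<in> borel_measurable borel_G.
     (\<forall>x\<in>carrier G. \<forall>h\<in>H.
        f (x \<otimes> h) = inverse (\<xi> h) * complex_of_real (sqrt (\<delta> h / \<Delta> h)) * f x) \<and>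
     integrable \<mu> (\<lambda>x. \<beta> x * (cmod (f x))\<^sup>2)}"

text \<open>\<open>\<pi>\<close> is unitarily equivalent to \<open>ind\<^sub>H\<^sup>G \<xi>\<close>, by means of the intertwiner \<open>J\<close>.\<close>

definition equiv_induced ::
    "('g \<Rightarrow> 'h::chilbert_space \<Rightarrow> 'h) \<Rightarrow> 'g measure \<Rightarrow> ('g \<Rightarrow> real) \<Rightarrow> 'g set \<Rightarrow> ('g \<Rightarrow> complex)
      \<Rightarrow> bool" where
  "equiv_induced \<pi> \<mu> \<Delta> H \<xi> \<longleftrightarrow> (\<exists>\<nu> \<delta> \<beta> J.
     left_haar H \<nu> \<and> modular H \<nu> \<delta> \<and>
     \<beta> \<in> borel_measurable borel_G \<and> (\<forall>x\<in>carrier G. \<beta> x \<ge> 0) \<and>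
     (\<forall>x\<in>carrier G. (\<integral>\<^sup>+h. ennreal (\<beta> (x \<otimes> h)) \<partial>\<nu>) = 1) \<and>
     (\<forall>v. J v \<in> induced_space \<mu> \<Delta> H \<delta> \<xi> \<beta>) \<and>
     (\<forall>v w. AE x in \<mu>. J (v + w) x = J v x + J w x) \<and>
     (\<forall>c v. AE x in \<mu>. J (c *\<^sub>C v) x = c * J v x) \<and>
     (\<forall>v. (norm v)\<^sup>2 = (\<integral>x. \<beta> x * (cmod (J v x))\<^sup>2 \<partial>\<mu>)) \<and>
     (\<forall>f\<in>induced_space \<mu> \<Delta> H \<delta> \<xi> \<beta>. \<exists>v. AE x in \<mu>. J v x = f x) \<and>
     (\<forall>g\<in>carrier G. \<forall>v. AE x in \<mu>. J (\<pi> g v) x = J v (m_inv G g \<otimes> x)))"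

definition matrix_coeff ::
    "('g \<Rightarrow> 'h::chilbert_space \<Rightarrow> 'h) \<Rightarrow> 'h \<Rightarrow> 'h \<Rightarrow> 'g \<Rightarrow> complex" where
  "matrix_coeff \<pi> \<phi> \<psi> x = cinner \<psi> (adj (\<pi> x) \<phi>)"

definition square_integrable_rep :: "('g \<Rightarrow> 'h::chilbert_space \<Rightarrow> 'h) \<Rightarrow> bool" where
  "square_integrable_rep \<pi> \<longleftrightarrow> (\<exists>\<phi> \<psi>. \<phi> \<noteq> 0 \<and> \<psi> \<noteq> 0 \<and> matrix_coeff \<pi> \<phi> \<psi> \<in> L2 \<mu>\<^sub>r)"

text \<open>\<open>T\<close>, with domain \<open>V\<close>, is the operator \<open>\<D>\<^sup>-\<^sup>1\<close>.\<close>

definition duflo_moore_inverse ::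
    "('g \<Rightarrow> 'h::chilbert_space \<Rightarrow> 'h) \<Rightarrow> 'h set \<Rightarrow> ('h \<Rightarrow> 'h) \<Rightarrow> bool" where
  "duflo_moore_inverse \<pi> V T \<longleftrightarrow> positive_selfadjoint V T \<and>
     (\<forall>\<phi>\<in>V. \<forall>\<psi>. matrix_coeff \<pi> \<phi> \<psi> \<in> L2 \<mu>\<^sub>r) \<and>
     (\<forall>\<phi>\<^sub>1\<in>V. \<forall>\<phi>\<^sub>2\<in>V. \<forall>\<psi>\<^sub>1 \<psi>\<^sub>2.
        L2_inner \<mu>\<^sub>r (matrix_coeff \<pi> \<phi>\<^sub>1 \<psi>\<^sub>1) (matrix_coeff \<pi> \<phi>\<^sub>2 \<psi>\<^sub>2) =
        cinner \<psi>\<^sub>1 \<psi>\<^sub>2 * cnj (cinner (T \<phi>\<^sub>1) (T \<phi>\<^sub>2)))"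


section \<open>The Fourier-Wigner transform\<close>

text \<open>The bounded extension \<open>B\<close> of \<open>A \<D>\<close> is unique because the domain \<open>T ` V\<close> of \<open>\<D>\<close> is dense;
  \<open>\<D>\<close> is \<open>inv_into V T\<close>.\<close>

definition is_fourier_wigner_dense ::
    "('g \<Rightarrow> 'h::chilbert_space \<Rightarrow> 'h) \<Rightarrow> 'h set \<Rightarrow> ('h \<Rightarrow> 'h) \<Rightarrow> ('h \<Rightarrow> 'h) \<Rightarrow> ('g \<Rightarrow> complex)
      \<Rightarrow> bool" where
  "is_fourier_wigner_dense \<pi> V T A f \<longleftrightarrow> hilbert_schmidt A \<and>
     (\<exists>B. trace_class B \<and> (\<forall>v \<in> T ` V. B v = A (inv_into V T v)) \<and>
       f = (\<lambda>x. trace_op (B \<circ> \<pi> x)))"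

text \<open>A version of the value at the Hilbert-Schmidt operator \<open>A\<close> of the continuous extension.\<close>

definition fourier_wigner ::
    "('g \<Rightarrow> 'h::chilbert_space \<Rightarrow> 'h) \<Rightarrow> 'h set \<Rightarrow> ('h \<Rightarrow> 'h) \<Rightarrow> ('h \<Rightarrow> 'h) \<Rightarrow> 'g \<Rightarrow> complex" where
  "fourier_wigner \<pi> V T A = (SOME f. \<exists>As fs.
     (\<forall>k. is_fourier_wigner_dense \<pi> V T (As k) (fs k)) \<and>
     (\<lambda>k. hs_norm (\<lambda>v. As k v - A v)) \<longlonglongrightarrow> 0 \<and> L2_tendsto \<mu>\<^sub>r fs f)"

definition dequantization ::
    "('g \<Rightarrow> real) \<Rightarrow> ((real ^ 'm) \<Rightarrow>\<^sub>L real) \<Rightarrow> ('g \<Rightarrow> 'h::chilbert_space \<Rightarrow> 'h) \<Rightarrow> 'h set \<Rightarrow> ('h \<Rightarrow> 'h)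
      \<Rightarrow> ('h \<Rightarrow> 'h) \<Rightarrow> 'g \<Rightarrow> complex" where
  "dequantization \<Delta> F \<pi> V T A = fourier_kirillov \<Delta> F (fourier_wigner \<pi> V T A)"

definition wigner ::
    "('g \<Rightarrow> real) \<Rightarrow> ((real ^ 'm) \<Rightarrow>\<^sub>L real) \<Rightarrow> ('g \<Rightarrow> 'h::chilbert_space \<Rightarrow> 'h) \<Rightarrow> 'h set \<Rightarrow> ('h \<Rightarrow> 'h)
      \<Rightarrow> 'h \<Rightarrow> 'h \<Rightarrow> 'g \<Rightarrow> complex" where
  "wigner \<Delta> F \<pi> V T \<psi> \<phi> = dequantization \<Delta> F \<pi> V T (rank_one \<psi> \<phi>)"

end


section \<open>The standing setting\<close>

locale orbit_method_setting = based_exponential_lie_group G Exp n X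
  for G :: "('g, 'b) monoid_scheme" (structure) and Exp :: "real ^ 'm \<Rightarrow> 'g"
    and n :: nat and X :: "nat \<Rightarrow> real ^ 'm" +
  fixes \<mu>\<^sub>l :: "'g measure" and \<Delta> :: "'g \<Rightarrow> real"
    and F :: "(real ^ 'm) \<Rightarrow>\<^sub>L real" and \<hh> :: "(real ^ 'm) set"
    and \<pi> :: "'g \<Rightarrow> 'h::chilbert_space \<Rightarrow> 'h"
    and V :: "'h set" and T :: "'h \<Rightarrow> 'h"
  assumes left_haar: "left_haar (carrier G) \<mu>\<^sub>l"
    and modular: "modular (carrier G) \<mu>\<^sub>l \<Delta>"
    and left_right: "\<mu>\<^sub>l = density \<mu>\<^sub>r (\<lambda>x. ennreal (\<Delta> x))"
    and trivial_stabilizer: "{g \<in> carrier G. K g F = F} = {\<one>}"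
    and kappa_measure: "distr \<mu>\<^sub>r borel (\<kappa> F) = density dY
          (\<lambda>Y. indicator (orbit F) Y *
             ennreal (\<bar>Pf F\<bar> * \<Delta> (inv_into (carrier G) (\<kappa> F) Y)))"
    and polarization: "pukanszky_polarization F \<hh>"
    and unitary: "unitary_rep \<pi>"
    and irreducible: "irreducible_rep \<pi>"
    and induced: "equiv_induced \<pi> \<mu>\<^sub>l \<Delta> (Exp ` \<hh>) (char_F F)"
    and square_integrable: "square_integrable_rep \<pi>"
    and duflo_moore: "duflo_moore_inverse \<pi> V T"

end

(* If B is the bounded extension of A D and T = D^-1, then B^* maps into dom T and T B^* = A^*, because
   T is self-adjoint.  So tr(B pi(x)) = sum_e W_{B^* e} e (x), an orthogonal series in L^2 by the
   Duflo-Moore relations, with square norm sum_e |A^* e|^2;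
   hence the densely defined Fourier-Wigner transform is bounded by the Hilbert-Schmidt norm and
   its values on psi (x) phi are the L^2 limits of W_{v_k} psi for any v_k with T v_k -> phi.
   These are linear in psi and antilinear in v_k.  The Fourier-Kirillov transform is linear because
   the Fourier transform is an L^2 contraction (Gaussian regularisation), and it lands in L^2
   because kappa transports the measure.

   As trace class means absolute convergence of the diagonal in every orthonormal basis, the
   convergence of sum_e <B pi(x) e, e> needs an argument: a gliding hump bounds |tr(P B)| uniformly
   over finite rank projections P, and approximate diagonalisation of the Hermitian parts of B on
   finite-dimensional subspaces turns this into a bound for every rotated diagonal. *)

theory Submission
  imports Defs "HOL-Probability.Characteristic_Functions"
begin

section \<open>Hilbert space geometry\<close>

text \<open>Both transforms are defined by choosing some limit of some admissible sequence, so
  linearity can be discussed only once a limit is known to exist and any two limits are known to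
  agree almost everywhere. Existence comes from explicit sequences: the operators
  \<open>rank_one \<psi> (T v)\<close> on one side, truncated functions on the other. Uniqueness
  needs an estimate valid for every admissible sequence, and on the Wigner side this forces the
  analysis of an arbitrary trace class \<open>B\<close>: the definition controls the diagonals <B e,
  e>, whereas \<open>trace_op (B \<circ> \<pi> x)\<close> sums <B pi(x) e, e>, a diagonal rotated by
  a unitary operator. Three facts about the group are given only implicitly and have to be extracted
  from the chart. The modular function is specified by how it scales a measure, so its measurability
  is a lemma; the inverse of \<open>\<kappa> F\<close> has to be shown measurable on the orbit; and
  nonempty open sets must have positive measure, since this makes \<open>T\<close> injective and
  hence gives it dense range.\<close>

lemma cinner_add_right: "cinner x (y + z) = cinner x y + cinner (x::'h::chilbert_space) z"
  by (metis cinner_add_left cinner_commute complex_cnj_add)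

lemma cinner_scaleC_right: "cinner x (a *\<^sub>C y) = cnj a * cinner (x::'h::chilbert_space) y"
  by (metis cinner_commute cinner_scaleC_left complex_cnj_mult)

lemma scaleC_one [simp]: "1 *\<^sub>C x = (x::'h::chilbert_space)"
  by (metis of_real_1 scaleR_one scaleR_scaleC)

lemma scaleC_zero_left [simp]: "0 *\<^sub>C x = (0::'h::chilbert_space)"
  by (metis of_real_0 scaleR_zero_left scaleR_scaleC)

lemma scaleC_zero_right [simp]: "a *\<^sub>C (0::'h::chilbert_space) = 0"
  by (metis add_cancel_right_right scaleC_add_right)

lemma scaleC_minus_right: "a *\<^sub>C (- x) = - (a *\<^sub>C (x::'h::chilbert_space))"
  by (metis add.right_inverse add_eq_0_iff scaleC_add_right scaleC_zero_right)

lemma scaleC_diff_right: "a *\<^sub>C (x - y) = a *\<^sub>C x - a *\<^sub>C (y::'h::chilbert_space)"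
  by (metis scaleC_add_right scaleC_minus_right uminus_add_conv_diff add.commute)

lemma scaleC_uminus1: "(-1) *\<^sub>C x = - (x::'h::chilbert_space)"
  by (metis of_real_1 of_real_minus scaleR_minus1_left scaleR_scaleC)

lemma scaleC_minus_left: "(- a) *\<^sub>C x = - (a *\<^sub>C (x::'h::chilbert_space))"
  by (metis add.right_inverse add_eq_0_iff scaleC_add_left scaleC_zero_left)

lemma scaleC_diff_left: "(a - b) *\<^sub>C x = a *\<^sub>C x - b *\<^sub>C (x::'h::chilbert_space)"
  by (metis scaleC_add_left scaleC_minus_left uminus_add_conv_diff add.commute)

lemma cinner_zero_left [simp]: "cinner 0 (x::'h::chilbert_space) = 0"
  by (metis add_cancel_right_right cinner_add_left)

lemma cinner_zero_right [simp]: "cinner (x::'h::chilbert_space) 0 = 0"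
  by (metis cinner_commute cinner_zero_left complex_cnj_zero)

lemma cinner_minus_left: "cinner (- x) y = - cinner (x::'h::chilbert_space) y"
  by (metis add.right_inverse add_eq_0_iff cinner_add_left cinner_zero_left)

lemma cinner_minus_right: "cinner x (- y) = - cinner (x::'h::chilbert_space) y"
  by (metis cinner_commute cinner_minus_left complex_cnj_minus)

lemma cinner_diff_left: "cinner (x - y) z = cinner x z - cinner (y::'h::chilbert_space) z"
  by (metis cinner_add_left cinner_minus_left uminus_add_conv_diff add.commute)

lemma cinner_diff_right: "cinner x (y - z) = cinner x y - cinner (x::'h::chilbert_space) z"
  by (metis cinner_add_right cinner_minus_right uminus_add_conv_diff add.commute)

lemma cinner_sum_left: "cinner (\<Sum>i\<in>I. f i) (y::'h::chilbert_space) = (\<Sum>i\<in>I. cinner (f i) y)"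
  by (induction I rule: infinite_finite_induct) (auto simp: cinner_add_left)

lemma cinner_sum_right: "cinner (y::'h::chilbert_space) (\<Sum>i\<in>I. f i) = (\<Sum>i\<in>I. cinner y (f i))"
  by (induction I rule: infinite_finite_induct) (auto simp: cinner_add_right)

lemma scaleC_sum_right: "a *\<^sub>C (\<Sum>i\<in>I. f i) = (\<Sum>i\<in>I. a *\<^sub>C (f i::'h::chilbert_space))"
  by (induction I rule: infinite_finite_induct) (auto simp: scaleC_add_right)

lemma cinner_self: "cinner x x = complex_of_real ((norm (x::'h::chilbert_space))\<^sup>2)"
proof -
  have "Im (cinner x x) = 0"
    using arg_cong[OF cinner_commute[of x x], of Im] by simp
  moreover have "Re (cinner x x) = (norm x)\<^sup>2"
    by (metis inner_eq_Re_cinner power2_norm_eq_inner)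
  ultimately show ?thesis by (simp add: complex_eq_iff)
qed

lemma cinner_eq_zero_iff: "cinner x x = 0 \<longleftrightarrow> (x::'h::chilbert_space) = 0"
  by (simp add: cinner_self)

lemma norm_scaleC: "norm (a *\<^sub>C x) = cmod a * norm (x::'h::chilbert_space)"
proof -
  have "complex_of_real ((norm (a *\<^sub>C x))\<^sup>2) = a * cnj a * cinner x x"
    by (simp only: cinner_self[symmetric] cinner_scaleC_left cinner_scaleC_right mult_ac)
  also have "\<dots> = complex_of_real ((cmod a * norm x)\<^sup>2)"
    by (simp add: cinner_self complex_norm_square[symmetric] power_mult_distrib)
  finally have "(norm (a *\<^sub>C x))\<^sup>2 = (cmod a * norm x)\<^sup>2"
    using of_real_eq_iff by blast
  then show ?thesis by (simp add: power2_eq_iff_nonneg)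
qed

text \<open>Multiplying \<open>x\<close> by a phase makes the complex inner product equal to its
  modulus, so that the real Cauchy-Schwarz inequality applies.\<close>

lemma cmod_cinner_le: "cmod (cinner x y) \<le> norm x * norm (y::'h::chilbert_space)"
proof (cases "cinner x y = 0")
  case False
  define c where "c = cnj (sgn (cinner x y))"
  have c: "cmod c = 1" using False by (simp add: c_def norm_sgn)
  have "c * cinner x y = complex_of_real (cmod (cinner x y))"
    using False complex_norm_square[of "cinner x y"] unfolding c_def sgn_eq
    by (simp add: field_simps power2_eq_square)
  then have "cmod (cinner x y) = Re (c * cinner x y)" by simp
  also have "\<dots> = (c *\<^sub>C x) \<bullet> y" by (simp add: inner_eq_Re_cinner cinner_scaleC_left)
  also have "\<dots> \<le> norm (c *\<^sub>C x) * norm y" by (rule norm_cauchy_schwarz)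
  finally show ?thesis by (simp add: norm_scaleC c)
qed simp

lemma scaleR_cinner_left: "cinner (r *\<^sub>R x) y = complex_of_real r * cinner (x::'h::chilbert_space) y"
  by (simp add: scaleR_scaleC cinner_scaleC_left)

lemma scaleR_cinner_right: "cinner x (r *\<^sub>R y) = complex_of_real r * cinner (x::'h::chilbert_space) y"
  by (simp add: scaleR_scaleC cinner_scaleC_right)

lemma bounded_linear_cinner_left: "bounded_linear (\<lambda>x. cinner x (y::'h::chilbert_space))"
  by (rule bounded_linear_intro[where K = "norm y"])
     (auto simp: cinner_add_left scaleR_cinner_left scaleR_conv_of_real cmod_cinner_le)

lemma bounded_linear_scaleC: "bounded_linear (\<lambda>x::'h::chilbert_space. a *\<^sub>C x)"
  by (rule bounded_linear_intro[where K = "cmod a"])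
     (auto simp: scaleC_add_right norm_scaleC scaleR_scaleC scaleC_scaleC mult.commute)

lemma cinner_eq_0I: "(x::'h::chilbert_space) = 0" if "\<And>y. cinner x y = 0"
  using that[of x] by (simp add: cinner_eq_zero_iff)

lemma cinner_eqI: "(x::'h::chilbert_space) = y" if "\<And>z. cinner x z = cinner y z"
  using cinner_eq_0I[of "x - y"] that by (simp add: cinner_diff_left)

lemma cinner_eqI': "(x::'h::chilbert_space) = y" if "\<And>z. cinner z x = cinner z y"
  by (rule cinner_eqI) (metis that cinner_commute)

section \<open>Closed subspaces, orthogonal projection and Riesz representation\<close>

lemma csubspace_closure:
  assumes "csubspace (S::'h::chilbert_space set)"
  shows "csubspace (closure S)"
  unfolding csubspace_def
proof (intro conjI ballI allI)
  show "0 \<in> closure S" using assms closure_subset[of S] by (auto simp: csubspace_def)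
next
  fix x y assume "x \<in> closure S" "y \<in> closure S"
  then obtain u v where "\<forall>n. u n \<in> S" "u \<longlonglongrightarrow> x" "\<forall>n. v n \<in> S" "v \<longlonglongrightarrow> y"
    unfolding closure_sequential by auto
  then show "x + y \<in> closure S"
    using assms tendsto_add[of u x sequentially v y]
    unfolding closure_sequential csubspace_def by (intro exI[of _ "\<lambda>n. u n + v n"]) auto
next
  fix c x assume "x \<in> closure S"
  then obtain u where "\<forall>n. u n \<in> S" "u \<longlonglongrightarrow> x" unfolding closure_sequential by auto
  then show "c *\<^sub>C x \<in> closure S"
    using assms bounded_linear.tendsto[OF bounded_linear_scaleC, of u x sequentially c]
    unfolding closure_sequential csubspace_def by (intro exI[of _ "\<lambda>n. c *\<^sub>C u n"]) auto
qed

lemma csubspace_diff: "csubspace S \<Longrightarrow> x \<in> S \<Longrightarrow> y \<in> S \<Longrightarrow> x - y \<in> S"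
  unfolding csubspace_def by (metis scaleC_uminus1 uminus_add_conv_diff add.commute)

text \<open>The first-variation argument at a minimum: t = 1 and t = -1 give b > 0 unless a = 0, and
  then t = a / b makes the quadratic negative.\<close>

lemma quadratic_nonneg_imp_zero:
  fixes a b :: real
  assumes "\<And>t. 0 \<le> t\<^sup>2 * b - 2 * t * a"
  shows "a = 0"
proof (rule ccontr)
  assume a: "a \<noteq> 0"
  have b: "0 \<le> b + 2*a" "0 \<le> b - 2*a" using assms[of 1] assms[of "-1"] by auto
  then have b: "b > 0" using a by linarith
  have "0 \<le> (a / b)\<^sup>2 * b - 2 * (a / b) * a" by (rule assms)
  also have "\<dots> = - (a * a) / b" using b by (simp add: power2_eq_square field_simps)
  finally show False using a b by (smt (verit) divide_neg_pos mult_neg_neg mult_pos_pos)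
qed

text \<open>A minimising sequence for the distance is Cauchy by the parallelogram law, because the
  midpoint of two terms stays in \<open>S\<close> and cannot be closer than the infimum. The first
  variation at the limit gives orthogonality for the real inner product only.\<close>

lemma orthogonal_projection_exists:
  assumes S: "csubspace (S::'h::chilbert_space set)" "closed S"
  shows "\<exists>p\<in>S. \<forall>s\<in>S. cinner (x - p) s = 0"
proof -
  define D where "D = (\<lambda>s. (norm (x - s))\<^sup>2) ` S"
  define d where "d = Inf D"
  have ne: "D \<noteq> {}" and bd: "bdd_below D"
    using S by (auto simp: D_def csubspace_def intro!: bdd_belowI[of _ 0])
  have dle: "d \<le> (norm (x - s))\<^sup>2" if "s \<in> S" for s
    unfolding d_def using that bd by (intro cInf_lower) (auto simp: D_def)
  have "\<exists>s\<in>S. (norm (x - s))\<^sup>2 < d + 1 / real (Suc k)" for k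
    using cInf_lessD[OF ne, of "d + 1 / real (Suc k)"] by (auto simp: d_def D_def)
  then obtain s where s: "\<And>k. s k \<in> S" "\<And>k. (norm (x - s k))\<^sup>2 < d + 1 / real (Suc k)" by metis
  have par: "(norm (s j - s k))\<^sup>2 \<le> 2 * (1 / real (Suc j)) + 2 * (1 / real (Suc k))" for j k
  proof -
    have half: "(1/2) *\<^sub>R (s j + s k) \<in> S"
      using S(1) s(1) unfolding csubspace_def scaleR_scaleC by blast
    have "(norm (s j - s k))\<^sup>2 + 4 * (norm (x - (1/2) *\<^sub>R (s j + s k)))\<^sup>2
        = 2 * (norm (x - s j))\<^sup>2 + 2 * (norm (x - s k))\<^sup>2"
      unfolding power2_norm_eq_inner
      by (simp add: inner_diff_left inner_diff_right inner_add_left inner_add_right inner_commute algebra_simps)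
    then show ?thesis using dle[OF half] s(2)[of j] s(2)[of k] by linarith
  qed
  have "Cauchy s"
  proof (rule metric_CauchyI)
    fix e :: real assume e: "e > 0"
    obtain N where N: "4 / e\<^sup>2 < real N" using reals_Archimedean2 by blast
    have "dist (s j) (s k) < e" if "j \<ge> N" "k \<ge> N" for j k
    proof -
      have N0: "real N > 0" using N e by (smt (verit) divide_pos_pos zero_less_power)
      have b: "1 / real (Suc i) < e\<^sup>2 / 4" if "i \<ge> N" for i
      proof -
        have "1 / real (Suc i) < 1 / real N" using that N0 by (intro divide_strict_left_mono) auto
        also have "\<dots> < e\<^sup>2/4" using N N0 e by (simp add: field_simps)
        finally show ?thesis .
      qed
      have "(norm (s j - s k))\<^sup>2 < e\<^sup>2" using par[of j k] b[OF that(1)] b[OF that(2)] by linarith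
      then show ?thesis using e by (simp add: dist_norm power2_less_imp_less)
    qed
    then show "\<exists>M. \<forall>m\<ge>M. \<forall>n\<ge>M. dist (s m) (s n) < e" by blast
  qed
  then obtain p where p: "s \<longlonglongrightarrow> p" using Cauchy_convergent convergent_def by blast
  have pS: "p \<in> S" using S(2) s(1) p closed_sequentially by blast
  have "(\<lambda>k. (norm (x - s k))\<^sup>2) \<longlonglongrightarrow> (norm (x - p))\<^sup>2" by (intro tendsto_intros p)
  moreover have "(\<lambda>k. d + 1 / real (Suc k)) \<longlonglongrightarrow> d + 0"
    by (intro tendsto_intros LIMSEQ_Suc[OF lim_1_over_n])
  ultimately have pd: "(norm (x - p))\<^sup>2 \<le> d + 0"
    by (rule LIMSEQ_le) (use s(2) in \<open>auto intro: less_imp_le\<close>)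
  have re: "(x - p) \<bullet> s = 0" if "s \<in> S" for s
  proof (rule quadratic_nonneg_imp_zero)
    fix t :: real
    have "p + t *\<^sub>R s \<in> S" using S(1) pS that unfolding csubspace_def scaleR_scaleC by blast
    from dle[OF this] pd have "(norm (x - p))\<^sup>2 \<le> (norm ((x - p) - t *\<^sub>R s))\<^sup>2"
      unfolding diff_diff_eq by linarith
    then show "0 \<le> t\<^sup>2 * (norm s)\<^sup>2 - 2 * t * ((x - p) \<bullet> s)"
      unfolding power2_norm_eq_inner
      by (simp add: inner_diff_left inner_diff_right inner_commute power2_eq_square algebra_simps)
  qed
  have "cinner (x - p) s = 0" if "s \<in> S" for s
  proof -
    \<comment> \<open>Testing with i s recovers the imaginary part, since Re <z, i s> = Im <z,
      s>.\<close>
    have "\<i> *\<^sub>C s \<in> S" using that S(1) by (auto simp: csubspace_def)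
    from re[OF this] have "Im (cinner (x - p) s) = 0"
      by (simp add: inner_eq_Re_cinner cinner_scaleC_right)
    then show ?thesis using re[OF that] by (simp add: inner_eq_Re_cinner complex_eq_iff)
  qed
  then show ?thesis using pS by blast
qed

lemma dense_if_orthogonal_trivial:
  assumes S: "csubspace (S::'h::chilbert_space set)" and triv: "\<And>y. (\<forall>s\<in>S. cinner s y = 0) \<Longrightarrow> y = 0"
  shows "closure S = UNIV"
proof -
  have "x \<in> closure S" for x
  proof -
    obtain p where p: "p \<in> closure S" "\<forall>s\<in>closure S. cinner (x - p) s = 0"
      using orthogonal_projection_exists[OF csubspace_closure[OF S]] by auto
    have "x - p = 0" by (rule triv) (use p closure_subset in \<open>metis cinner_commute complex_cnj_zero subsetD\<close>)
    then show ?thesis using p by simp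
  qed
  then show ?thesis by auto
qed

text \<open>The residual q of a vector outside the closed kernel is orthogonal to the kernel, and y
  - (\<phi> y / \<phi> q) q always lies in the kernel; pairing it with q determines \<phi>
  y.\<close>

lemma riesz_representation:
  fixes \<phi> :: "'h::chilbert_space \<Rightarrow> complex"
  assumes add: "\<And>x y. \<phi> (x + y) = \<phi> x + \<phi> y" and scale: "\<And>c x. \<phi> (c *\<^sub>C x) = c * \<phi> x"
    and bound: "\<And>x. cmod (\<phi> x) \<le> C * norm x"
  shows "\<exists>z. \<forall>x. \<phi> x = cinner x z"
proof (cases "\<forall>x. \<phi> x = 0")
  case True
  then show ?thesis by (intro exI[of _ 0]) simp
next
  case False
  then obtain x where x: "\<phi> x \<noteq> 0" by blast
  have bl: "bounded_linear \<phi>"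
    by (rule bounded_linear_intro[where K = C])
       (use bound in \<open>auto simp: add scaleR_scaleC scale scaleR_conv_of_real mult.commute\<close>)
  define N where "N = {x. \<phi> x = 0}"
  have "csubspace N" using scale[of 0] by (auto simp: csubspace_def N_def add scale)
  moreover have "closed N" unfolding N_def
    by (intro closed_Collect_eq continuous_intros linear_continuous_on bl)
  ultimately obtain p where p: "p \<in> N" "\<forall>s\<in>N. cinner (x - p) s = 0"
    using orthogonal_projection_exists by blast
  define q where "q = x - p"
  have \<phi>q: "\<phi> q = \<phi> x"
    using p(1) linear_diff[OF bounded_linear.linear[OF bl]] by (simp add: q_def N_def)
  then have q: "q \<noteq> 0" using x scale[of 0 0] by auto
  have "\<phi> y = cinner y ((cnj (\<phi> q) / of_real ((norm q)\<^sup>2)) *\<^sub>C q)" for y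
  proof -
    have "y - (\<phi> y / \<phi> q) *\<^sub>C q \<in> N"
      using x \<phi>q by (simp add: N_def linear_diff[OF bounded_linear.linear[OF bl]] scale)
    then have "cinner q (y - (\<phi> y / \<phi> q) *\<^sub>C q) = 0" using p by (simp add: q_def)
    then have "cinner (y - (\<phi> y / \<phi> q) *\<^sub>C q) q = 0" by (metis cinner_commute complex_cnj_zero)
    then have "cinner y q = \<phi> y / \<phi> q * of_real ((norm q)\<^sup>2)"
      by (simp add: cinner_diff_left cinner_scaleC_left cinner_self)
    then show ?thesis using x \<phi>q q by (simp add: cinner_scaleC_right field_simps)
  qed
  then show ?thesis by blast
qed

section \<open>Bounded operators and their adjoints\<close>

lemma bounded_op_add: "bounded_op A \<Longrightarrow> A (x + y) = A x + A y"
  and bounded_op_scaleC: "bounded_op A \<Longrightarrow> A (c *\<^sub>C x) = c *\<^sub>C A x"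
  by (auto simp: bounded_op_def clinear_on_def)

lemma bounded_op_bound:
  assumes "bounded_op A" obtains C where "C \<ge> 0" "\<And>x. norm (A x) \<le> C * norm x"
proof -
  obtain C where "\<And>x. norm (A x) \<le> C * norm x" using assms by (auto simp: bounded_op_def)
  then have "norm (A x) \<le> max C 0 * norm x" for x
    by (meson max.cobounded1 mult_right_mono norm_ge_zero order_trans)
  then show ?thesis using that[of "max C 0"] by auto
qed

lemma bounded_op_bounded_linear: "bounded_op A \<Longrightarrow> bounded_linear A"
proof -
  assume A: "bounded_op A"
  then obtain C where "\<And>x. norm (A x) \<le> C * norm x" using bounded_op_bound by blast
  with A show "bounded_linear A"
    by (intro bounded_linear_intro[where K = C])
       (auto simp: bounded_op_add scaleR_scaleC bounded_op_scaleC mult.commute)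
qed

lemma bounded_op_adjoint_exists:
  assumes A: "bounded_op (A::'h::chilbert_space \<Rightarrow> 'h)"
  obtains B where "bounded_op B" "\<And>x y. cinner (A x) y = cinner x (B y)"
proof -
  obtain C where C: "C \<ge> 0" "\<And>x. norm (A x) \<le> C * norm x" using bounded_op_bound[OF A] by blast
  have "\<exists>z. \<forall>x. cinner (A x) y = cinner x z" for y
  proof (rule riesz_representation)
    show "cmod (cinner (A x) y) \<le> (C * norm y) * norm x" for x
      using cmod_cinner_le[of "A x" y] mult_right_mono[OF C(2)[of x] norm_ge_zero[of y]]
      by (simp add: mult_ac)
  qed (simp_all add: bounded_op_add[OF A] bounded_op_scaleC[OF A] cinner_add_left cinner_scaleC_left)
  then obtain B where B: "\<And>x y. cinner (A x) y = cinner x (B y)" by metis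
  have "norm (B y) \<le> C * norm y" for y
  proof -
    have "(norm (B y))\<^sup>2 = cmod (cinner (A (B y)) y)" by (simp add: B cinner_self norm_power)
    also have "\<dots> \<le> C * norm (B y) * norm y"
      using cmod_cinner_le[of "A (B y)" y] mult_right_mono[OF C(2)[of "B y"] norm_ge_zero[of y]] by simp
    finally show ?thesis using C(1)
      by (cases "B y = 0") (auto simp: power2_eq_square mult_ac)
  qed
  moreover have "B (x + y) = B x + B y" for x y
    by (rule cinner_eqI') (simp add: cinner_add_right flip: B)
  moreover have "B (c *\<^sub>C x) = c *\<^sub>C B x" for c x
    by (rule cinner_eqI') (simp add: cinner_scaleC_right flip: B)
  ultimately have "bounded_op B" unfolding bounded_op_def clinear_on_def by blast
  then show ?thesis using that B by blast
qed

section \<open>Orthonormal systems\<close>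

definition ons :: "'h::chilbert_space set \<Rightarrow> bool" where
  "ons E \<longleftrightarrow> (\<forall>e\<in>E. \<forall>f\<in>E. cinner e f = (if e = f then 1 else 0))"

lemma onb_imp_ons: "onb E \<Longrightarrow> ons E"
  by (simp add: onb_def ons_def)

lemma ons_subset: "ons E \<Longrightarrow> J \<subseteq> E \<Longrightarrow> ons J"
  unfolding ons_def by blast

lemma ons_norm: "ons E \<Longrightarrow> e \<in> E \<Longrightarrow> norm e = 1"
  using cinner_self[of e] unfolding ons_def
  by (metis norm_ge_zero of_real_eq_1_iff power2_eq_1_iff neg_0_le_iff_le not_one_le_zero)

lemma norm_eq_1_cinner: "norm (x::'h::chilbert_space) = 1 \<Longrightarrow> cinner x x = 1"
  by (simp add: cinner_self)

lemma ons_insertI: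
  assumes "ons J" "norm x = 1" "\<And>j. j \<in> J \<Longrightarrow> cinner x j = 0"
  shows "ons (insert x J)" 
proof -
  have "cinner j x = 0" if "j \<in> J" for j
    using assms(3)[OF that] by (metis cinner_commute complex_cnj_zero)
  moreover have "x \<notin> J" using assms(2,3) norm_eq_1_cinner by force
  ultimately show ?thesis using assms by (auto simp: ons_def norm_eq_1_cinner)
qed

lemma ons_union:
  assumes "ons J" "ons J'" "\<And>x y. x \<in> J \<Longrightarrow> y \<in> J' \<Longrightarrow> cinner x y = 0"
  shows "ons (J \<union> J')" "J \<inter> J' = {}"
proof -
  have *: "cinner y x = 0" if "x \<in> J" "y \<in> J'" for x y
    using assms(3)[OF that] by (metis cinner_commute complex_cnj_zero)
  show d: "J \<inter> J' = {}"
  proof (rule ccontr)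
    assume "J \<inter> J' \<noteq> {}"
    then obtain x where "x \<in> J" "x \<in> J'" by blast
    then show False using assms(1) assms(3)[of x x] by (auto simp: ons_def)
  qed
  show "ons (J \<union> J')" using assms * d by (auto simp: ons_def)
qed

lemma ons_extends_to_onb:
  assumes "ons (J::'h::chilbert_space set)"
  obtains E where "onb E" "J \<subseteq> E"
proof -
  define \<A> where "\<A> = {E. ons E \<and> J \<subseteq> E}"
  have "\<exists>M\<in>\<A>. \<forall>X\<in>\<A>. M \<subseteq> X \<longrightarrow> X = M"
  proof (rule subset_Zorn_nonempty)
    show "\<A> \<noteq> {}" using assms by (auto simp: \<A>_def)
    fix \<C> assume c: "\<C> \<noteq> {}" "subset.chain \<A> \<C>"
    have "ons (\<Union>\<C>)" unfolding ons_def
    proof (intro ballI)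
      fix e f assume "e \<in> \<Union>\<C>" "f \<in> \<Union>\<C>"
      then obtain A B where AB: "A \<in> \<C>" "B \<in> \<C>" "e \<in> A" "f \<in> B" by blast
      then have "A \<subseteq> B \<or> B \<subseteq> A" using c unfolding subset_chain_def by blast
      then obtain D where "D \<in> \<C>" "e \<in> D" "f \<in> D" using AB by blast
      moreover have "ons D" using c \<open>D \<in> \<C>\<close> by (auto simp: subset_chain_def \<A>_def)
      ultimately show "cinner e f = (if e = f then 1 else 0)" by (auto simp: ons_def)
    qed
    moreover have "J \<subseteq> \<Union>\<C>" using c unfolding subset_chain_def \<A>_def by blast
    ultimately show "\<Union>\<C> \<in> \<A>" by (simp add: \<A>_def)
  qed
  then obtain E where "E \<in> \<A>" and max': "\<And>X. X \<in> \<A> \<Longrightarrow> E \<subseteq> X \<Longrightarrow> X = E" by metis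
  then have E: "ons E" "J \<subseteq> E" by (auto simp: \<A>_def)
  have max: "X = E" if "ons X" "J \<subseteq> X" "E \<subseteq> X" for X
    using that by (intro max') (auto simp: \<A>_def)
  have "x = 0" if "\<forall>e\<in>E. cinner x e = 0" for x
  proof (rule ccontr)
    assume x: "x \<noteq> 0"
    define u where "u = (1 / norm x) *\<^sub>R x"
    have u: "norm u = 1" "\<And>e. e \<in> E \<Longrightarrow> cinner u e = 0"
      using x that by (auto simp: u_def scaleR_cinner_left)
    have "insert u E = E" using ons_insertI[OF E(1) u] E(2) by (intro max) auto
    then have "u \<in> E" by blast
    then show False using u norm_eq_1_cinner by force
  qed
  then show ?thesis using that E by (auto simp: onb_def ons_def)
qed

text \<open>Makes the basis chosen in \<open>trace_op\<close> and \<open>hs_norm\<close> a genuine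
  orthonormal basis.\<close>

lemma onb_exists: "onb (SOME E::'h::chilbert_space set. onb E)"
proof -
  have "\<exists>E::'h set. onb E" using ons_extends_to_onb[of "{}"] by (auto simp: ons_def)
  then show ?thesis by (rule someI_ex)
qed

text \<open>For a finite orthonormal \<open>J\<close> the equation \<open>proj_ons J x = x\<close>
  serves throughout as membership of \<open>x\<close> in the complex span of
  \<open>J\<close>.\<close>

definition proj_ons :: "'h::chilbert_space set \<Rightarrow> 'h \<Rightarrow> 'h" where
  "proj_ons J x = (\<Sum>e\<in>J. cinner x e *\<^sub>C e)"

lemma proj_ons_residual_orthogonal:
  assumes "ons J" "finite J" "e \<in> J"
  shows "cinner (x - proj_ons J x) e = 0"
proof -
  have "cinner (proj_ons J x) e = (\<Sum>f\<in>J. if f = e then cinner x e else 0)"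
    unfolding proj_ons_def cinner_sum_left
    by (rule sum.cong) (use assms in \<open>auto simp: cinner_scaleC_left ons_def\<close>)
  then show ?thesis using assms by (simp add: cinner_diff_left)
qed

lemma pythagoras:
  assumes "cinner x y = 0" shows "(norm (x + y))\<^sup>2 = (norm x)\<^sup>2 + (norm (y::'h::chilbert_space))\<^sup>2"
  using assms unfolding power2_norm_eq_inner
  by (simp add: inner_add_left inner_add_right inner_commute[of y x]) (simp add: inner_eq_Re_cinner)

lemma norm_sum_ons:
  assumes "ons J" "finite J"
  shows "(norm (\<Sum>e\<in>J. c e *\<^sub>C e))\<^sup>2 = (\<Sum>e\<in>J. (cmod (c e))\<^sup>2)"
  using assms(2,1)
proof (induction J)
  case (insert j J)
  have "cinner (c j *\<^sub>C j) (\<Sum>e\<in>J. c e *\<^sub>C e) = 0"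
    unfolding cinner_sum_right
    by (rule sum.neutral) (use insert in \<open>auto simp: cinner_scaleC_right cinner_scaleC_left ons_def\<close>)
  from pythagoras[OF this] show ?case
    using insert ons_norm[of "insert j J" j] ons_subset[of "insert j J" J]
    by (auto simp: norm_scaleC)
qed simp

lemma bessel:
  assumes "ons J" "finite J"
  shows "(\<Sum>e\<in>J. (cmod (cinner x e))\<^sup>2) \<le> (norm x)\<^sup>2"
proof -
  have "cinner (x - proj_ons J x) (proj_ons J x) = 0"
    by (subst (2) proj_ons_def)
       (use proj_ons_residual_orthogonal[OF assms] in \<open>simp add: cinner_sum_right cinner_scaleC_right\<close>)
  from pythagoras[OF this] have "(norm x)\<^sup>2 \<ge> (norm (proj_ons J x))\<^sup>2" by simp
  then show ?thesis unfolding proj_ons_def norm_sum_ons[OF assms] .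
qed

lemma proj_ons_best:
  assumes "ons J" "finite J"
  shows "norm (x - proj_ons J x) \<le> norm (x - (\<Sum>e\<in>J. c e *\<^sub>C e))"
proof -
  define y where "y = (\<Sum>e\<in>J. c e *\<^sub>C e)"
  have "cinner (x - proj_ons J x) (proj_ons J x) = 0"
    by (subst (2) proj_ons_def)
       (use proj_ons_residual_orthogonal[OF assms] in \<open>simp add: cinner_sum_right cinner_scaleC_right\<close>)
  moreover have "cinner (x - proj_ons J x) y = 0" unfolding y_def
    using proj_ons_residual_orthogonal[OF assms] by (simp add: cinner_sum_right cinner_scaleC_right)
  ultimately have "cinner (x - proj_ons J x) (proj_ons J x - y) = 0" by (simp add: cinner_diff_right)
  from pythagoras[OF this] have "(norm (x - proj_ons J x))\<^sup>2 \<le> (norm (x - y))\<^sup>2" by simp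
  then show ?thesis unfolding y_def by (rule power2_le_imp_le) simp
qed

text \<open>Finite combinations of basis vectors are dense because nothing nonzero is orthogonal to
  them. If one supported in \<open>J\<close> is within \<epsilon> of \<open>x\<close>, then by best
  approximation so is every partial sum over a finite superset of \<open>J\<close>, which is
  convergence of the net.\<close>

lemma onb_expansion:
  assumes E: "onb (E::'h::chilbert_space set)"
  shows "((\<lambda>e. cinner x e *\<^sub>C e) has_sum x) E"
proof -
  define S where "S = {y. \<exists>J c. finite J \<and> J \<subseteq> E \<and> y = (\<Sum>e\<in>J. c e *\<^sub>C e)}"
  have ext: "(\<Sum>e\<in>J. c e *\<^sub>C e) = (\<Sum>e\<in>J'. (if e \<in> J then c e else 0) *\<^sub>C e)"
    if "finite J'" "J \<subseteq> J'" for J J' and c :: "'h \<Rightarrow> complex"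
    using that by (intro sum.mono_neutral_cong_left) auto
  have "csubspace S" unfolding csubspace_def
  proof (intro conjI ballI allI)
    show "0 \<in> S" unfolding S_def by (auto intro!: exI[of _ "{}"])
  next
    fix x y assume "x \<in> S" "y \<in> S"
    then obtain J c K d where J: "finite J" "J \<subseteq> E" "x = (\<Sum>e\<in>J. c e *\<^sub>C e)"
      and K: "finite K" "K \<subseteq> E" "y = (\<Sum>e\<in>K. d e *\<^sub>C e)" unfolding S_def by auto
    have "x + y = (\<Sum>e\<in>J\<union>K. ((if e \<in> J then c e else 0) + (if e \<in> K then d e else 0)) *\<^sub>C e)"
      unfolding scaleC_add_left sum.distrib J(3) K(3)
      using ext[of "J \<union> K" J c] ext[of "J \<union> K" K d] J(1) K(1) by simp
    then show "x + y \<in> S" unfolding S_def using J K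
      by (intro CollectI exI[of _ "J \<union> K"] exI conjI) auto
  next
    fix a x assume "x \<in> S"
    then obtain J c where J: "finite J" "J \<subseteq> E" "x = (\<Sum>e\<in>J. c e *\<^sub>C e)" unfolding S_def by auto
    then show "a *\<^sub>C x \<in> S" unfolding S_def
      by (intro CollectI exI[of _ J] exI[of _ "\<lambda>e. a * c e"]) (auto simp: scaleC_sum_right scaleC_scaleC)
  qed
  moreover have "y = 0" if "\<forall>s\<in>S. cinner s y = 0" for y
  proof -
    have "e \<in> S" if "e \<in> E" for e unfolding S_def
      by (intro CollectI exI[of _ "{e}"] exI[of _ "\<lambda>_. 1"]) (use that in auto)
    then have "\<forall>e\<in>E. cinner y e = 0" using that by (metis cinner_commute complex_cnj_zero)
    then show ?thesis using E by (auto simp: onb_def)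
  qed
  ultimately have "closure S = UNIV" by (rule dense_if_orthogonal_trivial)
  then have cl: "x \<in> closure S" by simp
  show ?thesis unfolding has_sum_def tendsto_iff eventually_finite_subsets_at_top
  proof (intro allI impI)
    fix \<epsilon> :: real assume "\<epsilon> > 0"
    then obtain y where y: "y \<in> S" "dist y x < \<epsilon>" using cl closure_approachable by blast
    then obtain J c where J: "finite J" "J \<subseteq> E" "y = (\<Sum>e\<in>J. c e *\<^sub>C e)" unfolding S_def by auto
    show "\<exists>X. finite X \<and> X \<subseteq> E \<and>
       (\<forall>Y. finite Y \<and> X \<subseteq> Y \<and> Y \<subseteq> E \<longrightarrow> dist (\<Sum>e\<in>Y. cinner x e *\<^sub>C e) x < \<epsilon>)"
    proof (intro exI[of _ J] conjI J allI impI)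
      fix Y assume Y: "finite Y \<and> J \<subseteq> Y \<and> Y \<subseteq> E"
      have "ons Y" using E Y onb_imp_ons ons_subset by blast
      then have "norm (x - proj_ons Y x) \<le> norm (x - y)"
        unfolding J(3) using proj_ons_best[of Y x "\<lambda>e. if e \<in> J then c e else 0"] ext[of Y J c] Y by simp
      then show "dist (\<Sum>e\<in>Y. cinner x e *\<^sub>C e) x < \<epsilon>"
        using y(2) by (simp add: dist_norm norm_minus_commute proj_ons_def)
    qed
  qed
qed

lemma parseval_cinner:
  assumes "onb E" shows "((\<lambda>e. cinner x e * cinner e y) has_sum cinner x y) E"
  using has_sum_bounded_linear[OF bounded_linear_cinner_left[of y] onb_expansion[OF assms, of x]]
  by (simp add: cinner_scaleC_left)

lemma parseval_norm:
  assumes "onb E" shows "((\<lambda>e. (cmod (cinner x e))\<^sup>2) has_sum (norm x)\<^sup>2) E"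
proof -
  have "((\<lambda>e. Re (cinner x e * cinner e x)) has_sum Re (cinner x x)) E"
    by (rule has_sum_bounded_linear[OF bounded_linear_Re parseval_cinner[OF assms]])
  moreover have "Re (cinner x e * cinner e x) = (cmod (cinner x e))\<^sup>2" for e
    by (subst cinner_commute[of e x]) (simp add: complex_norm_square[symmetric] del: complex_cnj_mult)
  ultimately show ?thesis by (simp add: cinner_self)
qed

section \<open>Spans of finite orthonormal systems and exchange of a unit vector\<close>

lemma proj_ons_add: "proj_ons J (x + y) = proj_ons J x + proj_ons J y"
  by (simp add: proj_ons_def cinner_add_left scaleC_add_left sum.distrib)

lemma proj_ons_scaleC: "proj_ons J (c *\<^sub>C x) = c *\<^sub>C proj_ons J x"
  by (simp add: proj_ons_def cinner_scaleC_left scaleC_sum_right scaleC_scaleC)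

lemma proj_ons_diff: "proj_ons J (x - y) = proj_ons J x - proj_ons J y"
  by (simp add: proj_ons_def cinner_diff_left scaleC_diff_left sum_subtractf)

lemma proj_ons_sum: "proj_ons J (\<Sum>i\<in>I. f i) = (\<Sum>i\<in>I. proj_ons J (f i))"
  by (induction I rule: infinite_finite_induct) (auto simp: proj_ons_add, simp_all add: proj_ons_def)

lemma proj_ons_fixes:
  assumes "ons J" "finite J" "e \<in> J" shows "proj_ons J e = e"
proof -
  have "proj_ons J e = (\<Sum>f\<in>J. if f = e then e else 0)"
    unfolding proj_ons_def by (rule sum.cong) (use assms in \<open>auto simp: ons_def\<close>)
  then show ?thesis using assms by simp
qed

text \<open>Transitivity of span inclusion: \<open>x\<close> is a combination of vectors that
  \<open>proj_ons C\<close> already fixes.\<close>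

lemma proj_ons_trans:
  assumes "\<And>b. b \<in> B \<Longrightarrow> proj_ons C b = b" "proj_ons B x = x"
  shows "proj_ons C x = x"
proof -
  have "proj_ons C (proj_ons B x) = proj_ons B x"
    unfolding proj_ons_def[of B] proj_ons_sum proj_ons_scaleC using assms(1) by simp
  then show ?thesis by (simp add: assms(2))
qed

lemma cinner_proj_ons_orthogonal:
  assumes "proj_ons J x = x" "\<And>j. j \<in> J \<Longrightarrow> cinner j y = 0"
  shows "cinner x y = 0"
proof -
  have "cinner (proj_ons J x) y = 0"
    by (simp add: proj_ons_def cinner_sum_left cinner_scaleC_left assms(2))
  then show ?thesis by (simp add: assms(1))
qed

lemma cinner_zero_sym: "cinner x y = 0 \<Longrightarrow> cinner y (x::'h::chilbert_space) = 0"
  by (metis cinner_commute complex_cnj_zero)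

text \<open>The Householder reflection in the complement of \<open>v\<close>; for
  \<open>v = 0\<close> it degenerates to the identity, still an isometric involution.\<close>

definition reflection :: "'h::chilbert_space \<Rightarrow> 'h \<Rightarrow> 'h" where
  "reflection v y = y - (complex_of_real (2 / (norm v)\<^sup>2) * cinner y v) *\<^sub>C v"

lemma reflection_selfadjoint: "cinner (reflection v y) z = cinner y (reflection v z)"
proof -
  have "cnj (cinner z v) = cinner v z" by (metis cinner_commute)
  then show ?thesis
    by (simp add: reflection_def cinner_diff_left cinner_diff_right cinner_scaleC_left cinner_scaleC_right)
qed

lemma reflection_involutive: "reflection v (reflection v y) = y"
  by (cases "v = 0")
     (simp_all add: reflection_def cinner_diff_left cinner_scaleC_left cinner_self scaleC_diff_left
        field_simps flip: scaleC_add_left)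

lemma reflection_add: "reflection v (x + y) = reflection v x + reflection v y"
  by (simp add: reflection_def cinner_add_left distrib_left scaleC_add_left)

lemma reflection_scaleC: "reflection v (c *\<^sub>C x) = c *\<^sub>C reflection v x"
  by (simp add: reflection_def cinner_scaleC_left scaleC_diff_right scaleC_scaleC mult_ac)

lemma reflection_proj:
  assumes "proj_ons J v = v" "proj_ons J y = y"
  shows "proj_ons J (reflection v y) = reflection v y"
  using assms by (simp add: reflection_def proj_ons_diff proj_ons_scaleC)

text \<open>A Householder reflection maps some \<open>e \<in> J\<close> to a unimodular multiple of \<open>x\<close>; then \<open>J'\<close> is the
  image of \<open>J - {e}\<close>.\<close>

lemma ons_exchange:
  assumes J: "ons (J::'h::chilbert_space set)" "finite J" and x: "proj_ons J x = x" "norm x = 1"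
  obtains J' where "finite J'" "ons (insert x J')" "x \<notin> J'" "Suc (card J') = card J"
    "\<And>j. j \<in> J' \<Longrightarrow> proj_ons J j = j" "\<And>j. j \<in> J \<Longrightarrow> proj_ons (insert x J') j = j"
proof -
  have "J \<noteq> {}" using x by (auto simp: proj_ons_def)
  then obtain e where e: "e \<in> J" by blast
  \<comment> \<open>For unit vectors e and x', the reflection in e - x' carries e to x' only if <e,
    x'> is real; this phase makes it real and nonnegative.\<close>
  define \<alpha> where "\<alpha> = (if cinner x e = 0 then 1 else cnj (sgn (cinner x e)))"
  have \<alpha>: "cmod \<alpha> = 1" by (simp add: \<alpha>_def norm_sgn)
  have \<alpha>\<alpha>: "cnj \<alpha> * \<alpha> = 1" using complex_norm_square[of \<alpha>] \<alpha> by (simp add: mult.commute)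
  define x' where "x' = \<alpha> *\<^sub>C x"
  define r where "r = cmod (cinner x e)"
  have x'e: "cinner x' e = of_real r"
    using complex_norm_square[of "cinner x e"]
    by (auto simp: x'_def \<alpha>_def cinner_scaleC_left r_def sgn_eq field_simps power2_eq_square)
  have ex': "cinner e x' = of_real r" using x'e by (metis cinner_commute complex_cnj_complex_of_real)
  have nx': "norm x' = 1" by (simp add: x'_def norm_scaleC \<alpha> x)
  have ne: "norm e = 1" using ons_norm J e by blast
  define v where "v = e - x'"
  have v: "cinner v v = 2 - 2 * of_real r"
    by (simp add: v_def cinner_diff_left cinner_diff_right x'e ex' norm_eq_1_cinner nx' ne)
  then have nv: "(norm v)\<^sup>2 = 2 - 2 * r"
    using arg_cong[OF v[unfolded cinner_self], of Re] by simp
  have Re: "reflection v e = x'"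
  proof (cases "v = 0")
    case True then show ?thesis by (simp add: reflection_def v_def)
  next
    case False
    then have "r \<noteq> 1" using nv by auto
    then have r: "2 / (2 - 2 * r) * (1 - r) = 1" by (simp add: field_simps)
    have "complex_of_real (2 / (norm v)\<^sup>2) * cinner e v = complex_of_real (2 / (2 - 2 * r) * (1 - r))"
      unfolding nv by (simp add: v_def cinner_diff_right ex' norm_eq_1_cinner[OF ne])
    then have "complex_of_real (2 / (norm v)\<^sup>2) * cinner e v = 1" unfolding r by simp
    then show ?thesis by (simp add: reflection_def v_def)
  qed
  have R: "cinner (reflection v y) (reflection v z) = cinner y z" for y z
    by (simp add: reflection_selfadjoint reflection_involutive)
  have inj: "inj_on (reflection v) A" for A by (metis inj_onI reflection_involutive)
  have vs: "proj_ons J v = v" using J e x by (simp add: v_def x'_def proj_ons_diff proj_ons_scaleC proj_ons_fixes)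
  define J' where "J' = reflection v ` (J - {e})"
  have K: "reflection v ` J = insert x' J'" using e Re unfolding J'_def by auto
  have onsJ': "ons J'" unfolding ons_def J'_def
  proof (intro ballI)
    fix a' b' assume "a' \<in> reflection v ` (J - {e})" "b' \<in> reflection v ` (J - {e})"
    then obtain a b where "a \<in> J" "b \<in> J" "a' = reflection v a" "b' = reflection v b" by blast
    then show "cinner a' b' = (if a' = b' then 1 else 0)"
      using J inj_on_eq_iff[OF inj[of UNIV], of a b] by (auto simp: R ons_def)
  qed
  have x'J': "cinner x' j = 0" if j: "j \<in> J'" for j
  proof -
    obtain i where "i \<in> J - {e}" "j = reflection v i" using j by (auto simp: J'_def)
    then show ?thesis using J e R[of e i] by (auto simp: Re ons_def)
  qed
  have xJ': "cinner x j = 0" if "j \<in> J'" for j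
    using x'J'[OF that] \<alpha> by (auto simp: x'_def cinner_scaleC_left)
  have ons: "ons (insert x J')" by (rule ons_insertI[OF onsJ' x(2) xJ'])
  have fin: "finite J'" using J by (simp add: J'_def)
  have nin: "x \<notin> J'" using xJ'[of x] norm_eq_1_cinner[OF x(2)] by auto
  have nin': "x' \<notin> J'" using x'J'[of x'] norm_eq_1_cinner[OF nx'] by auto
  \<comment> \<open>The projection onto a line does not see the phase of the spanning vector, so x'
    may be replaced by x.\<close>
  have proj_eq: "proj_ons (insert x J') = proj_ons (insert x' J')"
  proof
    fix y
    have "cinner y x' *\<^sub>C x' = ((cnj \<alpha> * \<alpha>) * cinner y x) *\<^sub>C x"
      by (simp add: x'_def cinner_scaleC_right scaleC_scaleC mult_ac)
    then have "cinner y x' *\<^sub>C x' = cinner y x *\<^sub>C x" by (simp add: \<alpha>\<alpha>)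
    then show "proj_ons (insert x J') y = proj_ons (insert x' J') y"
      using nin nin' fin by (simp add: proj_ons_def)
  qed
  have lin: "reflection v (\<Sum>i\<in>I. f i *\<^sub>C i) = (\<Sum>i\<in>I. f i *\<^sub>C reflection v i)" for f and I :: "'h set"
    by (induction I rule: infinite_finite_induct)
       (auto simp: reflection_add reflection_scaleC, simp_all add: reflection_def)
  show ?thesis
  proof (rule that[OF fin ons nin])
    show "Suc (card J') = card J"
      unfolding J'_def card_image[OF inj] using J e by (metis card_Suc_Diff1)
    show "proj_ons J j = j" if "j \<in> J'" for j
      using that reflection_proj[OF vs] J by (auto simp: J'_def proj_ons_fixes)
    show "proj_ons (insert x J') j = j" if "j \<in> J" for j
    proof -
      \<comment> \<open>With R the reflection, the projection belonging to the image of
        \<open>J\<close> is R P R with P the one belonging to \<open>J\<close>. As \<open>v\<close>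
        lies in the span of \<open>J\<close>, R preserves that span, and P drops out on R j.\<close>
      have "proj_ons (insert x J') j = proj_ons (reflection v ` J) j" by (simp add: proj_eq K)
      also have "\<dots> = (\<Sum>i\<in>J. cinner (reflection v j) i *\<^sub>C reflection v i)"
        by (simp add: proj_ons_def sum.reindex[OF inj] reflection_selfadjoint)
      also have "\<dots> = reflection v (proj_ons J (reflection v j))"
        by (simp add: proj_ons_def lin)
      also have "\<dots> = j"
        using reflection_proj[OF vs] J that by (simp add: proj_ons_fixes reflection_involutive)
      finally show ?thesis .
    qed
  qed
qed

section \<open>Diagonal sums of bounded operators\<close>

text \<open>For a finite orthonormal \<open>J\<close> this is the trace of the compression of
  \<open>B\<close> to the span of \<open>J\<close>; it depends on the span alone.\<close>

definition diag_sum :: "('h::chilbert_space \<Rightarrow> 'h) \<Rightarrow> 'h set \<Rightarrow> complex" where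
  "diag_sum B J = (\<Sum>e\<in>J. cinner (B e) e)"

lemma bounded_op_sum: "bounded_op A \<Longrightarrow> A (\<Sum>i\<in>I. c i *\<^sub>C f i) = (\<Sum>i\<in>I. c i *\<^sub>C A (f i))"
  by (simp add: linear_sum[OF bounded_linear.linear[OF bounded_op_bounded_linear]] bounded_op_scaleC)

lemma diag_sum_basis_change:
  assumes "bounded_op B" and "\<And>j. j \<in> J \<Longrightarrow> proj_ons J' j = j" "\<And>j. j \<in> J' \<Longrightarrow> proj_ons J j = j"
  shows "diag_sum B J = diag_sum B J'"
proof -
  have "diag_sum B J = (\<Sum>j\<in>J. cinner (B (proj_ons J' j)) j)"
    unfolding diag_sum_def using assms(2) by simp
  also have "\<dots> = (\<Sum>j\<in>J. \<Sum>i\<in>J'. cinner (B i) (cinner i j *\<^sub>C j))"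
    unfolding proj_ons_def bounded_op_sum[OF assms(1)] cinner_sum_left cinner_scaleC_left cinner_scaleC_right
    by (intro sum.cong refl) (metis cinner_commute)
  also have "\<dots> = (\<Sum>i\<in>J'. cinner (B i) (proj_ons J i))"
    by (subst sum.swap) (simp add: proj_ons_def cinner_sum_right)
  also have "\<dots> = diag_sum B J'" unfolding diag_sum_def using assms(3) by simp
  finally show ?thesis .
qed

lemma cinner_bounded_op_le:
  assumes "\<And>x. norm (B x) \<le> C * norm x" "norm x = 1" "norm y = 1"
  shows "cmod (cinner (B x) y) \<le> C"
  using cmod_cinner_le[of "B x" y] assms(1)[of x] assms(2,3) by simp

text \<open>A unit vector of the span of \<open>J\<close> contributes at most \<open>C\<close> to the basis-independent diagonal sum,
  and removing the direction of the projection of \<open>n\<close> makes the remaining vectors orthogonal to \<open>n\<close>.\<close>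

lemma diag_sum_hump:
  assumes B: "bounded_op B" "\<And>x. norm (B x) \<le> C * norm x" "C \<ge> 0"
    and J: "ons J" "finite J" and N: "finite N"
  shows "\<exists>J'. finite J' \<and> ons J' \<and> (\<forall>x\<in>N. \<forall>y\<in>J'. cinner x y = 0) \<and>
           cmod (diag_sum B J) \<le> cmod (diag_sum B J') + C * card N"
  using N
proof (induction N)
  case empty
  then show ?case using J by auto
next
  case (insert n N)
  then obtain J' where J': "finite J'" "ons J'" "\<forall>x\<in>N. \<forall>y\<in>J'. cinner x y = 0"
    "cmod (diag_sum B J) \<le> cmod (diag_sum B J') + C * card N" by blast
  define p where "p = proj_ons J' n"
  have np: "cinner n y = cinner p y" if "y \<in> J'" for y
    using proj_ons_residual_orthogonal[OF J'(2,1) that, of n] by (simp add: p_def cinner_diff_left)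
  show ?case
  proof (cases "p = 0")
    case True
    have "cmod (diag_sum B J) \<le> cmod (diag_sum B J') + C * card (insert n N)"
      using J'(4) insert.hyps B(3) by (simp add: algebra_simps)
    then show ?thesis using J' np True by (intro exI[of _ J']) auto
  next
    case False
    define x where "x = (1 / norm p) *\<^sub>R p"
    have px: "p = complex_of_real (norm p) *\<^sub>C x" using False by (simp add: x_def flip: scaleR_scaleC)
    have "proj_ons J' p = p"
      unfolding p_def proj_ons_def[of J' n] proj_ons_sum proj_ons_scaleC
      using proj_ons_fixes[OF J'(2,1)] by simp
    then have x: "proj_ons J' x = x" "norm x = 1"
      using False by (simp_all add: x_def scaleR_scaleC proj_ons_scaleC norm_scaleC norm_divide)
    obtain K where K: "finite K" "ons (insert x K)" "x \<notin> K"
      "\<And>j. j \<in> K \<Longrightarrow> proj_ons J' j = j" "\<And>j. j \<in> J' \<Longrightarrow> proj_ons (insert x K) j = j"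
      using ons_exchange[OF J'(2,1) x] by metis
    have K': "proj_ons J' j = j" if "j \<in> insert x K" for j using that x K by auto
    have "diag_sum B J' = diag_sum B (insert x K)"
      by (rule diag_sum_basis_change[OF B(1)]) (use K K' in auto)
    then have eq: "diag_sum B J' = cinner (B x) x + diag_sum B K" using K by (simp add: diag_sum_def)
    have C: "cmod (cinner (B x) x) \<le> C" by (rule cinner_bounded_op_le[OF B(2) x(2) x(2)])
    have "cmod (diag_sum B J') \<le> cmod (diag_sum B K) + C"
      unfolding eq using norm_triangle_ineq[of "cinner (B x) x" "diag_sum B K"] C by linarith
    moreover have "cinner a y = 0" if "a \<in> insert n N" "y \<in> K" for a y
    proof (cases "a = n")
      case True
      have "cinner x y = 0" using K that unfolding ons_def by auto
      then have "cinner p y = 0" by (subst px) (simp add: cinner_scaleC_left)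
      have "cinner y (n - p) = 0"
      proof (rule cinner_proj_ons_orthogonal)
        show "proj_ons J' y = y" using K that by blast
        show "cinner j (n - p) = 0" if "j \<in> J'" for j
          using np[OF that] by (intro cinner_zero_sym[of "n - p" j]) (simp add: cinner_diff_left)
      qed
      then show ?thesis using True \<open>cinner p y = 0\<close>
        by (metis cinner_zero_sym cinner_diff_left eq_iff_diff_eq_0)
    next
      case False
      have "cinner y a = 0"
      proof (rule cinner_proj_ons_orthogonal)
        show "proj_ons J' y = y" using K that by blast
        show "cinner j a = 0" if "j \<in> J'" for j
          using \<open>j \<in> J'\<close> \<open>a \<in> insert n N\<close> False J'(3) by (intro cinner_zero_sym[of a j]) auto
      qed
      then show ?thesis by (rule cinner_zero_sym)
    qed
    moreover have "ons K" using K(2) ons_subset by blast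
    moreover have "C * card (insert n N) = C * card N + C" using insert.hyps by (simp add: algebra_simps)
    ultimately show ?thesis using K(1) J'(4) by (intro exI[of _ K]) auto
  qed
qed

text \<open>If the sums were unbounded, one could choose finite blocks one after the other, each
  orthogonal to its predecessors and each with diagonal sum of modulus at least 1. Their union
  extends to an orthonormal basis in which the diagonal is not absolutely summable.\<close>

lemma diag_sum_bounded:
  assumes B: "bounded_op (B::'h::chilbert_space \<Rightarrow> 'h)"
    and summable: "\<And>E. onb E \<Longrightarrow> (\<lambda>e. cmod (cinner (B e) e)) summable_on E"
  obtains M where "\<And>J. finite J \<Longrightarrow> ons J \<Longrightarrow> cmod (diag_sum B J) \<le> M"
proof (rule ccontr)
  assume "\<not> thesis"
  then have unb: "\<exists>J. finite J \<and> ons J \<and> cmod (diag_sum B J) > M" for M using that by (metis not_le)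
  obtain C where C: "C \<ge> 0" "\<And>x. norm (B x) \<le> C * norm x" using bounded_op_bound[OF B] by blast
  define P where "P = (\<lambda>(n::nat) J::'h set. finite J \<and> ons J)"
  define Q where "Q = (\<lambda>(n::nat) (J::'h set) J'. J \<subseteq> J' \<and> (\<Sum>e\<in>J' - J. cmod (cinner (B e) e)) \<ge> 1)"
  have "\<exists>f. \<forall>n. P n (f n) \<and> Q n (f n) (f (Suc n))"
  proof (rule dependent_nat_choice)
    show "\<exists>J. P 0 J" by (intro exI[of _ "{}"]) (simp add: P_def ons_def)
  next
    fix J n assume J: "P n J"
    \<comment> \<open>The excess \<open>C * card J\<close> pays for making the new block orthogonal
      to the \<open>card J\<close> vectors already chosen.\<close>
    obtain K where K: "finite K" "ons K" "cmod (diag_sum B K) > 1 + C * card J" using unb by blast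
    obtain J' where J': "finite J'" "ons J'" "\<forall>x\<in>J. \<forall>y\<in>J'. cinner x y = 0"
      "cmod (diag_sum B K) \<le> cmod (diag_sum B J') + C * card J"
      using diag_sum_hump[OF B C(2,1) K(2,1), of J] J by (auto simp: P_def)
    have u: "ons (J \<union> J')" "J \<inter> J' = {}" using ons_union[of J J'] J J' by (auto simp: P_def)
    have "1 \<le> cmod (diag_sum B J')" using K J' by linarith
    also have "\<dots> \<le> (\<Sum>e\<in>J'. cmod (cinner (B e) e))" unfolding diag_sum_def by (rule norm_sum)
    also have "J' = (J \<union> J') - J" using u by auto
    finally show "\<exists>y. P (Suc n) y \<and> Q n J y"
      using J J' u by (intro exI[of _ "J \<union> J'"]) (auto simp: P_def Q_def)
  qed
  then obtain f where "\<forall>n. P n (f n) \<and> Q n (f n) (f (Suc n))" by (elim exE)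
  then have f: "\<And>n. P n (f n)" "\<And>n. Q n (f n) (f (Suc n))" by simp_all
  have mono: "f m \<subseteq> f n" if "m \<le> n" for m n
  proof (rule lift_Suc_mono_le[of f, OF _ that])
    show "f n \<subseteq> f (Suc n)" for n using f(2)[of n] by (simp add: Q_def)
  qed
  have "ons (\<Union>(range f))" unfolding ons_def
  proof (intro ballI)
    fix a b assume "a \<in> \<Union>(range f)" "b \<in> \<Union>(range f)"
    then obtain m n where "a \<in> f m" "b \<in> f n" by blast
    then have "a \<in> f (max m n)" "b \<in> f (max m n)" using mono by (meson max.cobounded1 max.cobounded2 subsetD)+
    then show "cinner a b = (if a = b then 1 else 0)" using f(1)[of "max m n"] by (auto simp: P_def ons_def)
  qed
  then obtain E where E: "onb E" "\<Union>(range f) \<subseteq> E" using ons_extends_to_onb by blast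
  have "real n \<le> (\<Sum>e\<in>f n. cmod (cinner (B e) e))" for n
  proof (induction n)
    case (Suc n)
    have "(\<Sum>e\<in>f (Suc n). cmod (cinner (B e) e))
        = (\<Sum>e\<in>f n. cmod (cinner (B e) e)) + (\<Sum>e\<in>f (Suc n) - f n. cmod (cinner (B e) e))"
      using f(1)[of "Suc n"] f(2)[of n] by (subst sum.subset_diff[of "f n"]) (auto simp: P_def Q_def)
    then show ?case using Suc f(2)[of n] by (simp add: Q_def)
  qed (simp add: sum_nonneg)
  moreover have "(\<Sum>e\<in>f n. cmod (cinner (B e) e)) \<le> (\<Sum>\<^sub>\<infinity>e\<in>E. cmod (cinner (B e) e))" for n
    using E f(1)[of n] by (intro finite_sum_le_infsum summable) (auto simp: P_def)
  ultimately have "real n \<le> (\<Sum>\<^sub>\<infinity>e\<in>E. cmod (cinner (B e) e))" for n by (meson order_trans)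
  then show False using reals_Archimedean2 by (meson not_le)
qed

section \<open>Hermitian operators: diagonals and approximate diagonalisation\<close>

lemma diag_abs_sum_bounded:
  assumes herm: "\<And>x. Im (cinner (D x) x) = 0"
    and M: "\<And>J. finite J \<Longrightarrow> ons J \<Longrightarrow> cmod (diag_sum D J) \<le> M"
    and J: "finite J" "ons J"
  shows "(\<Sum>e\<in>J. cmod (cinner (D e) e)) \<le> 2 * M"
proof -
  define P where "P = {e\<in>J. Re (cinner (D e) e) \<ge> 0}"
  define N where "N = {e\<in>J. Re (cinner (D e) e) < 0}"
  have re: "cmod (cinner (D e) e) = \<bar>Re (cinner (D e) e)\<bar>" for e
    using herm[of e] by (simp add: cmod_def)
  \<comment> \<open>The diagonal entries are real, so sorting them by sign writes the sum of moduli
    as a difference of two diagonal sums over orthonormal subsystems. This is the origin of the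
    factor 2.\<close>
  have "(\<Sum>e\<in>J. cmod (cinner (D e) e)) = (\<Sum>e\<in>P. Re (cinner (D e) e)) + (\<Sum>e\<in>N. - Re (cinner (D e) e))"
  proof -
    have "J = P \<union> N" "P \<inter> N = {}" "finite P" "finite N" using J by (auto simp: P_def N_def)
    then have "(\<Sum>e\<in>J. cmod (cinner (D e) e)) = (\<Sum>e\<in>P. cmod (cinner (D e) e)) + (\<Sum>e\<in>N. cmod (cinner (D e) e))"
      by (simp add: sum.union_disjoint)
    also have "(\<Sum>e\<in>P. cmod (cinner (D e) e)) = (\<Sum>e\<in>P. Re (cinner (D e) e))"
      by (rule sum.cong) (auto simp: re P_def)
    also have "(\<Sum>e\<in>N. cmod (cinner (D e) e)) = (\<Sum>e\<in>N. - Re (cinner (D e) e))"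
      by (rule sum.cong) (auto simp: re N_def)
    finally show ?thesis .
  qed
  also have "\<dots> = Re (diag_sum D P) - Re (diag_sum D N)"
    by (simp add: diag_sum_def sum_negf)
  also have "\<dots> \<le> cmod (diag_sum D P) + cmod (diag_sum D N)"
    using complex_Re_le_cmod[of "diag_sum D P"] abs_Re_le_cmod[of "diag_sum D N"] by linarith
  also have "\<dots> \<le> M + M"
    using J by (intro add_mono M) (auto simp: P_def N_def intro: ons_subset)
  finally show ?thesis by simp
qed

text \<open>One Gram-Schmidt step per vector; a vector already in the span leaves the system
  unchanged.\<close>

lemma ons_finite_span_exists:
  assumes "finite S"
  shows "\<exists>L. finite L \<and> ons L \<and> (\<forall>x\<in>S. proj_ons L x = (x::'h::chilbert_space))"
  using assms
proof (induction S)
  case empty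
  show ?case by (intro exI[of _ "{}"]) (simp add: ons_def)
next
  case (insert a S)
  then obtain L where L: "finite L" "ons L" "\<forall>x\<in>S. proj_ons L x = x" by blast
  define r where "r = a - proj_ons L a"
  show ?case
  proof (cases "r = 0")
    case True
    then show ?thesis using L by (intro exI[of _ L]) (auto simp: r_def)
  next
    case False
    define u where "u = (1 / norm r) *\<^sub>R r"
    have ru: "r = complex_of_real (norm r) *\<^sub>C u" using False by (simp add: u_def flip: scaleR_scaleC)
    have u: "norm u = 1" using False by (simp add: u_def)
    have uL: "cinner u j = 0" if "j \<in> L" for j
      using proj_ons_residual_orthogonal[OF L(2,1) that, of a] by (simp add: u_def r_def scaleR_cinner_left)
    have ons: "ons (insert u L)" by (rule ons_insertI[OF L(2) u uL])
    have fin: "finite (insert u L)" using L by simp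
    have sub: "proj_ons (insert u L) x = x" if "proj_ons L x = x" for x
      by (rule proj_ons_trans[OF _ that]) (use ons fin proj_ons_fixes in blast)
    have pp: "proj_ons L (proj_ons L a) = proj_ons L a"
      unfolding proj_ons_def[of L a] proj_ons_sum proj_ons_scaleC using proj_ons_fixes[OF L(2,1)] by simp
    have a: "a = proj_ons L a + complex_of_real (norm r) *\<^sub>C u" by (subst ru[symmetric]) (simp add: r_def)
    then have "proj_ons (insert u L) a = proj_ons (insert u L) (proj_ons L a + complex_of_real (norm r) *\<^sub>C u)"
      by metis
    also have "\<dots> = proj_ons L a + complex_of_real (norm r) *\<^sub>C u"
      unfolding proj_ons_add proj_ons_scaleC sub[OF pp] using proj_ons_fixes[OF ons fin] by simp
    also have "\<dots> = a" by (rule a[symmetric])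
    finally show ?thesis using ons fin sub L by (intro exI[of _ "insert u L"]) auto
  qed
qed

text \<open>The first variation of the quadratic form in quantitative shape. A step of length \<tau>
  along \<open>y\<close>, with the phase of z = <D x, y>, adds 2 \<tau> |z| to first order. The
  slack \<tau>^2 at \<open>x\<close>, the growth s \<tau>^2 of the bound and the term of
  \<open>D\<close> on the step itself together leave room for at most \<tau>^2 (1 + 2 C).\<close>

lemma near_maximiser_almost_eigenvector:
  fixes D :: "'h::chilbert_space \<Rightarrow> 'h"
  assumes D: "bounded_op D" "\<And>x. norm (D x) \<le> C * norm x" and herm: "\<And>x y. cinner (D x) y = cinner x (D y)"
    and x: "norm x = 1" and y: "norm y = 1" "cinner x y = 0" and s: "s \<le> C"
    and near: "Re (cinner (D x) x) > s - \<tau>\<^sup>2" and \<tau>: "\<tau> > 0"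
    and sup: "\<And>c. norm (x + c *\<^sub>C y) > 0 \<Longrightarrow> Re (cinner (D (x + c *\<^sub>C y)) (x + c *\<^sub>C y)) \<le> s * (norm (x + c *\<^sub>C y))\<^sup>2"
  shows "cmod (cinner (D x) y) \<le> \<tau> * (1 + 2 * C) / 2"
proof -
  define z where "z = cinner (D x) y"
  define c where "c = (if z = 0 then 1 else sgn z)"
  have c: "cmod c = 1" by (simp add: c_def norm_sgn)
  have cz: "cnj c * z = of_real (cmod z)"
    using complex_norm_square[of z] by (auto simp: c_def sgn_eq field_simps power2_eq_square)
  define w where "w = (of_real \<tau> * c) *\<^sub>C y"
  have xw: "cinner x w = 0" by (simp add: w_def cinner_scaleC_right y)
  have nw: "(norm w)\<^sup>2 = \<tau>\<^sup>2" using \<tau> by (simp add: w_def norm_scaleC norm_mult c y)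
  have nxw: "(norm (x + w))\<^sup>2 = 1 + \<tau>\<^sup>2" using pythagoras[OF xw] by (simp add: x nw)
  then have "norm (x + w) > 0"
    by (metis add_pos_nonneg norm_eq_zero zero_less_norm_iff zero_less_one zero_le_power2 power_zero_numeral less_irrefl)
  with sup[of "of_real \<tau> * c"] have le: "Re (cinner (D (x + w)) (x + w)) \<le> s * (1 + \<tau>\<^sup>2)"
    by (simp add: nxw flip: w_def)
  have Dxw: "cinner (D x) w = of_real (\<tau> * cmod z)"
    using cz by (simp add: w_def cinner_scaleC_right mult.assoc flip: z_def)
  have Dwx: "cinner (D w) x = of_real (\<tau> * cmod z)"
    by (metis Dxw cinner_commute complex_cnj_complex_of_real herm)
  have "cmod (cinner (D w) w) \<le> C * \<tau>\<^sup>2"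
    using cmod_cinner_le[of "D w" w] mult_right_mono[OF D(2)[of w] norm_ge_zero[of w]] nw
    by (simp add: power2_eq_square mult_ac)
  then have "Re (cinner (D w) w) \<ge> - (C * \<tau>\<^sup>2)" using abs_Re_le_cmod[of "cinner (D w) w"] by linarith
  moreover have "Re (cinner (D (x + w)) (x + w)) = Re (cinner (D x) x) + 2 * (\<tau> * cmod z) + Re (cinner (D w) w)"
    by (simp add: bounded_op_add[OF D(1)] cinner_add_left cinner_add_right Dxw Dwx)
  moreover have "s * \<tau>\<^sup>2 \<le> C * \<tau>\<^sup>2" using s by (simp add: mult_right_mono)
  ultimately have "2 * (\<tau> * cmod z) \<le> \<tau>\<^sup>2 + 2 * (C * \<tau>\<^sup>2)" using le near by (simp add: algebra_simps)
  then have "\<tau> * (2 * cmod z) \<le> \<tau> * (\<tau> * (1 + 2 * C))" by (simp add: power2_eq_square algebra_simps)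
  then show ?thesis using \<tau> by (simp add: z_def)
qed

definition offdiag :: "('h::chilbert_space \<Rightarrow> 'h) \<Rightarrow> 'h set \<Rightarrow> real" where
  "offdiag D J = (\<Sum>i\<in>J. \<Sum>j\<in>J - {i}. cmod (cinner (D i) j))"

text \<open>Induction on the dimension of the span. A unit vector that nearly maximises the
  quadratic form is almost decoupled from its orthogonal complement within the span, and the
  complement is treated with half the tolerance. The two projection conditions say that the span is
  preserved.\<close>

lemma approximate_diagonalisation:
  fixes D :: "'h::chilbert_space \<Rightarrow> 'h"
  assumes D: "bounded_op D" "\<And>x. norm (D x) \<le> C * norm x" "C \<ge> 0"
    and herm: "\<And>x y. cinner (D x) y = cinner x (D y)"
    and J: "finite J" "ons J" and \<epsilon>: "\<epsilon> > 0"
  shows "\<exists>L. finite L \<and> ons L \<and> card L = card J \<and> (\<forall>j\<in>J. proj_ons L j = j) \<and> (\<forall>j\<in>L. proj_ons J j = j) \<and>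
           offdiag D L \<le> \<epsilon>"
  using J \<epsilon>
proof (induction "card J" arbitrary: J \<epsilon>)
  case 0
  then show ?case by (intro exI[of _ "{}"]) (auto simp: offdiag_def)
next
  case (Suc N)
  define S where "S = (\<lambda>x. Re (cinner (D x) x)) ` {x. proj_ons J x = x \<and> norm x = 1}"
  define s where "s = Sup S"
  have le_C: "Re (cinner (D x) x) \<le> C" if "norm x = 1" for x
    using complex_Re_le_cmod[of "cinner (D x) x"] cinner_bounded_op_le[OF D(2) that that] by linarith
  then have bdd: "bdd_above S" unfolding S_def bdd_above_def by auto
  obtain e where "e \<in> J" using Suc.hyps(2) by fastforce
  then have ne: "S \<noteq> {}" unfolding S_def using Suc.prems ons_norm proj_ons_fixes by blast
  have s_le: "s \<le> C" unfolding s_def by (rule cSup_least[OF ne]) (use le_C in \<open>auto simp: S_def\<close>)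
  \<comment> \<open>The N vectors of the complement give 2 N new off-diagonal entries, each at most
    \<tau> (1 + 2 C) / 2; this \<tau> keeps their sum below \<epsilon> / 2. \<open>Suc N\<close> in
    place of N keeps the denominator positive in dimension one.\<close>
  define \<tau> where "\<tau> = \<epsilon> / (2 * real (Suc N) * (1 + 2 * C))"
  have \<tau>: "\<tau> > 0" using Suc.prems D(3) by (simp add: \<tau>_def add_pos_nonneg)
  then have "s - \<tau>\<^sup>2 < s" by simp
  then obtain x where x: "proj_ons J x = x" "norm x = 1" "Re (cinner (D x) x) > s - \<tau>\<^sup>2"
    using less_cSupD[OF ne] unfolding s_def S_def by (smt (verit, best) imageE mem_Collect_eq)
  obtain J' where J': "finite J'" "ons (insert x J')" "x \<notin> J'" "Suc (card J') = card J"
    "\<And>j. j \<in> J' \<Longrightarrow> proj_ons J j = j" "\<And>j. j \<in> J \<Longrightarrow> proj_ons (insert x J') j = j"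
    using ons_exchange[OF Suc.prems(2,1) x(1,2)] by metis
  have "ons J'" using J'(2) ons_subset by blast
  then obtain L where L: "finite L" "ons L" "card L = card J'" "\<forall>j\<in>J'. proj_ons L j = j" "\<forall>j\<in>L. proj_ons J' j = j"
    "offdiag D L \<le> \<epsilon> / 2"
    using Suc.hyps(1)[of J' "\<epsilon> / 2"] J' Suc by auto
  have xL: "cinner x j = 0" if "j \<in> L" for j
  proof (rule cinner_zero_sym, rule cinner_proj_ons_orthogonal)
    show "proj_ons J' j = j" using L that by blast
    show "cinner i x = 0" if "i \<in> J'" for i using that J'(2,3) by (auto simp: ons_def)
  qed
  have onsL: "ons (insert x L)" by (rule ons_insertI[OF L(2) x(2) xL])
  have xnL: "x \<notin> L" using xL[of x] norm_eq_1_cinner[OF x(2)] by auto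
  have finL: "finite (insert x L)" using L by simp
  have LJ: "proj_ons J j = j" if "j \<in> insert x L" for j
    using that x(1) proj_ons_trans[of J' J j] J'(5) L(5) by auto
  have "proj_ons (insert x L) i = i" if "i \<in> insert x J'" for i
  proof (cases "i = x")
    case True then show ?thesis using proj_ons_fixes[OF onsL finL] by simp
  next
    case False
    then have "proj_ons L i = i" using that L by auto
    then show ?thesis by (rule proj_ons_trans[rotated]) (use proj_ons_fixes[OF onsL finL] in auto)
  qed
  then have JL: "proj_ons (insert x L) j = j" if "j \<in> J" for j
    using proj_ons_trans[of "insert x J'" "insert x L" j] J'(6)[OF that] by blast
  have small: "cmod (cinner (D x) j) \<le> \<tau> * (1 + 2 * C) / 2" if j: "j \<in> L" for j
  proof (rule near_maximiser_almost_eigenvector[OF D(1,2) herm x(2) _ xL[OF j] s_le x(3) \<tau>])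
    show "norm j = 1" using L j ons_norm by blast
    fix c assume pos: "norm (x + c *\<^sub>C j) > 0"
    define z where "z = x + c *\<^sub>C j"
    define u where "u = (1 / norm z) *\<^sub>R z"
    have "proj_ons J z = z" using LJ j by (simp add: z_def proj_ons_add proj_ons_scaleC)
    then have u: "proj_ons J u = u" by (simp add: u_def scaleR_scaleC proj_ons_scaleC)
    have nu: "norm u = 1" using pos by (simp add: u_def z_def)
    have "Re (cinner (D u) u) \<le> s" unfolding s_def
      by (rule cSup_upper[OF _ bdd]) (use u nu in \<open>auto simp: S_def\<close>)
    moreover have "cinner (D z) z = of_real ((norm z)\<^sup>2) * cinner (D u) u"
    proof -
      have "z = complex_of_real (norm z) *\<^sub>C u" using pos by (simp add: u_def z_def flip: scaleR_scaleC)
      then have "cinner (D z) z = cinner (D (complex_of_real (norm z) *\<^sub>C u)) (complex_of_real (norm z) *\<^sub>C u)" by simp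
      then show ?thesis
        by (simp add: bounded_op_scaleC[OF D(1)] cinner_scaleC_left cinner_scaleC_right power2_eq_square)
    qed
    ultimately have "Re (cinner (D z) z) \<le> s * (norm z)\<^sup>2"
      by (simp add: mult.commute mult_right_mono flip: of_real_power)
    then show "Re (cinner (D (x + c *\<^sub>C j)) (x + c *\<^sub>C j)) \<le> s * (norm (x + c *\<^sub>C j))\<^sup>2" by (simp add: z_def)
  qed
  \<comment> \<open>For a Hermitian operator the row and the column of \<open>x\<close> have the
    same moduli, so one estimate serves both.\<close>
  have sym: "cmod (cinner (D j) x) = cmod (cinner (D x) j)" for j
    by (metis cinner_commute complex_mod_cnj herm)
  have "offdiag D (insert x L) = (\<Sum>j\<in>L. cmod (cinner (D x) j)) + (\<Sum>i\<in>L. \<Sum>j\<in>insert x (L - {i}). cmod (cinner (D i) j))"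
  proof -
    have "insert x L - {i} = insert x (L - {i})" if "i \<in> L" for i using that xnL by auto
    then show ?thesis unfolding offdiag_def using L(1) xnL by (simp add: insert_Diff_if)
  qed
  also have "\<dots> = 2 * (\<Sum>j\<in>L. cmod (cinner (D x) j)) + offdiag D L"
    using L(1) xnL by (simp add: offdiag_def sum.distrib sym)
  also have "\<dots> \<le> 2 * (\<Sum>j\<in>L. \<tau> * (1 + 2 * C) / 2) + \<epsilon> / 2"
    using L(6) sum_mono[OF small] by (intro add_mono mult_left_mono) auto
  also have "\<dots> \<le> \<epsilon>"
  proof -
    have N: "card L = N" using L J' Suc.hyps(2) by simp
    have "real N * (\<tau> * (1 + 2 * C)) \<le> real (Suc N) * (\<tau> * (1 + 2 * C))"
      using \<tau> D(3) by (intro mult_right_mono) auto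
    also have "\<dots> = \<tau> * (2 * real (Suc N) * (1 + 2 * C)) / 2" by (simp add: algebra_simps)
    also have "\<dots> = \<epsilon> / 2"
    proof -
      have "2 * real (Suc N) * (1 + 2 * C) \<noteq> 0" using D(3) by auto
      then show ?thesis unfolding \<tau>_def by (metis nonzero_eq_divide_eq)
    qed
    finally show ?thesis by (simp add: N)
  qed
  finally have "offdiag D (insert x L) \<le> \<epsilon>" .
  moreover have "card (insert x L) = card J" using L J' xnL by simp
  ultimately show ?case using onsL finL LJ JL by (intro exI[of _ "insert x L"]) blast
qed

text \<open>Expand <D (U e), e> in an almost diagonal system \<open>L\<close> whose span contains
  \<open>J\<close> and its image under \<open>U\<close>. Summed over e, the coefficient of each
  matrix entry <D i, j> is at most 1 by Bessel's inequality, so the total is at most the sum of the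
  moduli of all entries: 2 M from the diagonal and 1 from the rest, whatever \<open>J\<close>
  is.\<close>

lemma hermitian_rotated_diag_bounded:
  fixes D :: "'h::chilbert_space \<Rightarrow> 'h"
  assumes D: "bounded_op D" and herm: "\<And>x y. cinner (D x) y = cinner x (D y)"
    and summable: "\<And>E. onb E \<Longrightarrow> (\<lambda>e. cmod (cinner (D e) e)) summable_on E"
    and U: "\<And>x y. cinner (U x) (U y) = cinner x y"
  obtains M where "\<And>J. finite J \<Longrightarrow> ons J \<Longrightarrow> (\<Sum>e\<in>J. cmod (cinner (D (U e)) e)) \<le> M"
proof -
  obtain C where C: "C \<ge> 0" "\<And>x. norm (D x) \<le> C * norm x" using bounded_op_bound[OF D] by blast
  obtain M where M: "\<And>J. finite J \<Longrightarrow> ons J \<Longrightarrow> cmod (diag_sum D J) \<le> M"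
    using diag_sum_bounded[OF D summable] by blast
  have im: "Im (cinner (D x) x) = 0" for x
    using arg_cong[OF cinner_commute[of "D x" x], of Im] by (simp add: herm)
  have "(\<Sum>e\<in>J. cmod (cinner (D (U e)) e)) \<le> 2 * M + 1" if J: "finite J" "ons J" for J
  proof -
    obtain K where K: "finite K" "ons K" "\<forall>x\<in>J \<union> U ` J. proj_ons K x = x"
      using ons_finite_span_exists[of "J \<union> U ` J"] J by auto
    obtain L where L: "finite L" "ons L" "\<forall>j\<in>K. proj_ons L j = j" "offdiag D L \<le> 1"
      using approximate_diagonalisation[OF D C(2,1) herm K(1,2), of 1] by auto
    have fixL: "proj_ons L x = x" if "x \<in> J \<union> U ` J" for x
      by (rule proj_ons_trans[of K]) (use that K L in auto)
    have Uons: "ons (U ` J)" and Uinj: "inj_on U J"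
    proof -
      have "cinner (U a) (U b) = (if a = b then 1 else 0)" if "a \<in> J" "b \<in> J" for a b
        using that J by (simp add: U ons_def)
      then show "inj_on U J" by (metis inj_onI zero_neq_one)
      then show "ons (U ` J)" using J by (auto simp: ons_def U inj_on_eq_iff)
    qed
    have bes1: "(\<Sum>e\<in>J. (cmod (cinner (U e) i))\<^sup>2) \<le> 1" if "i \<in> L" for i
    proof -
      have "(\<Sum>e\<in>J. (cmod (cinner (U e) i))\<^sup>2) = (\<Sum>e\<in>U ` J. (cmod (cinner i e))\<^sup>2)"
        by (simp add: sum.reindex[OF Uinj]) (metis cinner_commute complex_mod_cnj)
      also have "\<dots> \<le> (norm i)\<^sup>2" using bessel[OF Uons] J by blast
      finally show ?thesis using ons_norm L that by fastforce
    qed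
    have bes2: "(\<Sum>e\<in>J. (cmod (cinner e i))\<^sup>2) \<le> 1" if "i \<in> L" for i
    proof -
      have "(\<Sum>e\<in>J. (cmod (cinner e i))\<^sup>2) = (\<Sum>e\<in>J. (cmod (cinner i e))\<^sup>2)"
        by (metis cinner_commute complex_mod_cnj)
      also have "\<dots> \<le> (norm i)\<^sup>2" using bessel J by blast
      finally show ?thesis using ons_norm L that by fastforce
    qed
    \<comment> \<open>Bessel's inequality is used for i against the orthonormal image of
      \<open>J\<close> under \<open>U\<close> and for j against \<open>J\<close> itself.\<close>
    have prod: "(\<Sum>e\<in>J. cmod (cinner (U e) i) * cmod (cinner e j)) \<le> 1" if "i \<in> L" "j \<in> L" for i j
    proof -
      have ab: "a * b \<le> (a\<^sup>2 + b\<^sup>2) / 2" for a b :: real using sum_squares_bound[of a b] by simp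
      have "(\<Sum>e\<in>J. cmod (cinner (U e) i) * cmod (cinner e j))
          \<le> (\<Sum>e\<in>J. ((cmod (cinner (U e) i))\<^sup>2 + (cmod (cinner e j))\<^sup>2) / 2)" by (intro sum_mono ab)
      also have "\<dots> \<le> 1" using bes1[OF that(1)] bes2[OF that(2)]
        by (simp add: sum.distrib flip: sum_divide_distrib)
      finally show ?thesis .
    qed
    have "cmod (cinner (D (U e)) e) \<le> (\<Sum>i\<in>L. \<Sum>j\<in>L. cmod (cinner (D i) j) * (cmod (cinner (U e) i) * cmod (cinner e j)))"
      if "e \<in> J" for e
    proof -
      have "cinner (D (U e)) e = cinner (D (proj_ons L (U e))) (proj_ons L e)"
        using fixL that by simp
      also have "\<dots> = (\<Sum>j\<in>L. \<Sum>i\<in>L. cnj (cinner e j) * (cinner (U e) i * cinner (D i) j))"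
        unfolding proj_ons_def bounded_op_sum[OF D] cinner_sum_left cinner_sum_right cinner_scaleC_left
            cinner_scaleC_right sum_distrib_left by (rule refl)
      also have "\<dots> = (\<Sum>i\<in>L. \<Sum>j\<in>L. cinner (U e) i * (cnj (cinner e j) * cinner (D i) j))"
        by (subst sum.swap) (simp add: mult_ac)
      also have "cmod \<dots> \<le> (\<Sum>i\<in>L. \<Sum>j\<in>L. cmod (cinner (U e) i * (cnj (cinner e j) * cinner (D i) j)))"
        by (rule order_trans[OF norm_sum]) (intro sum_mono norm_sum)
      finally show ?thesis by (simp add: norm_mult mult_ac)
    qed
    then have "(\<Sum>e\<in>J. cmod (cinner (D (U e)) e))
        \<le> (\<Sum>e\<in>J. \<Sum>i\<in>L. \<Sum>j\<in>L. cmod (cinner (D i) j) * (cmod (cinner (U e) i) * cmod (cinner e j)))"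
      by (rule sum_mono)
    also have "\<dots> = (\<Sum>i\<in>L. \<Sum>j\<in>L. cmod (cinner (D i) j) * (\<Sum>e\<in>J. cmod (cinner (U e) i) * cmod (cinner e j)))"
      by (subst sum.swap, rule sum.cong[OF refl], subst sum.swap) (simp add: sum_distrib_left)
    also have "\<dots> \<le> (\<Sum>i\<in>L. \<Sum>j\<in>L. cmod (cinner (D i) j) * 1)"
      by (intro sum_mono mult_left_mono prod) auto
    also have "\<dots> = (\<Sum>i\<in>L. cmod (cinner (D i) i)) + offdiag D L"
      unfolding offdiag_def sum.distrib[symmetric] mult_1_right using L(1) by (intro sum.cong refl sum.remove)
    also have "\<dots> \<le> 2 * M + 1"
      using diag_abs_sum_bounded[OF im M L(1,2)] L(4) by linarith
    finally show ?thesis .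
  qed
  then show ?thesis using that by blast
qed

section \<open>Rotated diagonals of trace class operators\<close>

lemma bounded_op_lincomb:
  assumes A: "bounded_op A" and B: "bounded_op B"
  shows "bounded_op (\<lambda>x. a *\<^sub>C A x + b *\<^sub>C B x)"
proof -
  obtain C C' where C: "\<And>x. norm (A x) \<le> C * norm x" "\<And>x. norm (B x) \<le> C' * norm x"
    using bounded_op_bound[OF A] bounded_op_bound[OF B] by metis
  have "norm (a *\<^sub>C A x + b *\<^sub>C B x) \<le> (cmod a * C + cmod b * C') * norm x" for x
  proof -
    have "norm (a *\<^sub>C A x + b *\<^sub>C B x) \<le> cmod a * norm (A x) + cmod b * norm (B x)"
      using norm_triangle_ineq[of "a *\<^sub>C A x" "b *\<^sub>C B x"] by (simp add: norm_scaleC)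
    also have "\<dots> \<le> cmod a * (C * norm x) + cmod b * (C' * norm x)"
      by (intro add_mono mult_left_mono C) auto
    finally show ?thesis by (simp add: algebra_simps)
  qed
  then have "\<exists>C. \<forall>x. norm (a *\<^sub>C A x + b *\<^sub>C B x) \<le> C * norm x" by blast
  then show ?thesis unfolding bounded_op_def clinear_on_def
    by (auto simp: bounded_op_add[OF A] bounded_op_add[OF B] bounded_op_scaleC[OF A]
        bounded_op_scaleC[OF B] scaleC_add_right scaleC_scaleC mult.commute)
qed

text \<open>Reduction to Hermitian operators. The Hermitian part of a B with |a| = 1 again has
  absolutely summable diagonals, since the diagonal entries of \<open>B\<close> and of its adjoint
  have the same modulus.\<close>

lemma trace_class_rotated_summable:
  assumes B: "trace_class (B::'h::chilbert_space \<Rightarrow> 'h)" and U: "\<And>x y. cinner (U x) (U y) = cinner x y"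
    and E: "ons E"
  shows "(\<lambda>e. cmod (cinner (B (U e)) e)) summable_on E"
proof -
  have bB: "bounded_op B" and sB: "\<And>E. onb E \<Longrightarrow> (\<lambda>e. cmod (cinner (B e) e)) summable_on E"
    using B by (auto simp: trace_class_def)
  obtain B' where B': "bounded_op B'" "\<And>x y. cinner (B x) y = cinner x (B' y)"
    using bounded_op_adjoint_exists[OF bB] by blast
  have B'2: "cinner (B' x) y = cinner x (B y)" for x y by (metis B'(2) cinner_commute)
  \<comment> \<open>\<open>D a\<close> is the Hermitian part of a B. The values a = 1 and a = i
    recover B as D 1 - i D i.\<close>
  define D where "D a = (\<lambda>x. (a / 2) *\<^sub>C B x + (cnj a / 2) *\<^sub>C B' x)" for a
  have D: "bounded_op (D a)" for a unfolding D_def by (rule bounded_op_lincomb[OF bB B'(1)])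
  have herm: "cinner (D a x) y = cinner x (D a y)" for a x y
    by (simp add: D_def cinner_add_left cinner_add_right cinner_scaleC_left cinner_scaleC_right B' B'2)
  have sum: "(\<lambda>e. cmod (cinner (D a e) e)) summable_on F" if F: "onb F" and a: "cmod a = 1" for F a
  proof -
    have le: "cmod (cinner (D a e) e) \<le> cmod (cinner (B e) e)" for e
    proof -
    have "cmod (cinner (D a e) e) \<le> cmod (a / 2 * cinner (B e) e) + cmod (cnj a / 2 * cinner (B' e) e)"
      unfolding D_def cinner_add_left cinner_scaleC_left by (rule norm_triangle_ineq)
      moreover have "cmod (cinner (B' e) e) = cmod (cinner (B e) e)"
        by (metis B'2 cinner_commute complex_mod_cnj)
      ultimately show ?thesis using a by (simp add: norm_mult norm_divide)
    qed
    show ?thesis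
      using Infinite_Sum.abs_summable_on_comparison_test[where f = "\<lambda>e. cinner (D a e) e" and g = "\<lambda>e. cinner (B e) e" and A = F]
        sB[OF F] le by blast
  qed
  obtain M1 where M1: "\<And>J. finite J \<Longrightarrow> ons J \<Longrightarrow> (\<Sum>e\<in>J. cmod (cinner (D 1 (U e)) e)) \<le> M1"
    using hermitian_rotated_diag_bounded[OF D herm sum U, of 1] by (metis norm_one)
  obtain M2 where M2: "\<And>J. finite J \<Longrightarrow> ons J \<Longrightarrow> (\<Sum>e\<in>J. cmod (cinner (D \<i> (U e)) e)) \<le> M2"
    using hermitian_rotated_diag_bounded[OF D herm sum U, of \<i>] by (metis norm_ii)
  have dec: "cinner (B x) y = cinner (D 1 x) y - \<i> * cinner (D \<i> x) y" for x y
    by (simp add: D_def cinner_add_left cinner_scaleC_left algebra_simps)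
  have le: "cmod (cinner (B x) y) \<le> cmod (cinner (D 1 x) y) + cmod (cinner (D \<i> x) y)" for x y
    unfolding dec using norm_triangle_ineq4[of "cinner (D 1 x) y" "\<i> * cinner (D \<i> x) y"] by (simp add: norm_mult)
  show ?thesis
  proof (rule nonneg_bdd_above_summable_on)
    show "bdd_above (sum (\<lambda>e. cmod (cinner (B (U e)) e)) ` {F. F \<subseteq> E \<and> finite F})"
    proof (rule bdd_aboveI2)
      fix J assume "J \<in> {F. F \<subseteq> E \<and> finite F}"
      then have J: "finite J" "ons J" using E ons_subset by auto
      have "(\<Sum>e\<in>J. cmod (cinner (B (U e)) e)) \<le> (\<Sum>e\<in>J. cmod (cinner (D 1 (U e)) e) + cmod (cinner (D \<i> (U e)) e))"
        by (intro sum_mono le)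
      also have "\<dots> \<le> M1 + M2" unfolding sum.distrib by (intro add_mono M1 M2 J)
      finally show "(\<Sum>e\<in>J. cmod (cinner (B (U e)) e)) \<le> M1 + M2" .
    qed
  qed simp
qed

section \<open>Square-integrable functions\<close>

text \<open>The norm is kept squared: the triangle inequality then costs a factor 2, which is
  harmless for sequences tending to 0, and orthogonal sums and nonnegative integrals need no square
  roots.\<close>

definition L2sq :: "'a measure \<Rightarrow> ('a \<Rightarrow> complex) \<Rightarrow> real" where
  "L2sq M f = (\<integral>x. (cmod (f x))\<^sup>2 \<partial>M)"

lemma L2_measurable [measurable_dest]: "f \<in> L2 M \<Longrightarrow> f \<in> borel_measurable M"
  by (simp add: L2_def)

lemma L2_integrable: "f \<in> L2 M \<Longrightarrow> integrable M (\<lambda>x. (cmod (f x))\<^sup>2)"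
  by (simp add: L2_def)

lemma L2sq_nonneg [simp]: "0 \<le> L2sq M f"
  by (simp add: L2sq_def)

lemma norm_add_square_le: "(norm (a + b))\<^sup>2 \<le> 2 * (norm a)\<^sup>2 + 2 * (norm (b::'a::real_normed_vector))\<^sup>2"
proof -
  have "(norm (a + b))\<^sup>2 \<le> (norm a + norm b)\<^sup>2" by (intro power_mono norm_triangle_ineq) simp
  also have "\<dots> \<le> 2 * (norm a)\<^sup>2 + 2 * (norm b)\<^sup>2"
    using sum_squares_bound[of "norm a" "norm b"] by (simp add: power2_sum)
  finally show ?thesis .
qed

lemma L2_add: assumes "f \<in> L2 M" "g \<in> L2 M" shows "(\<lambda>x. f x + g x) \<in> L2 M"
proof -
  note [measurable] = assms
  have "integrable M (\<lambda>x. 2 * (cmod (f x))\<^sup>2 + 2 * (cmod (g x))\<^sup>2)" using assms by (simp add: L2_def)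
  then have "integrable M (\<lambda>x. (cmod (f x + g x))\<^sup>2)"
    by (rule Bochner_Integration.integrable_bound) (auto intro!: AE_I2 norm_add_square_le)
  then show ?thesis by (simp add: L2_def)
qed

lemma L2_cmult: "f \<in> L2 M \<Longrightarrow> (\<lambda>x. c * f x) \<in> L2 M"
  by (auto simp: L2_def norm_mult power_mult_distrib)

lemma measurable_cnj [measurable]: "f \<in> borel_measurable M \<Longrightarrow> (\<lambda>x. cnj (f x)) \<in> borel_measurable M"
  by (erule measurable_compose[OF _ borel_measurable_continuous_onI]) (intro continuous_intros)

lemma L2_diff: "f \<in> L2 M \<Longrightarrow> g \<in> L2 M \<Longrightarrow> (\<lambda>x. f x - g x) \<in> L2 M"
  using L2_add[of f M "\<lambda>x. (-1) * g x"] L2_cmult[of g M "-1"] by simp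

lemma L2_zero: "(\<lambda>x. 0) \<in> L2 M"
  by (simp add: L2_def)

lemma L2_sum: "(\<And>i. i \<in> I \<Longrightarrow> f i \<in> L2 M) \<Longrightarrow> (\<lambda>x. \<Sum>i\<in>I. f i x) \<in> L2 M"
  by (induction I rule: infinite_finite_induct) (auto simp: L2_zero intro: L2_add)

lemma L2sq_cmult: "L2sq M (\<lambda>x. c * f x) = (cmod c)\<^sup>2 * L2sq M f"
  by (simp add: L2sq_def norm_mult power_mult_distrib)

lemma L2sq_add_le:
  assumes "f \<in> L2 M" "g \<in> L2 M"
  shows "L2sq M (\<lambda>x. f x + g x) \<le> 2 * L2sq M f + 2 * L2sq M g"
proof -
  have "L2sq M (\<lambda>x. f x + g x) \<le> (\<integral>x. 2 * (cmod (f x))\<^sup>2 + 2 * (cmod (g x))\<^sup>2 \<partial>M)"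
    unfolding L2sq_def using assms L2_add[OF assms]
    by (intro integral_mono norm_add_square_le) (auto simp: L2_def)
  then show ?thesis using assms by (simp add: L2sq_def L2_def)
qed

lemma L2sq_minus_commute: "L2sq M (\<lambda>x. f x - g x) = L2sq M (\<lambda>x. g x - f x)"
  by (simp add: L2sq_def norm_minus_commute)

lemma L2sq_diff_triangle:
  assumes "f \<in> L2 M" "g \<in> L2 M" "h \<in> L2 M"
  shows "L2sq M (\<lambda>x. f x - h x) \<le> 2 * L2sq M (\<lambda>x. f x - g x) + 2 * L2sq M (\<lambda>x. g x - h x)"
  using L2sq_add_le[OF L2_diff[OF assms(1,2)] L2_diff[OF assms(2,3)]] by simp

lemma L2sq_eq_0_iff: "f \<in> L2 M \<Longrightarrow> L2sq M f = 0 \<longleftrightarrow> (AE x in M. f x = 0)"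
  unfolding L2sq_def using integral_nonneg_eq_0_iff_AE[OF L2_integrable, of f M] by simp

lemma L2I_nn:
  assumes "f \<in> borel_measurable M" "(\<integral>\<^sup>+x. ennreal ((cmod (f x))\<^sup>2) \<partial>M) < \<infinity>"
  shows "f \<in> L2 M"
  using assms by (auto simp: L2_def intro!: integrableI_bounded)

lemma nn_integral_L2sq:
  "f \<in> L2 M \<Longrightarrow> (\<integral>\<^sup>+x. ennreal ((cmod (f x))\<^sup>2) \<partial>M) = ennreal (L2sq M f)"
  unfolding L2sq_def by (rule nn_integral_eq_integral[OF L2_integrable]) auto

lemma L2sq_leI:
  assumes "f \<in> borel_measurable M" "(\<integral>\<^sup>+x. ennreal ((cmod (f x))\<^sup>2) \<partial>M) \<le> ennreal c" "0 \<le> c"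
  shows "f \<in> L2 M" "L2sq M f \<le> c"
proof -
  show f: "f \<in> L2 M" by (rule L2I_nn[OF assms(1)]) (rule order.strict_trans1[OF assms(2)], simp)
  show "L2sq M f \<le> c" using assms(2,3) unfolding nn_integral_L2sq[OF f] by simp
qed

section \<open>Convergence and completeness in the space of square-integrable functions\<close>

lemma L2_tendsto_iff:
  "L2_tendsto M f g \<longleftrightarrow> (\<forall>k. f k \<in> L2 M) \<and> g \<in> L2 M \<and> (\<lambda>k. L2sq M (\<lambda>x. f k x - g x)) \<longlonglongrightarrow> 0"
  by (simp add: L2_tendsto_def L2sq_def)

lemma L2_tendsto_lincomb:
  assumes "L2_tendsto M f g" "L2_tendsto M f' g'"
  shows "L2_tendsto M (\<lambda>k x. a * f k x + b * f' k x) (\<lambda>x. a * g x + b * g' x)"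
proof -
  have m: "\<And>k. f k \<in> L2 M" "g \<in> L2 M" "\<And>k. f' k \<in> L2 M" "g' \<in> L2 M"
    using assms by (auto simp: L2_tendsto_iff)
  have "(\<lambda>k. L2sq M (\<lambda>x. (a * f k x + b * f' k x) - (a * g x + b * g' x))) \<longlonglongrightarrow> 0"
  proof (rule tendsto_sandwich[OF _ _ tendsto_const])
    show "(\<lambda>k. 2 * ((cmod a)\<^sup>2 * L2sq M (\<lambda>x. f k x - g x)) + 2 * ((cmod b)\<^sup>2 * L2sq M (\<lambda>x. f' k x - g' x))) \<longlonglongrightarrow> 0"
      using assms by (auto simp: L2_tendsto_iff intro!: tendsto_eq_intros)
    show "\<forall>\<^sub>F k in sequentially. L2sq M (\<lambda>x. (a * f k x + b * f' k x) - (a * g x + b * g' x))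
      \<le> 2 * ((cmod a)\<^sup>2 * L2sq M (\<lambda>x. f k x - g x)) + 2 * ((cmod b)\<^sup>2 * L2sq M (\<lambda>x. f' k x - g' x))"
    proof (intro always_eventually allI)
      fix k
      have "(\<lambda>x. (a * f k x + b * f' k x) - (a * g x + b * g' x))
          = (\<lambda>x. a * (f k x - g x) + b * (f' k x - g' x))" by (simp add: algebra_simps)
      then show "L2sq M (\<lambda>x. (a * f k x + b * f' k x) - (a * g x + b * g' x))
          \<le> 2 * ((cmod a)\<^sup>2 * L2sq M (\<lambda>x. f k x - g x)) + 2 * ((cmod b)\<^sup>2 * L2sq M (\<lambda>x. f' k x - g' x))"
        using L2sq_add_le[OF L2_cmult[OF L2_diff[OF m(1,2)]] L2_cmult[OF L2_diff[OF m(3,4)]], of a k b k]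
        by (simp only: L2sq_cmult)
    qed
  qed simp
  then show ?thesis using m by (auto simp: L2_tendsto_iff intro!: L2_add L2_cmult)
qed

lemma L2_tendsto_unique:
  assumes "L2_tendsto M f g" "L2_tendsto M f' g'" "(\<lambda>k. L2sq M (\<lambda>x. f k x - f' k x)) \<longlonglongrightarrow> 0"
  shows "AE x in M. g x = g' x"
proof -
  have m: "\<And>k. f k \<in> L2 M" "g \<in> L2 M" "\<And>k. f' k \<in> L2 M" "g' \<in> L2 M"
    using assms by (auto simp: L2_tendsto_iff)
  have "L2sq M (\<lambda>x. g x - g' x) \<le> 0"
  proof (rule tendsto_lowerbound)
    show "(\<lambda>k. 2 * L2sq M (\<lambda>x. f k x - g x) + 2 * (2 * L2sq M (\<lambda>x. f k x - f' k x) + 2 * L2sq M (\<lambda>x. f' k x - g' x))) \<longlonglongrightarrow> 0"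
      using assms by (auto simp: L2_tendsto_iff intro!: tendsto_eq_intros)
    show "\<forall>\<^sub>F k in sequentially. L2sq M (\<lambda>x. g x - g' x)
       \<le> 2 * L2sq M (\<lambda>x. f k x - g x) + 2 * (2 * L2sq M (\<lambda>x. f k x - f' k x) + 2 * L2sq M (\<lambda>x. f' k x - g' x))"
    proof (intro always_eventually allI)
      show "L2sq M (\<lambda>x. g x - g' x) \<le> 2 * L2sq M (\<lambda>x. f k x - g x)
          + 2 * (2 * L2sq M (\<lambda>x. f k x - f' k x) + 2 * L2sq M (\<lambda>x. f' k x - g' x))" for k
      proof -
        have "L2sq M (\<lambda>x. g x - g' x) \<le> 2 * L2sq M (\<lambda>x. g x - f k x) + 2 * L2sq M (\<lambda>x. f k x - g' x)"
          by (rule L2sq_diff_triangle[OF m(2) m(1) m(4)])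
        also have "\<dots> \<le> 2 * L2sq M (\<lambda>x. f k x - g x)
          + 2 * (2 * L2sq M (\<lambda>x. f k x - f' k x) + 2 * L2sq M (\<lambda>x. f' k x - g' x))"
          unfolding L2sq_minus_commute[of M g "f k"]
          by (intro add_left_mono mult_left_mono L2sq_diff_triangle m) simp
        finally show ?thesis .
      qed
    qed
  qed simp
  then have "L2sq M (\<lambda>x. g x - g' x) = 0" by (simp add: order.antisym)
  then show ?thesis using L2sq_eq_0_iff[OF L2_diff[OF m(2,4)]] by simp
qed

text \<open>Turns summability of squares with weights 2^k into absolute summability: either a is at
  most 2^-k, or 2^k a exceeds 1 and a is at most 2^k a^2.\<close>

lemma le_power_plus_power_mult_square: "(a::real) \<le> (1/2) ^ k + 2 ^ k * a\<^sup>2"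
proof (cases "a \<le> (1/2) ^ k")
  case True
  then show ?thesis by (simp add: add_increasing2)
next
  case False
  then have a: "a > (1/2) ^ k" by simp
  have "(0::real) < (1/2) ^ k" by simp
  with a have "a > 0" by linarith
  have "1 = 2 ^ k * (1/2::real) ^ k" by (simp add: power_one_over)
  also have "\<dots> \<le> 2 ^ k * a" using a by (intro mult_left_mono) auto
  finally have "a * 1 \<le> a * (2 ^ k * a)" using \<open>a > 0\<close> by (intro mult_left_mono) auto
  then have "a \<le> 2 ^ k * a\<^sup>2" by (simp add: power2_eq_square mult_ac)
  moreover have "(0::real) \<le> (1/2) ^ k" by simp
  ultimately show ?thesis by linarith
qed

text \<open>Fatou's lemma, in the form in which completeness, the Fourier contraction and the
  Fourier-Wigner bound pass to pointwise limits.\<close>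

lemma nn_integral_limit_le:
  fixes f :: "nat \<Rightarrow> 'a \<Rightarrow> real"
  assumes [measurable]: "\<And>k. f k \<in> borel_measurable M"
    and lim: "AE x in M. (\<lambda>k. f k x) \<longlonglongrightarrow> g x"
    and le: "\<forall>\<^sub>F k in sequentially. (\<integral>\<^sup>+x. ennreal (f k x) \<partial>M) \<le> C"
  shows "(\<integral>\<^sup>+x. ennreal (g x) \<partial>M) \<le> C"
proof -
  have "(\<integral>\<^sup>+x. ennreal (g x) \<partial>M) = (\<integral>\<^sup>+x. liminf (\<lambda>k. ennreal (f k x)) \<partial>M)"
    using lim by (intro nn_integral_cong_AE)
      (auto elim!: eventually_mono intro!: lim_imp_Liminf[symmetric] tendsto_ennrealI)
  also have "\<dots> \<le> liminf (\<lambda>k. \<integral>\<^sup>+x. ennreal (f k x) \<partial>M)" by (rule nn_integral_liminf) measurable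
  also have "\<dots> \<le> liminf (\<lambda>k. C)" by (rule Liminf_mono[OF le])
  finally show ?thesis by (simp add: Liminf_const)
qed

text \<open>Riesz-Fischer. Along a fast subsequence the increments have square norm at most 4^-i, so
  the sum of 2^i |d i|^2 has finite integral and is finite almost everywhere, whence the subsequence
  converges pointwise. Fatou's lemma then shows that the whole sequence converges to this limit in
  square norm.\<close>

lemma L2_complete:
  assumes f: "\<And>k. f k \<in> L2 M"
    and cauchy: "\<And>\<epsilon>. \<epsilon> > 0 \<Longrightarrow> \<exists>N. \<forall>j\<ge>N. \<forall>k\<ge>N. L2sq M (\<lambda>x. f j x - f k x) < \<epsilon>"
  obtains g where "L2_tendsto M f g"
proof -
  note [measurable] = L2_measurable[OF f]
  have "\<forall>i. \<exists>N. \<forall>j\<ge>N. \<forall>k\<ge>N. L2sq M (\<lambda>x. f j x - f k x) < (1/4) ^ i" using cauchy by simp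
  then obtain N where N: "\<And>i j k. j \<ge> N i \<Longrightarrow> k \<ge> N i \<Longrightarrow> L2sq M (\<lambda>x. f j x - f k x) < (1/4) ^ i" by metis
  \<comment> \<open>The partial sum makes r monotone with r i at least N i; the summand i makes it
    exceed every index.\<close>
  define r where "r i = (\<Sum>j\<le>i. N j) + i" for i
  have rN: "r i \<ge> N i" for i unfolding r_def by (metis atMost_iff finite_atMost member_le_sum order_refl trans_le_add1 zero_le)
  have rS: "r (Suc i) \<ge> r i" for i by (simp add: r_def)
  define d where "d i = (\<lambda>x. f (r (Suc i)) x - f (r i) x)" for i
  have d [measurable]: "d i \<in> borel_measurable M" for i unfolding d_def by measurable
  have dL2: "d i \<in> L2 M" for i unfolding d_def by (intro L2_diff f)
  have dsq: "L2sq M (d i) \<le> (1/4) ^ i" for i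
    unfolding d_def using N[of i "r (Suc i)" "r i"] rN[of i] rS[of i] by simp
  have "(\<integral>\<^sup>+x. (\<Sum>i. ennreal (2 ^ i * (cmod (d i x))\<^sup>2)) \<partial>M) = (\<Sum>i. \<integral>\<^sup>+x. ennreal (2 ^ i * (cmod (d i x))\<^sup>2) \<partial>M)"
    by (rule nn_integral_suminf) measurable
  also have "\<dots> = (\<Sum>i. ennreal (2 ^ i * L2sq M (d i)))"
    by (simp add: ennreal_mult' nn_integral_cmult nn_integral_L2sq[OF dL2])
  also have "\<dots> \<le> (\<Sum>i. ennreal ((1/2) ^ i))"
  proof (intro suminf_le ennreal_leI summableI)
    fix i :: nat
    have "2 ^ i * L2sq M (d i) \<le> 2 ^ i * (1/4) ^ i" by (intro mult_left_mono dsq) simp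
    also have "\<dots> = (1/2) ^ i" by (simp flip: power_mult_distrib)
    finally show "2 ^ i * L2sq M (d i) \<le> (1/2) ^ i" .
  qed
  also have "\<dots> = ennreal (\<Sum>i. (1/2) ^ i)" by (rule suminf_ennreal2) auto
  also have "\<dots> < \<infinity>" by simp
  finally have "AE x in M. (\<Sum>i. ennreal (2 ^ i * (cmod (d i x))\<^sup>2)) \<noteq> \<infinity>"
    by (intro nn_integral_PInf_AE) auto
  moreover have "convergent (\<lambda>i. f (r i) x)" if "(\<Sum>i. ennreal (2 ^ i * (cmod (d i x))\<^sup>2)) \<noteq> \<infinity>" for x
  proof -
    have "summable (\<lambda>i. 2 ^ i * (cmod (d i x))\<^sup>2)"
      using that by (intro summable_suminf_not_top) auto
    then have "summable (\<lambda>i. (1/2) ^ i + 2 ^ i * (cmod (d i x))\<^sup>2)"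
      by (intro summable_add summable_geometric) auto
    then have "summable (\<lambda>i. d i x)"
      by (rule summable_comparison_test'[where N = 0]) (rule le_power_plus_power_mult_square)
    then have "convergent (\<lambda>n. \<Sum>i<n. d i x)" by (simp add: summable_iff_convergent)
    moreover have "(\<Sum>i<n. d i x) = f (r n) x - f (r 0) x" for n
      unfolding d_def by (rule sum_lessThan_telescope)
    ultimately have "convergent (\<lambda>n. (f (r n) x - f (r 0) x) + f (r 0) x)"
      by (intro convergent_add convergent_const) simp
    then show ?thesis by simp
  qed
  ultimately have conv: "AE x in M. convergent (\<lambda>i. f (r i) x)" by auto
  define g where "g x = lim (\<lambda>i. f (r i) x)" for x
  have g [measurable]: "g \<in> borel_measurable M" unfolding g_def by measurable
  have lim: "AE x in M. (\<lambda>i. f (r i) x) \<longlonglongrightarrow> g x"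
    using conv by eventually_elim (simp add: g_def convergent_LIMSEQ_iff)
  have close: "(\<lambda>x. f j x - g x) \<in> L2 M \<and> L2sq M (\<lambda>x. f j x - g x) \<le> \<epsilon>"
    if "\<epsilon> > 0" "\<And>k. k \<ge> n \<Longrightarrow> L2sq M (\<lambda>x. f j x - f k x) < \<epsilon>" for j n \<epsilon>
  proof -
    have r_ge: "r i \<ge> i" for i by (simp add: r_def)
    have "(\<integral>\<^sup>+x. ennreal ((cmod (f j x - g x))\<^sup>2) \<partial>M) \<le> ennreal \<epsilon>"
    proof (rule nn_integral_limit_le)
      show "AE x in M. (\<lambda>i. (cmod (f j x - f (r i) x))\<^sup>2) \<longlonglongrightarrow> (cmod (f j x - g x))\<^sup>2"
        using lim by eventually_elim (intro tendsto_intros)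
      show "\<forall>\<^sub>F i in sequentially. (\<integral>\<^sup>+x. ennreal ((cmod (f j x - f (r i) x))\<^sup>2) \<partial>M) \<le> ennreal \<epsilon>"
      proof (rule eventually_sequentiallyI[of n])
        fix i assume "n \<le> i"
        then have "L2sq M (\<lambda>x. f j x - f (r i) x) \<le> \<epsilon>" using that(2)[of "r i"] r_ge[of i] by simp
        then show "(\<integral>\<^sup>+x. ennreal ((cmod (f j x - f (r i) x))\<^sup>2) \<partial>M) \<le> ennreal \<epsilon>"
          unfolding nn_integral_L2sq[OF L2_diff[OF f f]] by (rule ennreal_leI)
      qed
    qed measurable
    then show ?thesis using L2sq_leI[of "\<lambda>x. f j x - g x" M \<epsilon>] that(1) by simp
  qed
  have ex: "\<exists>n. \<forall>j\<ge>n. (\<lambda>x. f j x - g x) \<in> L2 M \<and> L2sq M (\<lambda>x. f j x - g x) \<le> \<epsilon>" if e: "\<epsilon> > 0" for \<epsilon>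
  proof -
    obtain n where "\<forall>j\<ge>n. \<forall>k\<ge>n. L2sq M (\<lambda>x. f j x - f k x) < \<epsilon>" using cauchy[OF e] by blast
    then show ?thesis using close[OF e, of n] by blast
  qed
  obtain n where "(\<lambda>x. f n x - g x) \<in> L2 M" using ex[of 1] by auto
  from L2_diff[OF f[of n] this] have gL2: "g \<in> L2 M" by simp
  have "(\<lambda>k. L2sq M (\<lambda>x. f k x - g x)) \<longlonglongrightarrow> 0"
  proof (rule LIMSEQ_I)
    fix e :: real assume "e > 0"
    then obtain n where "\<forall>j\<ge>n. L2sq M (\<lambda>x. f j x - g x) \<le> e / 2" using ex[of "e/2"] by auto
    then show "\<exists>no. \<forall>n\<ge>no. norm (L2sq M (\<lambda>x. f n x - g x) - 0) < e"
      using \<open>e > 0\<close> by (intro exI[of _ n]) auto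
  qed
  then have "L2_tendsto M f g" using f gL2 by (simp add: L2_tendsto_iff)
  then show ?thesis using that by blast
qed

lemma L2_tendsto_Cauchy:
  assumes "L2_tendsto M f g" "\<epsilon> > 0"
  shows "\<exists>N. \<forall>j\<ge>N. \<forall>k\<ge>N. L2sq M (\<lambda>x. f j x - f k x) < \<epsilon>"
proof -
  have m: "\<And>k. f k \<in> L2 M" "g \<in> L2 M" using assms by (auto simp: L2_tendsto_iff)
  have "(\<lambda>k. L2sq M (\<lambda>x. f k x - g x)) \<longlonglongrightarrow> 0" using assms by (simp add: L2_tendsto_iff)
  then obtain N where N: "\<And>k. k \<ge> N \<Longrightarrow> L2sq M (\<lambda>x. f k x - g x) < \<epsilon> / 4"
    using assms(2) LIMSEQ_D[of _ 0 "\<epsilon>/4"] by fastforce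
  have "L2sq M (\<lambda>x. f j x - f k x) < \<epsilon>" if "j \<ge> N" "k \<ge> N" for j k
    using L2sq_diff_triangle[OF m(1) m(2) m(1), of j k] N[OF that(1)] N[OF that(2)]
      L2sq_minus_commute[of M "f k" g] by linarith
  then show ?thesis by blast
qed

lemma integrable_L2_product:
  assumes "f \<in> L2 M" "g \<in> L2 M" shows "integrable M (\<lambda>x. f x * cnj (g x))"
proof (rule Bochner_Integration.integrable_bound)
  note [measurable] = assms
  show "integrable M (\<lambda>x. (cmod (f x))\<^sup>2 + (cmod (g x))\<^sup>2)" using assms by (simp add: L2_def)
  show "(\<lambda>x. f x * cnj (g x)) \<in> borel_measurable M" by measurable
  have "a * b \<le> a\<^sup>2 + b\<^sup>2" if "0 \<le> a" "0 \<le> b" for a b :: real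
  proof -
    have "2 * (a * b) \<le> a\<^sup>2 + b\<^sup>2" using sum_squares_bound[of a b] by simp
    moreover have "0 \<le> a * b" using that by simp
    ultimately show ?thesis by linarith
  qed
  then show "AE x in M. norm (f x * cnj (g x)) \<le> norm ((cmod (f x))\<^sup>2 + (cmod (g x))\<^sup>2)"
    by (intro AE_I2) (simp add: norm_mult)
qed

lemma L2sq_orthogonal_sum:
  assumes "finite I" "\<And>i. i \<in> I \<Longrightarrow> f i \<in> L2 M"
    "\<And>i j. i \<in> I \<Longrightarrow> j \<in> I \<Longrightarrow> i \<noteq> j \<Longrightarrow> L2_inner M (f i) (f j) = 0"
  shows "L2sq M (\<lambda>x. \<Sum>i\<in>I. f i x) = (\<Sum>i\<in>I. L2sq M (f i))"
  using assms
proof (induction I)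
  case empty
  show ?case by (simp add: L2sq_def)
next
  case (insert i I)
  define g where "g = (\<lambda>x. \<Sum>j\<in>I. f j x)"
  have L2: "f i \<in> L2 M" "g \<in> L2 M" "\<And>j. j \<in> I \<Longrightarrow> f j \<in> L2 M"
    using insert.prems by (auto simp: g_def intro: L2_sum)
  have "(\<integral>x. f i x * cnj (g x) \<partial>M) = (\<integral>x. (\<Sum>j\<in>I. f i x * cnj (f j x)) \<partial>M)"
    by (simp add: g_def sum_distrib_left)
  also have "\<dots> = (\<Sum>j\<in>I. L2_inner M (f i) (f j))"
    unfolding L2_inner_def by (rule Bochner_Integration.integral_sum) (auto intro: integrable_L2_product L2)
  also have "\<dots> = 0" using insert by (intro sum.neutral) auto
  finally have 0: "(\<integral>x. f i x * cnj (g x) \<partial>M) = 0" .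
  have sq: "(cmod (a + b))\<^sup>2 = (cmod a)\<^sup>2 + (cmod b)\<^sup>2 + 2 * Re (a * cnj b)" for a b
    unfolding cmod_power2 by (simp add: power2_eq_square algebra_simps)
  have int: "integrable M (\<lambda>x. f i x * cnj (g x))" by (intro integrable_L2_product L2)
  have "L2sq M (\<lambda>x. \<Sum>j\<in>insert i I. f j x) = L2sq M (\<lambda>x. f i x + g x)"
    using insert.hyps by (simp add: g_def)
  also have "\<dots> = L2sq M (f i) + L2sq M g + 2 * Re (\<integral>x. f i x * cnj (g x) \<partial>M)"
    unfolding L2sq_def sq using int L2
    by (simp add: L2_integrable Bochner_Integration.integral_add integrable_Re del: times_complex.sel)
  also have "\<dots> = L2sq M (f i) + L2sq M g" unfolding 0 by simp
  finally show ?case using insert by (simp add: g_def)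
qed

section \<open>The Fourier transform is an \<open>L\<^sup>2\<close> contraction\<close>

text \<open>The substitution u = \<epsilon> d gives the characteristic function of the standard
  normal distribution at 2 pi (x - y) / \<epsilon>. The outcome is itself a normal density, of
  standard deviation \<epsilon> / (2 pi) and therefore of total mass one.\<close>

lemma gaussian_fourier:
  assumes \<epsilon>: "\<epsilon> > 0"
  shows "integrable lborel (\<lambda>d. complex_of_real (exp (- ((\<epsilon> * d)\<^sup>2) / 2)) * cis (2 * pi * ((x - y) * d)))" (is "integrable _ ?f")
    and "(\<integral>d. complex_of_real (exp (- ((\<epsilon> * d)\<^sup>2) / 2)) * cis (2 * pi * ((x - y) * d)) \<partial>lborel)
      = complex_of_real (normal_density y (\<epsilon> / (2 * pi)) x)"
proof -
  define t where "t = 2 * pi * (x - y) / \<epsilon>"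
  define g where "g u = complex_of_real (exp (- (u\<^sup>2) / 2)) * cis (t * u)" for u
  have t: "t * (\<epsilon> * d) = 2 * pi * ((x - y) * d)" for d using \<epsilon> by (simp add: t_def)
  have fg: "?f d = g (0 + \<epsilon> * d)" for d unfolding g_def add_0 t ..
  have nd: "g u = complex_of_real (sqrt (2 * pi)) * (std_normal_density u *\<^sub>R iexp (t * u))" for u
  proof -
    have E: "exp (- (u\<^sup>2) / 2) = sqrt (2 * pi) * std_normal_density u" by (simp add: std_normal_density_def)
    show ?thesis unfolding g_def cis_conv_exp scaleR_conv_of_real E of_real_mult by (simp only: mult.assoc)
  qed
  have int0: "integrable lborel (\<lambda>u. std_normal_density u *\<^sub>R iexp (t * u))"
    by (rule Bochner_Integration.integrable_bound[of _ std_normal_density]) auto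
  have intg: "integrable lborel g" unfolding nd by (intro integrable_mult_right int0)
  show "integrable lborel ?f" unfolding fg
    by (rule lborel_integrable_real_affine[OF intg]) (use \<epsilon> in simp)
  have "(\<integral>u. std_normal_density u *\<^sub>R iexp (t * u) \<partial>lborel) = char std_normal_distribution t"
    unfolding char_def by (subst integral_density) auto
  then have Ig: "(\<integral>u. g u \<partial>lborel) = complex_of_real (sqrt (2 * pi) * exp (- (t\<^sup>2) / 2))"
    unfolding nd integral_mult_right_zero by (simp add: char_std_normal_distribution)
  have "(\<integral>u. g u \<partial>lborel) = \<bar>\<epsilon>\<bar> *\<^sub>R (\<integral>d. g (0 + \<epsilon> * d) \<partial>lborel)"
    by (rule lborel_integral_real_affine) (use \<epsilon> in simp)
  then have "(\<integral>d. ?f d \<partial>lborel) = complex_of_real (sqrt (2 * pi) * exp (- (t\<^sup>2) / 2) / \<epsilon>)"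
    unfolding fg Ig using \<epsilon> by (simp add: scaleR_conv_of_real field_simps)
  also have "sqrt (2 * pi) * exp (- (t\<^sup>2) / 2) / \<epsilon> = normal_density y (\<epsilon> / (2 * pi)) x"
  proof -
    have s: "sqrt (2 * pi) > 0" "sqrt (2 * pi) * sqrt (2 * pi) = 2 * pi" by simp_all
    have "sqrt (2 * pi * (\<epsilon> / (2 * pi))\<^sup>2) = sqrt (2 * pi) * (\<epsilon> / (2 * pi))"
      using \<epsilon> by (simp add: real_sqrt_mult)
    moreover have "1 / (sqrt (2 * pi) * (\<epsilon> / (2 * pi))) = sqrt (2 * pi) / \<epsilon>"
      using s \<epsilon> by (simp add: divide_simps del: real_sqrt_mult_self)
    moreover have "- ((x - y)\<^sup>2) / (2 * (\<epsilon> / (2 * pi))\<^sup>2) = - (t\<^sup>2) / 2"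
      using \<epsilon> by (simp add: t_def power2_eq_square field_simps)
    ultimately show ?thesis unfolding normal_density_def by simp
  qed
  finally show "(\<integral>d. ?f d \<partial>lborel) = complex_of_real (normal_density y (\<epsilon> / (2 * pi)) x)" .
qed

text \<open>Provides the absolute integrability behind the two Fubini interchanges in the Gaussian
  bound, where \<open>w\<close> is an oscillating factor or a bounded Fourier transform times
  one.\<close>

lemma integrable_tensor_bounded:
  fixes a :: "'a \<Rightarrow> complex" and b :: "'b \<Rightarrow> complex" and w :: "'a \<Rightarrow> 'b \<Rightarrow> complex"
  assumes "sigma_finite_measure M" "sigma_finite_measure N" "integrable M a" "integrable N b"
    and w: "(\<lambda>(x, y). w x y) \<in> borel_measurable (M \<Otimes>\<^sub>M N)" "\<And>x y. cmod (w x y) \<le> C"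
  shows "integrable (M \<Otimes>\<^sub>M N) (\<lambda>(x, y). a x * b y * w x y)"
proof -
  interpret pair_sigma_finite M N using assms(1,2) by (simp add: pair_sigma_finite_def)
  note [measurable] = assms(3,4)[THEN borel_measurable_integrable]
  have w' [measurable]: "(\<lambda>p. w (fst p) (snd p)) \<in> borel_measurable (M \<Otimes>\<^sub>M N)"
    using w(1) by (simp add: case_prod_unfold)
  show ?thesis
  proof (rule Bochner_Integration.integrable_bound)
    show "integrable (M \<Otimes>\<^sub>M N) (\<lambda>(x, y). C *\<^sub>R (cmod (a x) * cmod (b y)))"
    proof (rule Fubini_integrable)
      show "AE x in M. integrable N (\<lambda>y. case (x, y) of (x, y) \<Rightarrow> C *\<^sub>R (cmod (a x) * cmod (b y)))"
        using assms(4) by simp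
      have "integrable M (\<lambda>x. cmod (a x) * (\<bar>C\<bar> * (\<integral>y. cmod (b y) \<partial>N)))" using assms(3) by simp
      then show "integrable M (\<lambda>x. \<integral>y. norm (case (x, y) of (x, y) \<Rightarrow> C *\<^sub>R (cmod (a x) * cmod (b y))) \<partial>N)"
        by (simp add: abs_mult mult_ac)
    qed measurable
    show "(\<lambda>(x, y). a x * b y * w x y) \<in> borel_measurable (M \<Otimes>\<^sub>M N)"
      by (simp add: case_prod_unfold) measurable
    have "cmod (a x * b y * w x y) \<le> cmod (a x) * cmod (b y) * \<bar>C\<bar>" for x y
      using w(2)[of x y] by (simp add: norm_mult mult_left_mono)
    then show "AE p in M \<Otimes>\<^sub>M N. norm (case p of (x, y) \<Rightarrow> a x * b y * w x y)
        \<le> norm (case p of (x, y) \<Rightarrow> C *\<^sub>R (cmod (a x) * cmod (b y)))"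
      by (intro AE_I2) (auto simp: abs_mult mult_ac)
  qed
qed

section \<open>The Fourier transform in coordinates\<close>

lemma cis_sum: "cis (\<Sum>i\<in>I. f i) = (\<Prod>i\<in>I. cis (f i))"
  by (induction I rule: infinite_finite_induct) (auto simp: cis_mult[symmetric])

abbreviation leb :: "nat set \<Rightarrow> (nat \<Rightarrow> real) measure" where
  "leb I \<equiv> Pi\<^sub>M I (\<lambda>_. lborel)"

interpretation leb: product_sigma_finite "\<lambda>_::nat. lborel::real measure"
  by (simp add: product_sigma_finite_def lborel.sigma_finite_measure_axioms)

lemma leb_component_measurable [measurable]: "i \<in> I \<Longrightarrow> (\<lambda>c. c i) \<in> borel_measurable (leb I)"
  using measurable_component_singleton[of i I "\<lambda>_. lborel::real measure"] by simp

definition dotp :: "nat set \<Rightarrow> (nat \<Rightarrow> real) \<Rightarrow> (nat \<Rightarrow> real) \<Rightarrow> real" where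
  "dotp I c d = (\<Sum>i\<in>I. c i * d i)"

definition coord_fourier :: "nat set \<Rightarrow> ((nat \<Rightarrow> real) \<Rightarrow> complex) \<Rightarrow> (nat \<Rightarrow> real) \<Rightarrow> complex" where
  "coord_fourier I u d = (\<integral>c. u c * cis (2 * pi * dotp I c d) \<partial>leb I)"

lemma measurable_cis [measurable]: "f \<in> borel_measurable M \<Longrightarrow> (\<lambda>x. cis (f x)) \<in> borel_measurable M"
  by (erule measurable_compose[OF _ borel_measurable_continuous_onI]) (simp add: cis_conv_exp continuous_intros)

lemma measurable_dotp [measurable]:
  assumes "f \<in> measurable M (leb I)" "g \<in> measurable M (leb I)"
  shows "(\<lambda>x. dotp I (f x) (g x)) \<in> borel_measurable M"
proof -
  have "(\<lambda>x. f x i) \<in> borel_measurable M" "(\<lambda>x. g x i) \<in> borel_measurable M" if "i \<in> I" for i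
    using measurable_compose[OF assms(1) measurable_component_singleton[OF that]]
      measurable_compose[OF assms(2) measurable_component_singleton[OF that]] by simp_all
  then show ?thesis unfolding dotp_def by (intro borel_measurable_sum borel_measurable_times) auto
qed

lemma measurable_dotp_const [measurable]:
  assumes "g \<in> measurable M (leb I)"
  shows "(\<lambda>x. dotp I y (g x)) \<in> borel_measurable M"
proof -
  have "(\<lambda>x. g x i) \<in> borel_measurable M" if "i \<in> I" for i
    using measurable_compose[OF assms measurable_component_singleton[OF that]] by simp
  then show ?thesis unfolding dotp_def by (intro borel_measurable_sum borel_measurable_times) auto
qed

lemma coord_fourier_measurable:
  assumes "finite I" "u \<in> borel_measurable (leb I)"
  shows "coord_fourier I u \<in> borel_measurable (leb I)"
proof -
  interpret sigma_finite_measure "leb I" by (rule leb.sigma_finite[OF assms(1)])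
  note [measurable] = assms(2)
  show ?thesis unfolding coord_fourier_def[abs_def] by measurable
qed

lemma gaussian_fourier_coord:
  assumes I: "finite I" and \<epsilon>: "\<epsilon> > 0"
  shows "integrable (leb I) (\<lambda>d. complex_of_real (\<Prod>i\<in>I. exp (- ((\<epsilon> * d i)\<^sup>2) / 2)) * cis (2 * pi * (dotp I x d - dotp I y d)))"
    and "(\<integral>d. complex_of_real (\<Prod>i\<in>I. exp (- ((\<epsilon> * d i)\<^sup>2) / 2)) * cis (2 * pi * (dotp I x d - dotp I y d)) \<partial>leb I)
      = complex_of_real (\<Prod>i\<in>I. normal_density (y i) (\<epsilon> / (2 * pi)) (x i))"
proof -
  have eq: "complex_of_real (\<Prod>i\<in>I. exp (- ((\<epsilon> * d i)\<^sup>2) / 2)) * cis (2 * pi * (dotp I x d - dotp I y d))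
    = (\<Prod>i\<in>I. complex_of_real (exp (- ((\<epsilon> * d i)\<^sup>2) / 2)) * cis (2 * pi * ((x i - y i) * d i)))" for d
  proof -
    have "2 * pi * (dotp I x d - dotp I y d) = (\<Sum>i\<in>I. 2 * pi * ((x i - y i) * d i))"
      by (simp add: dotp_def sum_distrib_left left_diff_distrib right_diff_distrib sum_subtractf)
    then show ?thesis by (simp add: cis_sum prod.distrib)
  qed
  show "integrable (leb I) (\<lambda>d. complex_of_real (\<Prod>i\<in>I. exp (- ((\<epsilon> * d i)\<^sup>2) / 2)) * cis (2 * pi * (dotp I x d - dotp I y d)))"
    unfolding eq by (rule leb.product_integrable_prod[OF I gaussian_fourier(1)[OF \<epsilon>]])
  show "(\<integral>d. complex_of_real (\<Prod>i\<in>I. exp (- ((\<epsilon> * d i)\<^sup>2) / 2)) * cis (2 * pi * (dotp I x d - dotp I y d)) \<partial>leb I)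
      = complex_of_real (\<Prod>i\<in>I. normal_density (y i) (\<epsilon> / (2 * pi)) (x i))"
    unfolding eq leb.product_integral_prod[OF I gaussian_fourier(1)[OF \<epsilon>]]
    by (simp only: gaussian_fourier(2)[OF \<epsilon>] of_real_prod)
qed

text \<open>Mass one in either variable, because a normal density is symmetric in its mean and its
  argument. These are the row and column bounds for Schur's test.\<close>

lemma nn_integral_normal_density_prod:
  assumes "finite I" "\<sigma> > 0"
  shows "(\<integral>\<^sup>+x. ennreal (\<Prod>i\<in>I. normal_density (y i) \<sigma> (x i)) \<partial>leb I) = 1"
    and "(\<integral>\<^sup>+x. ennreal (\<Prod>i\<in>I. normal_density (x i) \<sigma> (y i)) \<partial>leb I) = 1"
proof -
  have sym: "normal_density a \<sigma> b = normal_density b \<sigma> a" for a b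
    by (simp add: normal_density_def power2_commute)
  have 1: "(\<integral>\<^sup>+x. ennreal (normal_density (y i) \<sigma> x) \<partial>lborel) = 1" for i
    using assms(2) by (subst nn_integral_eq_integral) auto
  show *: "(\<integral>\<^sup>+x. ennreal (\<Prod>i\<in>I. normal_density (y i) \<sigma> (x i)) \<partial>leb I) = 1"
    using leb.product_nn_integral_prod[OF assms(1), of "\<lambda>i x. ennreal (normal_density (y i) \<sigma> x)"]
    by (simp add: prod_ennreal[symmetric] 1)
  show "(\<integral>\<^sup>+x. ennreal (\<Prod>i\<in>I. normal_density (x i) \<sigma> (y i)) \<partial>leb I) = 1"
    using * by (simp add: sym)
qed

lemma norm_integral_le_nn_integral:
  fixes f :: "'a \<Rightarrow> 'b::{banach, second_countable_topology}"
  shows "ennreal (norm (integral\<^sup>L M f)) \<le> (\<integral>\<^sup>+x. ennreal (norm (f x)) \<partial>M)"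
  by (cases "integrable M f") (auto intro: integral_norm_bound_ennreal simp: not_integrable_integral_eq)

text \<open>The Gaussian weight makes the triple integral behind |U|^2 absolutely convergent for
  integrable \<open>u\<close>. Integrating the weight first turns the left side into the quadratic
  form of u with the kernel \<Gamma>, a normal density of mass one in each variable, and Schur's
  test bounds this form by the square norm of u. The right side may be infinite.\<close>

lemma coord_fourier_gaussian_bound:
  assumes I: "finite I" and u: "integrable (leb I) u" and \<epsilon>: "\<epsilon> > 0"
  shows "(\<integral>\<^sup>+d. ennreal ((cmod (coord_fourier I u d))\<^sup>2 * (\<Prod>i\<in>I. exp (- ((\<epsilon> * d i)\<^sup>2) / 2))) \<partial>leb I)
    \<le> (\<integral>\<^sup>+c. ennreal ((cmod (u c))\<^sup>2) \<partial>leb I)"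
proof -
  interpret M: sigma_finite_measure "leb I" by (rule leb.sigma_finite[OF I])
  interpret MM: pair_sigma_finite "leb I" "leb I" ..
  note [measurable] = borel_measurable_integrable[OF u]
  define G where "G d = (\<Prod>i\<in>I. exp (- ((\<epsilon> * d i)\<^sup>2) / 2))" for d :: "nat \<Rightarrow> real"
  define \<Gamma> where "\<Gamma> x y = (\<Prod>i\<in>I. normal_density (y i) (\<epsilon> / (2 * pi)) (x i))" for x y :: "nat \<Rightarrow> real"
  have G0: "G d \<ge> 0" for d by (simp add: G_def prod_nonneg)
  have \<Gamma>0: "\<Gamma> x y \<ge> 0" for x y by (simp add: \<Gamma>_def prod_nonneg)
  have \<sigma>: "\<epsilon> / (2 * pi) > 0" using \<epsilon> by simp
  have Gm [measurable]: "G \<in> borel_measurable (leb I)" unfolding G_def[abs_def] by measurable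
  have \<Gamma>m [measurable]: "(\<lambda>p. \<Gamma> (fst p) (snd p)) \<in> borel_measurable (leb I \<Otimes>\<^sub>M leb I)"
    unfolding \<Gamma>_def normal_density_def by measurable
  have \<Gamma>m' [measurable]: "(\<lambda>p. \<Gamma> (snd p) (fst p)) \<in> borel_measurable (leb I \<Otimes>\<^sub>M leb I)"
    unfolding \<Gamma>_def normal_density_def by measurable
  have \<Gamma>1 [measurable]: "(\<lambda>x. \<Gamma> x y) \<in> borel_measurable (leb I)"
    and \<Gamma>2 [measurable]: "(\<lambda>x. \<Gamma> y x) \<in> borel_measurable (leb I)" for y
    unfolding \<Gamma>_def normal_density_def by measurable
  have \<Gamma>I: "(\<integral>\<^sup>+x. c * ennreal (\<Gamma> x y) \<partial>leb I) = c" "(\<integral>\<^sup>+x. c * ennreal (\<Gamma> y x) \<partial>leb I) = c" for c y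
    using nn_integral_normal_density_prod[OF I \<sigma>, of y] by (simp_all add: nn_integral_cmult flip: \<Gamma>_def)
  have Gint: "integrable (leb I) (\<lambda>d. complex_of_real (G d))"
    using gaussian_fourier_coord(1)[OF I \<epsilon>, of "\<lambda>_. 0" "\<lambda>_. 0"] by (simp add: G_def)
  have uc: "integrable (leb I) (\<lambda>y. cnj (u y))" using u by simp
  define U where "U = coord_fourier I u"
  have [measurable]: "U \<in> borel_measurable (leb I)" unfolding U_def by (rule coord_fourier_measurable[OF I]) measurable
  have Ub: "cmod (U d) \<le> (\<integral>c. cmod (u c) \<partial>leb I)" for d
    unfolding U_def coord_fourier_def
    by (rule order_trans[OF integral_norm_bound]) (simp add: norm_mult)
  \<comment> \<open>The inverse Fourier integral of G U, which the next fact identifies as u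
    smoothed by \<Gamma>.\<close>
  define v where "v y = (\<integral>d. complex_of_real (G d) * (U d * cis (- (2 * pi * dotp I y d))) \<partial>leb I)" for y
  have v: "v y = (\<integral>x. u x * complex_of_real (\<Gamma> x y) \<partial>leb I)" for y
  proof -
    have "v y = (\<integral>d. (\<integral>x. complex_of_real (G d) * u x * cis (2 * pi * (dotp I x d - dotp I y d)) \<partial>leb I) \<partial>leb I)"
    proof -
      have c: "complex_of_real (G d) * u x * cis (2 * pi * (dotp I x d - dotp I y d))
          = complex_of_real (G d) * ((u x * cis (2 * pi * dotp I x d)) * cis (- (2 * pi * dotp I y d)))" for d x
        by (simp add: right_diff_distrib cis_mult mult.assoc)
      show ?thesis unfolding v_def U_def coord_fourier_def c integral_mult_right_zero integral_mult_left_zero ..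
    qed
    also have "\<dots> = (\<integral>x. (\<integral>d. complex_of_real (G d) * u x * cis (2 * pi * (dotp I x d - dotp I y d)) \<partial>leb I) \<partial>leb I)"
      by (rule MM.Fubini_integral[symmetric, where f = "\<lambda>d x. complex_of_real (G d) * u x * cis (2 * pi * (dotp I x d - dotp I y d))"])
         (rule integrable_tensor_bounded[where C = 1, OF M.sigma_finite_measure_axioms M.sigma_finite_measure_axioms Gint u],
          simp_all add: case_prod_unfold)
    also have "\<dots> = (\<integral>x. u x * (\<integral>d. complex_of_real (G d) * cis (2 * pi * (dotp I x d - dotp I y d)) \<partial>leb I) \<partial>leb I)"
      unfolding mult.assoc mult.left_commute[of _ "u _"] integral_mult_right_zero ..
    also have "\<dots> = (\<integral>x. u x * complex_of_real (\<Gamma> x y) \<partial>leb I)"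
      unfolding G_def \<Gamma>_def gaussian_fourier_coord(2)[OF I \<epsilon>] ..
    finally show ?thesis .
  qed
  have sq: "complex_of_real ((cmod z)\<^sup>2) = z * cnj z" for z by (rule complex_norm_square)
  have cU: "cnj (U d) = (\<integral>y. cnj (u y) * cis (- (2 * pi * dotp I y d)) \<partial>leb I)" for d
    unfolding U_def coord_fourier_def by (simp add: cis_cnj flip: Bochner_Integration.integral_cnj)
  have "(\<integral>d. complex_of_real ((cmod (U d))\<^sup>2 * G d) \<partial>leb I)
      = (\<integral>d. (\<integral>y. complex_of_real (G d) * cnj (u y) * (U d * cis (- (2 * pi * dotp I y d))) \<partial>leb I) \<partial>leb I)"
  proof (rule Bochner_Integration.integral_cong[OF refl])
    fix d
    have c: "complex_of_real (G d) * cnj (u y) * (U d * cis (- (2 * pi * dotp I y d)))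
        = (complex_of_real (G d) * U d) * (cnj (u y) * cis (- (2 * pi * dotp I y d)))" for y by (simp add: mult_ac)
    show "complex_of_real ((cmod (U d))\<^sup>2 * G d)
        = (\<integral>y. complex_of_real (G d) * cnj (u y) * (U d * cis (- (2 * pi * dotp I y d))) \<partial>leb I)"
      unfolding c integral_mult_right_zero cU[symmetric] of_real_mult sq by (simp add: mult_ac)
  qed
  also have "\<dots> = (\<integral>y. (\<integral>d. complex_of_real (G d) * cnj (u y) * (U d * cis (- (2 * pi * dotp I y d))) \<partial>leb I) \<partial>leb I)"
    by (rule MM.Fubini_integral[symmetric, where f = "\<lambda>d y. complex_of_real (G d) * cnj (u y) * (U d * cis (- (2 * pi * dotp I y d)))"])
       (rule integrable_tensor_bounded[where C = "\<integral>c. cmod (u c) \<partial>leb I", OF M.sigma_finite_measure_axioms M.sigma_finite_measure_axioms Gint uc],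
        simp_all add: norm_mult Ub case_prod_unfold)
  also have "\<dots> = (\<integral>y. cnj (u y) * v y \<partial>leb I)"
    unfolding v_def mult.assoc mult.left_commute[of _ "cnj _"] integral_mult_right_zero ..
  finally have main: "(\<integral>d. complex_of_real ((cmod (U d))\<^sup>2 * G d) \<partial>leb I) = (\<integral>y. cnj (u y) * v y \<partial>leb I)" .
  have int: "integrable (leb I) (\<lambda>d. (cmod (U d))\<^sup>2 * G d)"
  proof (rule Bochner_Integration.integrable_bound)
    show "integrable (leb I) (\<lambda>d. complex_of_real ((\<integral>c. cmod (u c) \<partial>leb I)\<^sup>2) * complex_of_real (G d))"
      using Gint by simp
    show "AE d in leb I. norm ((cmod (U d))\<^sup>2 * G d) \<le> norm (complex_of_real ((\<integral>c. cmod (u c) \<partial>leb I)\<^sup>2) * complex_of_real (G d))"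
      using G0 Ub by (intro AE_I2) (auto simp: norm_mult norm_power intro!: mult_right_mono power_mono)
  qed measurable
  have "(\<integral>\<^sup>+d. ennreal ((cmod (U d))\<^sup>2 * G d) \<partial>leb I) = ennreal (\<integral>d. (cmod (U d))\<^sup>2 * G d \<partial>leb I)"
    by (rule nn_integral_eq_integral[OF int]) (auto simp: G0)
  also have "\<dots> = ennreal (cmod (\<integral>d. complex_of_real ((cmod (U d))\<^sup>2 * G d) \<partial>leb I))"
    unfolding integral_complex_of_real by (simp add: G0 integral_nonneg_AE)
  also have "\<dots> \<le> (\<integral>\<^sup>+y. ennreal (cmod (cnj (u y) * v y)) \<partial>leb I)"
    unfolding main by (rule norm_integral_le_nn_integral)
  also have "\<dots> \<le> (\<integral>\<^sup>+y. (\<integral>\<^sup>+x. ennreal (cmod (u y) * cmod (u x) * \<Gamma> x y) \<partial>leb I) \<partial>leb I)"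
  proof (rule nn_integral_mono)
    fix y
    have "ennreal (cmod (cnj (u y) * v y)) = ennreal (cmod (u y)) * ennreal (cmod (v y))"
      by (simp add: norm_mult ennreal_mult)
    also have "\<dots> \<le> ennreal (cmod (u y)) * (\<integral>\<^sup>+x. ennreal (cmod (u x * complex_of_real (\<Gamma> x y))) \<partial>leb I)"
      unfolding v by (intro mult_left_mono norm_integral_le_nn_integral) simp
    also have "\<dots> = (\<integral>\<^sup>+x. ennreal (cmod (u y)) * ennreal (cmod (u x * complex_of_real (\<Gamma> x y))) \<partial>leb I)"
      by (rule nn_integral_cmult[symmetric]) measurable
    also have "\<dots> = (\<integral>\<^sup>+x. ennreal (cmod (u y) * cmod (u x) * \<Gamma> x y) \<partial>leb I)"
      by (simp add: norm_mult \<Gamma>0 mult.assoc flip: ennreal_mult')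
    finally show "ennreal (cmod (cnj (u y) * v y)) \<le> (\<integral>\<^sup>+x. ennreal (cmod (u y) * cmod (u x) * \<Gamma> x y) \<partial>leb I)" .
  qed
  \<comment> \<open>Schur's test: the product of two values of u is split by the
    arithmetic-geometric mean inequality, and in each half \<Gamma> is integrated first in the
    variable on which u does not depend.\<close>
  also have "\<dots> \<le> (\<integral>\<^sup>+y. (\<integral>\<^sup>+x. ennreal ((cmod (u y))\<^sup>2 / 2) * ennreal (\<Gamma> x y) + ennreal ((cmod (u x))\<^sup>2 / 2) * ennreal (\<Gamma> x y) \<partial>leb I) \<partial>leb I)"
  proof (intro nn_integral_mono)
    fix x y
    have "cmod (u y) * cmod (u x) \<le> (cmod (u y))\<^sup>2 / 2 + (cmod (u x))\<^sup>2 / 2"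
      using sum_squares_bound[of "cmod (u y)" "cmod (u x)"] by simp
    then have "cmod (u y) * cmod (u x) * \<Gamma> x y \<le> ((cmod (u y))\<^sup>2 / 2 + (cmod (u x))\<^sup>2 / 2) * \<Gamma> x y"
      by (intro mult_right_mono \<Gamma>0)
    then show "ennreal (cmod (u y) * cmod (u x) * \<Gamma> x y)
        \<le> ennreal ((cmod (u y))\<^sup>2 / 2) * ennreal (\<Gamma> x y) + ennreal ((cmod (u x))\<^sup>2 / 2) * ennreal (\<Gamma> x y)"
      using \<Gamma>0[of x y] by (simp add: distrib_right flip: ennreal_mult ennreal_plus)
  qed
  also have "\<dots> = (\<integral>\<^sup>+y. (\<integral>\<^sup>+x. ennreal ((cmod (u y))\<^sup>2 / 2) * ennreal (\<Gamma> x y) \<partial>leb I) \<partial>leb I)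
      + (\<integral>\<^sup>+y. (\<integral>\<^sup>+x. ennreal ((cmod (u x))\<^sup>2 / 2) * ennreal (\<Gamma> x y) \<partial>leb I) \<partial>leb I)"
  proof -
    have "(\<integral>\<^sup>+x. ennreal ((cmod (u y))\<^sup>2 / 2) * ennreal (\<Gamma> x y) + ennreal ((cmod (u x))\<^sup>2 / 2) * ennreal (\<Gamma> x y) \<partial>leb I)
        = (\<integral>\<^sup>+x. ennreal ((cmod (u y))\<^sup>2 / 2) * ennreal (\<Gamma> x y) \<partial>leb I) + (\<integral>\<^sup>+x. ennreal ((cmod (u x))\<^sup>2 / 2) * ennreal (\<Gamma> x y) \<partial>leb I)" for y
      by (rule nn_integral_add) measurable
    moreover have "(\<lambda>y. \<integral>\<^sup>+x. ennreal ((cmod (u x))\<^sup>2 / 2) * ennreal (\<Gamma> x y) \<partial>leb I) \<in> borel_measurable (leb I)"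
      by (rule M.borel_measurable_nn_integral) (use \<Gamma>m' in measurable)
    ultimately show ?thesis unfolding \<Gamma>I by (simp only:) (rule nn_integral_add, measurable)
  qed
  also have "(\<integral>\<^sup>+y. (\<integral>\<^sup>+x. ennreal ((cmod (u x))\<^sup>2 / 2) * ennreal (\<Gamma> x y) \<partial>leb I) \<partial>leb I)
      = (\<integral>\<^sup>+x. (\<integral>\<^sup>+y. ennreal ((cmod (u x))\<^sup>2 / 2) * ennreal (\<Gamma> x y) \<partial>leb I) \<partial>leb I)"
    by (rule MM.Fubini') (use \<Gamma>m in measurable)
  also have "(\<integral>\<^sup>+x. (\<integral>\<^sup>+y. ennreal ((cmod (u x))\<^sup>2 / 2) * ennreal (\<Gamma> x y) \<partial>leb I) \<partial>leb I) = (\<integral>\<^sup>+x. ennreal ((cmod (u x))\<^sup>2 / 2) \<partial>leb I)"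
    unfolding \<Gamma>I ..
  also have "(\<integral>\<^sup>+y. (\<integral>\<^sup>+x. ennreal ((cmod (u y))\<^sup>2 / 2) * ennreal (\<Gamma> x y) \<partial>leb I) \<partial>leb I) = (\<integral>\<^sup>+x. ennreal ((cmod (u x))\<^sup>2 / 2) \<partial>leb I)"
    unfolding \<Gamma>I ..
  also have "(\<integral>\<^sup>+x. ennreal ((cmod (u x))\<^sup>2 / 2) \<partial>leb I) + (\<integral>\<^sup>+x. ennreal ((cmod (u x))\<^sup>2 / 2) \<partial>leb I)
      = (\<integral>\<^sup>+x. ennreal ((cmod (u x))\<^sup>2) \<partial>leb I)"
    by (subst nn_integral_add[symmetric]) (simp_all flip: ennreal_plus)
  finally show ?thesis unfolding U_def G_def .
qed

text \<open>As \<epsilon> tends to 0 the weights tend to 1 pointwise, and Fatou's lemma preserves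
  the bound, which is uniform in \<epsilon>.\<close>

lemma coord_fourier_L2_contraction:
  assumes I: "finite I" and u: "integrable (leb I) u"
  shows "(\<integral>\<^sup>+d. ennreal ((cmod (coord_fourier I u d))\<^sup>2) \<partial>leb I) \<le> (\<integral>\<^sup>+c. ennreal ((cmod (u c))\<^sup>2) \<partial>leb I)"
proof -
  note [measurable] = borel_measurable_integrable[OF u]
  define \<epsilon> where "\<epsilon> k = 1 / real (Suc k)" for k
  define G where "G k d = (\<Prod>i\<in>I. exp (- ((\<epsilon> k * d i)\<^sup>2) / 2))" for k and d :: "nat \<Rightarrow> real"
  have Gm [measurable]: "G k \<in> borel_measurable (leb I)" for k unfolding G_def[abs_def] by measurable
  have Um [measurable]: "coord_fourier I u \<in> borel_measurable (leb I)" by (rule coord_fourier_measurable[OF I]) measurable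
  have lim: "(\<lambda>k. G k d) \<longlonglongrightarrow> 1" for d
  proof -
    have "\<epsilon> \<longlonglongrightarrow> 0" unfolding \<epsilon>_def[abs_def] by (rule LIMSEQ_Suc[OF lim_1_over_n])
    then have "(\<lambda>k. G k d) \<longlonglongrightarrow> (\<Prod>i\<in>I. exp (- ((0 * d i)\<^sup>2) / 2))"
      unfolding G_def by (intro tendsto_intros) auto
    then show ?thesis by simp
  qed
  show ?thesis
  proof (rule nn_integral_limit_le)
    show "AE d in leb I. (\<lambda>k. (cmod (coord_fourier I u d))\<^sup>2 * G k d) \<longlonglongrightarrow> (cmod (coord_fourier I u d))\<^sup>2"
      using tendsto_mult[OF tendsto_const lim] by (intro AE_I2) simp
    show "\<forall>\<^sub>F k in sequentially. (\<integral>\<^sup>+d. ennreal ((cmod (coord_fourier I u d))\<^sup>2 * G k d) \<partial>leb I)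
        \<le> (\<integral>\<^sup>+c. ennreal ((cmod (u c))\<^sup>2) \<partial>leb I)"
      by (intro always_eventually allI)
         (unfold G_def, rule coord_fourier_gaussian_bound[OF I u], simp add: \<epsilon>_def)
  qed measurable
qed

lemma blinfun_eval_measurable: "(\<lambda>Y::'a::real_normed_vector \<Rightarrow>\<^sub>L 'b::real_normed_vector. blinfun_apply Y x) \<in> borel_measurable borel"
  by (intro borel_measurable_continuous_onI linear_continuous_on blinfun.bounded_linear_left)

text \<open>It is the small values of h that may spoil integrability. Where |h| is at least 1 / (k +
  1), it is bounded by (k + 1) |h|^2, so keeping h only there gives integrable functions, and
  dominated convergence gives the limit.\<close>

lemma L2_truncation:
  assumes h: "h \<in> L2 M"
  obtains hs where "\<And>k::nat. integrable M (hs k)" "L2_tendsto M hs h"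
proof -
  note [measurable] = L2_measurable[OF h]
  define S where "S k = {x \<in> space M. 1 / real (Suc k) \<le> cmod (h x)}" for k
  have [measurable]: "S k \<in> sets M" for k unfolding S_def by measurable
  define hs where "hs k x = (if x \<in> S k then h x else 0)" for k x
  have [measurable]: "hs k \<in> borel_measurable M" for k unfolding hs_def[abs_def] by measurable
  have le: "cmod (hs k x) \<le> cmod (h x)" for k x by (simp add: hs_def)
  have int: "integrable M (hs k)" for k
  proof (rule Bochner_Integration.integrable_bound)
    show "integrable M (\<lambda>x. real (Suc k) * (cmod (h x))\<^sup>2)" using h by (simp add: L2_def)
    have "cmod (h x) \<le> real (Suc k) * (cmod (h x))\<^sup>2" if "1 / real (Suc k) \<le> cmod (h x)" for x
    proof -
      have "1 \<le> real (Suc k) * cmod (h x)" using that by (simp add: field_simps)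
      then show ?thesis using mult_right_mono[of 1 "real (Suc k) * cmod (h x)" "cmod (h x)"]
        by (simp add: power2_eq_square mult.assoc)
    qed
    then show "AE x in M. norm (hs k x) \<le> norm (real (Suc k) * (cmod (h x))\<^sup>2)"
      by (intro AE_I2) (auto simp: hs_def S_def)
  qed measurable
  have L2: "hs k \<in> L2 M" for k
  proof -
    have "integrable M (\<lambda>x. (cmod (hs k x))\<^sup>2)"
      by (rule Bochner_Integration.integrable_bound[OF L2_integrable[OF h]]) (use le in \<open>auto intro!: power_mono\<close>)
    then show ?thesis by (simp add: L2_def)
  qed
  have "(\<lambda>k. \<integral>x. (cmod (hs k x - h x))\<^sup>2 \<partial>M) \<longlonglongrightarrow> (\<integral>x. 0 \<partial>M)"
  proof (rule integral_dominated_convergence[where w = "\<lambda>x. (cmod (h x))\<^sup>2"])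
    show "integrable M (\<lambda>x. (cmod (h x))\<^sup>2)" by (rule L2_integrable[OF h])
    show "AE x in M. norm ((cmod (hs k x - h x))\<^sup>2) \<le> (cmod (h x))\<^sup>2" for k by (intro AE_I2) (simp add: hs_def)
    have "(\<lambda>k. (cmod (hs k x - h x))\<^sup>2) \<longlonglongrightarrow> 0" if x: "x \<in> space M" for x
    proof (cases "h x = 0")
      case True
      then have "hs k x = 0" for k by (simp add: hs_def)
      then show ?thesis using True by simp
    next
      case False
      then obtain N where N: "1 / real (Suc N) < cmod (h x)" using nat_approx_posE[of "cmod (h x)"] by auto
      have "hs k x = h x" if "k \<ge> N" for k
      proof -
        have "1 / real (Suc k) \<le> 1 / real (Suc N)" using that by (intro divide_left_mono) auto
        then show ?thesis using N x by (simp add: hs_def S_def)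
      qed
      then have "eventually (\<lambda>k. (cmod (hs k x - h x))\<^sup>2 = 0) sequentially"
        by (intro eventually_sequentiallyI[of N]) simp
      then show ?thesis by (rule tendsto_eventually)
    qed
    then show "AE x in M. (\<lambda>k. (cmod (hs k x - h x))\<^sup>2) \<longlonglongrightarrow> 0" by (intro AE_I2)
  qed measurable
  then have "L2_tendsto M hs h" using L2 h by (simp add: L2_tendsto_def)
  then show ?thesis using that int by blast
qed

section \<open>The Fourier-Plancherel transform on the Lie algebra\<close>

context based_exponential_lie_group
begin

definition idx :: "nat set" where "idx = {1..2*n}"

lemma finite_idx [simp]: "finite idx"
  by (simp add: idx_def)

lemmas X_basis = X_inj[folded idx_def] X_independent[folded idx_def] X_span[folded idx_def]

definition lincomb :: "(nat \<Rightarrow> real) \<Rightarrow> real ^ 'm" where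
  "lincomb c = (\<Sum>i\<in>idx. c i *\<^sub>R X i)"

lemma lincomb_measurable [measurable]: "lincomb \<in> borel_measurable (leb idx)"
proof -
  show ?thesis unfolding lincomb_def[abs_def] by (intro borel_measurable_sum borel_measurable_scaleR) auto
qed

lemma dX_eq: "dX = distr (leb idx) borel lincomb"
  unfolding dX_def lincomb_def[abs_def] idx_def ..

lemma sets_dX [simp, measurable_cong]: "sets dX = sets borel"
  by (simp add: dX_eq)

lemma sets_dY [simp, measurable_cong]: "sets dY = sets borel"
  by (simp add: dY_def)

lemma linear_eq_on_basis:
  fixes f g :: "real ^ 'm \<Rightarrow> real"
  assumes "linear f" "linear g" "\<And>i. i \<in> idx \<Longrightarrow> f (X i) = g (X i)"
  shows "f = g"
proof
  fix x show "f x = g x"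
    by (rule linear_eq_on[OF assms(1,2), of x "X ` idx"]) (use X_basis(3) assms(3) in auto)
qed

lemma dual_vectors_exist: "\<exists>w. \<forall>j\<in>idx. \<forall>i\<in>idx. X i \<bullet> w j = (if i = j then 1 else (0::real))"
proof -
  have "\<exists>v. \<forall>i\<in>idx. X i \<bullet> v = (if i = j then 1 else (0::real))" if j: "j \<in> idx" for j
  proof -
    obtain g :: "real ^ 'm \<Rightarrow> real" where g: "linear g" "\<forall>x\<in>X ` idx. g x = (if x = X j then 1 else 0)"
      using linear_independent_extend[OF X_basis(2), of "\<lambda>x. if x = X j then 1 else 0"] by (elim exE conjE)
    have "X i \<bullet> adjoint g 1 = (if i = j then 1 else 0)" if i: "i \<in> idx" for i
      using adjoint_works[OF g(1), of "X i" 1] g(2) i j inj_on_eq_iff[OF X_basis(1)] by auto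
    then show ?thesis by blast
  qed
  then show ?thesis by (intro bchoice) simp
qed

definition dual_vector :: "nat \<Rightarrow> real ^ 'm" where
  "dual_vector = (SOME w. \<forall>j\<in>idx. \<forall>i\<in>idx. X i \<bullet> w j = (if i = j then 1 else (0::real)))"

lemma inner_dual_vector: "i \<in> idx \<Longrightarrow> j \<in> idx \<Longrightarrow> X i \<bullet> dual_vector j = (if i = j then 1 else 0)"
  using someI_ex[OF dual_vectors_exist] unfolding dual_vector_def by blast

text \<open>An explicit formula, continuous in the coordinates, for the functional that
  \<open>dY\<close> selects by a definite description.\<close>

definition functional :: "(nat \<Rightarrow> real) \<Rightarrow> (real ^ 'm) \<Rightarrow>\<^sub>L real" where
  "functional d = blinfun_inner_right (\<Sum>j\<in>idx. d j *\<^sub>R dual_vector j)"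

lemma functional_basis: "i \<in> idx \<Longrightarrow> functional d (X i) = d i"
  by (simp add: functional_def inner_sum_left inner_commute[of _ "X i"] inner_sum_right inner_dual_vector mult_delta_right)

text \<open>Dual bases turn the pairing into the Euclidean dot product, so that
  \<open>fourier\<close>, read in the coordinates of \<open>dX\<close> and \<open>dY\<close>,
  becomes \<open>coord_fourier\<close>.\<close>

lemma functional_lincomb: "functional d (lincomb c) = dotp idx c d"
  using functional_basis[of _ d] by (simp add: lincomb_def dotp_def blinfun.sum_right blinfun.scaleR_right)

lemma the_functional: "(THE Y. \<forall>i\<in>idx. blinfun_apply Y (X i) = d i) = functional d"
proof (rule the_equality)
  show "\<forall>i\<in>idx. blinfun_apply (functional d) (X i) = d i" by (simp add: functional_basis)
  fix Y :: "(real ^ 'm) \<Rightarrow>\<^sub>L real" assume "\<forall>i\<in>idx. blinfun_apply Y (X i) = d i"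
  then have "blinfun_apply Y = blinfun_apply (functional d)"
    by (intro linear_eq_on_basis) (auto simp: functional_basis intro: bounded_linear.linear blinfun.bounded_linear_right)
  then show "Y = functional d" by (simp add: blinfun_apply_inject)
qed

lemma functional_measurable [measurable]: "functional \<in> borel_measurable (leb idx)"
proof -
  have "(\<lambda>d. \<Sum>j\<in>idx. d j *\<^sub>R dual_vector j) \<in> borel_measurable (leb idx)"
    by (intro borel_measurable_sum borel_measurable_scaleR) auto
  then show ?thesis unfolding functional_def[abs_def]
    by (rule measurable_compose[OF _ borel_measurable_continuous_onI])
       (intro linear_continuous_on bounded_linear_blinfun_inner_right bounded_linear_ident)
qed

lemma dY_eq: "dY = distr (leb idx) borel functional"
  unfolding dY_def idx_def[symmetric] the_functional ..

lemma fourier_eq: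
  assumes [measurable]: "h \<in> borel_measurable borel"
  shows "fourier h Y = (\<integral>c. h (lincomb c) * cis (2 * pi * Y (lincomb c)) \<partial>leb idx)"
proof -
  have [measurable]: "blinfun_apply Y \<in> borel_measurable borel"
    by (intro borel_measurable_continuous_onI linear_continuous_on blinfun.bounded_linear_right)
  show ?thesis unfolding fourier_def dX_eq by (rule integral_distr) measurable
qed

lemma fourier_measurable:
  assumes [measurable]: "h \<in> borel_measurable borel"
  shows "fourier h \<in> borel_measurable borel"
proof -
  interpret sigma_finite_measure "leb idx" by (rule leb.sigma_finite) simp
  note [measurable] = blinfun_eval_measurable
  \<comment> \<open>Written as a finite sum of products of coordinates, the pairing is jointly
    measurable for the product sigma-algebra.\<close>
  have eq: "blinfun_apply Y (lincomb c) = (\<Sum>i\<in>idx. c i * blinfun_apply Y (X i))" for Y :: "(real ^ 'm) \<Rightarrow>\<^sub>L real" and c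
    by (simp add: lincomb_def blinfun.sum_right blinfun.scaleR_right)
  have "(\<lambda>p. h (lincomb (snd p)) * cis (2 * pi * (\<Sum>i\<in>idx. snd p i * blinfun_apply (fst p) (X i))))
      \<in> borel_measurable (borel \<Otimes>\<^sub>M leb idx)"
    by measurable
  then have "(\<lambda>Y. \<integral>c. h (lincomb c) * cis (2 * pi * (\<Sum>i\<in>idx. c i * blinfun_apply Y (X i))) \<partial>leb idx) \<in> borel_measurable borel"
    by (intro borel_measurable_lebesgue_integral) (simp add: case_prod_unfold)
  then show ?thesis using fourier_eq[OF assms] by (simp add: eq fun_eq_iff cong: measurable_cong)
qed

lemma fourier_L2:
  assumes h: "integrable dX h" "h \<in> L2 dX"
  shows "fourier h \<in> L2 dY" "L2sq dY (fourier h) \<le> L2sq dX h"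
proof -
  have hm [measurable]: "h \<in> borel_measurable borel" using L2_measurable[OF h(2)] by simp
  have fm [measurable]: "fourier h \<in> borel_measurable borel" by (rule fourier_measurable[OF hm])
  have int: "integrable (leb idx) (\<lambda>c. h (lincomb c))"
    using h(1) unfolding dX_eq by (subst (asm) integrable_distr_eq) auto
  have fc: "fourier h (functional d) = coord_fourier idx (\<lambda>c. h (lincomb c)) d" for d
    by (simp add: fourier_eq coord_fourier_def functional_lincomb)
  have "(\<integral>\<^sup>+Y. ennreal ((cmod (fourier h Y))\<^sup>2) \<partial>dY) = (\<integral>\<^sup>+d. ennreal ((cmod (fourier h (functional d)))\<^sup>2) \<partial>leb idx)"
    unfolding dY_eq by (rule nn_integral_distr) measurable
  also have "\<dots> \<le> (\<integral>\<^sup>+c. ennreal ((cmod (h (lincomb c)))\<^sup>2) \<partial>leb idx)"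
    unfolding fc by (rule coord_fourier_L2_contraction[OF _ int]) simp
  also have "\<dots> = (\<integral>\<^sup>+Z. ennreal ((cmod (h Z))\<^sup>2) \<partial>dX)"
    unfolding dX_eq by (rule nn_integral_distr[symmetric]) measurable
  also have "\<dots> = ennreal (L2sq dX h)" by (rule nn_integral_L2sq[OF h(2)])
  finally have le: "(\<integral>\<^sup>+Y. ennreal ((cmod (fourier h Y))\<^sup>2) \<partial>dY) \<le> ennreal (L2sq dX h)" .
  have "fourier h \<in> borel_measurable dY" using fm by simp
  from L2sq_leI[OF this le] show "fourier h \<in> L2 dY" "L2sq dY (fourier h) \<le> L2sq dX h" by simp_all
qed

lemma integrable_fourier_integrand:
  assumes "integrable dX h" shows "integrable dX (\<lambda>Z. h Z * cis (2 * pi * blinfun_apply Y Z))"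
proof (rule Bochner_Integration.integrable_bound[OF assms])
  have [measurable]: "blinfun_apply Y \<in> borel_measurable borel"
    by (intro borel_measurable_continuous_onI linear_continuous_on blinfun.bounded_linear_right)
  show "(\<lambda>Z. h Z * cis (2 * pi * blinfun_apply Y Z)) \<in> borel_measurable dX"
    using borel_measurable_integrable[OF assms] by simp
qed (simp add: norm_mult)

lemma fourier_lincomb:
  assumes "integrable dX h" "integrable dX h'"
  shows "fourier (\<lambda>Z. a * h Z + b * h' Z) Y = a * fourier h Y + b * fourier h' Y"
proof -
  have "fourier (\<lambda>Z. a * h Z + b * h' Z) Y
      = (\<integral>Z. a * (h Z * cis (2 * pi * Y Z)) + b * (h' Z * cis (2 * pi * Y Z)) \<partial>dX)"
    unfolding fourier_def by (simp add: algebra_simps)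
  also have "\<dots> = a * fourier h Y + b * fourier h' Y"
    unfolding fourier_def by (simp add: integrable_fourier_integrand assms)
  finally show ?thesis .
qed

text \<open>The contraction, applied to differences of truncations, makes their Fourier integrals
  Cauchy. This is what entitles \<open>fourier_kirillov\<close> to choose a version.\<close>

lemma is_fourier_L2_exists:
  assumes "h \<in> L2 dX" shows "\<exists>H. is_fourier_L2 h H"
proof -
  obtain hs where hs: "\<And>k::nat. integrable dX (hs k)" "L2_tendsto dX hs h" using L2_truncation[OF assms] by blast
  have L2: "hs k \<in> L2 dX" for k using hs(2) by (simp add: L2_tendsto_iff)
  have le: "L2sq dY (\<lambda>Y. fourier (hs j) Y - fourier (hs k) Y) \<le> L2sq dX (\<lambda>Z. hs j Z - hs k Z)" for j k
  proof -
    have "fourier (\<lambda>Z. hs j Z - hs k Z) = (\<lambda>Y. fourier (hs j) Y - fourier (hs k) Y)"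
      using fourier_lincomb[OF hs(1) hs(1), of 1 j "-1" k] by auto
    then show ?thesis
      using fourier_L2(2)[of "\<lambda>Z. hs j Z - hs k Z"] L2_diff[OF L2 L2, of j k] hs(1) by simp
  qed
  obtain H where "L2_tendsto dY (\<lambda>k. fourier (hs k)) H"
  proof (rule L2_complete)
    show "fourier (hs k) \<in> L2 dY" for k by (rule fourier_L2(1)[OF hs(1) L2])
    show "\<exists>N. \<forall>j\<ge>N. \<forall>k\<ge>N. L2sq dY (\<lambda>x. fourier (hs j) x - fourier (hs k) x) < \<epsilon>" if "\<epsilon> > 0" for \<epsilon>
      using L2_tendsto_Cauchy[OF hs(2) that] le by (meson order.strict_trans1)
  qed
  then show ?thesis using hs by (auto simp: is_fourier_L2_def)
qed

lemma is_fourier_L2_lincomb: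
  assumes "is_fourier_L2 h H" "is_fourier_L2 h' H'"
  shows "is_fourier_L2 (\<lambda>Z. a * h Z + b * h' Z) (\<lambda>Y. a * H Y + b * H' Y)"
proof -
  obtain hs where hs: "\<And>k. integrable dX (hs k)" "L2_tendsto dX hs h" "L2_tendsto dY (\<lambda>k. fourier (hs k)) H"
    using assms(1) by (auto simp: is_fourier_L2_def)
  obtain hs' where hs': "\<And>k. integrable dX (hs' k)" "L2_tendsto dX hs' h'" "L2_tendsto dY (\<lambda>k. fourier (hs' k)) H'"
    using assms(2) by (auto simp: is_fourier_L2_def)
  have "fourier (\<lambda>Z. a * hs k Z + b * hs' k Z) = (\<lambda>Y. a * fourier (hs k) Y + b * fourier (hs' k) Y)" for k
    using fourier_lincomb[OF hs(1) hs'(1)] by auto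
  then show ?thesis unfolding is_fourier_L2_def
    using L2_tendsto_lincomb[OF hs(2) hs'(2), of a b] L2_tendsto_lincomb[OF hs(3) hs'(3), of a b] hs(1) hs'(1)
    by (intro exI[of _ "\<lambda>k Z. a * hs k Z + b * hs' k Z"]) simp
qed

text \<open>Two versions may come from different sequences and different representatives; the
  contraction, applied to the difference of the sequences, forces their transforms together.\<close>

lemma is_fourier_L2_unique:
  assumes "is_fourier_L2 h H" "is_fourier_L2 h' H'" "AE Z in dX. h Z = h' Z"
  shows "AE Y in dY. H Y = H' Y"
proof -
  obtain hs where hs: "\<And>k. integrable dX (hs k)" "L2_tendsto dX hs h" "L2_tendsto dY (\<lambda>k. fourier (hs k)) H"
    using assms(1) by (auto simp: is_fourier_L2_def)
  obtain hs' where hs': "\<And>k. integrable dX (hs' k)" "L2_tendsto dX hs' h'" "L2_tendsto dY (\<lambda>k. fourier (hs' k)) H'"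
    using assms(2) by (auto simp: is_fourier_L2_def)
  have L2: "hs k \<in> L2 dX" "hs' k \<in> L2 dX" "h \<in> L2 dX" "h' \<in> L2 dX" for k
    using hs hs' by (auto simp: L2_tendsto_iff)
  have dz: "L2sq dX (\<lambda>Z. h Z - h' Z) = 0"
    using assms(3) L2sq_eq_0_iff[OF L2_diff[OF L2(3,4)]] by simp
  have le: "L2sq dY (\<lambda>Y. fourier (hs k) Y - fourier (hs' k) Y) \<le> L2sq dX (\<lambda>Z. hs k Z - hs' k Z)" for k
  proof -
    have "fourier (\<lambda>Z. hs k Z - hs' k Z) = (\<lambda>Y. fourier (hs k) Y - fourier (hs' k) Y)"
      using fourier_lincomb[OF hs(1) hs'(1), of 1 k "-1" k] by auto
    then show ?thesis
      using fourier_L2(2)[of "\<lambda>Z. hs k Z - hs' k Z"] L2_diff[OF L2(1,2), of k k] hs(1) hs'(1) by simp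
  qed
  have le2: "L2sq dX (\<lambda>Z. hs k Z - hs' k Z) \<le> 2 * L2sq dX (\<lambda>Z. hs k Z - h Z) + 4 * L2sq dX (\<lambda>Z. hs' k Z - h' Z)" for k
  proof -
    have "L2sq dX (\<lambda>Z. hs k Z - hs' k Z) \<le> 2 * L2sq dX (\<lambda>Z. hs k Z - h Z) + 2 * L2sq dX (\<lambda>Z. h Z - hs' k Z)"
      by (rule L2sq_diff_triangle) (use L2 in auto)
    moreover have "L2sq dX (\<lambda>Z. h Z - hs' k Z) \<le> 2 * L2sq dX (\<lambda>Z. h Z - h' Z) + 2 * L2sq dX (\<lambda>Z. h' Z - hs' k Z)"
      by (rule L2sq_diff_triangle) (use L2 in auto)
    ultimately show ?thesis using dz L2sq_minus_commute[of dX h' "hs' k"] by linarith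
  qed
  have "(\<lambda>k. L2sq dY (\<lambda>Y. fourier (hs k) Y - fourier (hs' k) Y)) \<longlonglongrightarrow> 0"
  proof (rule tendsto_sandwich[OF _ _ tendsto_const])
    show "(\<lambda>k. 2 * L2sq dX (\<lambda>Z. hs k Z - h Z) + 4 * L2sq dX (\<lambda>Z. hs' k Z - h' Z)) \<longlonglongrightarrow> 0"
      using hs(2) hs'(2) by (auto simp: L2_tendsto_iff intro!: tendsto_eq_intros)
  qed (use order_trans[OF le le2] in auto)
  then show ?thesis by (rule L2_tendsto_unique[OF hs(3) hs'(3)])
qed

end

section \<open>The chart of an exponential Lie group\<close>

text \<open>\<open>C_k\<close> yields differentiability of a derivative D p b in p only for a fixed
  vector b. Expanding the moving vector in a basis reduces the general case to products.\<close>

lemma differentiable_bilinear_sum: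
  fixes D :: "'a::euclidean_space \<Rightarrow> 'b::euclidean_space \<Rightarrow> 'c::euclidean_space"
  assumes lin: "\<And>p. linear (D p)" and D: "\<And>b p. (\<lambda>p. D p b) differentiable (at p)"
    and g: "g differentiable (at x)" and w: "w differentiable (at (x::'d::euclidean_space))"
  shows "(\<lambda>x. D (g x) (w x)) differentiable (at x)"
proof -
  have eq: "D p v = (\<Sum>b\<in>Basis. (v \<bullet> b) *\<^sub>R D p b)" for p v
    by (subst euclidean_representation[of v, symmetric])
       (simp add: linear_sum[OF lin] linear_scale[OF lin] del: euclidean_representation)
  have "(\<lambda>x. D (g x) b) differentiable (at x)" for b
    using differentiable_chain_at[OF g D[of b "g x"]] by (simp add: o_def)
  moreover have "(\<lambda>x. w x \<bullet> b) differentiable (at x)" for b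
    using differentiable_chain_at[OF w bounded_linear_imp_differentiable[OF bounded_linear_inner_left[of b]]]
    by (simp add: o_def)
  ultimately show ?thesis unfolding eq[of _ "w _"]
    by (intro differentiable_sum) auto
qed

context exponential_lie_group
begin

lemma Exp_in_carrier [simp]: "Exp Z \<in> carrier G"
  using Exp_bij by (auto simp: bij_betw_def)

lemma Log_Exp [simp]: "Log (Exp Z) = Z"
  using Exp_bij unfolding Log_def bij_betw_def by (simp add: inv_into_f_f)

lemma Exp_Log [simp]: "x \<in> carrier G \<Longrightarrow> Exp (Log x) = x"
  using Exp_bij unfolding Log_def bij_betw_def by (simp add: f_inv_into_f)

lemma Exp_0 [simp]: "Exp 0 = \<one>"
proof -
  have "Exp 0 = Exp 0 \<otimes> Exp 0" using Exp_add[of 0 0 0] by simp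
  then show ?thesis using r_cancel_one'[of "Exp 0" "Exp 0"] by simp
qed

lemma inv_Exp [simp]: "inv (Exp Z) = Exp (- Z)"
  using Exp_add[of "-1" 1 Z] by (intro inv_equality) auto

definition lmult :: "real ^ 'm \<Rightarrow> real ^ 'm \<Rightarrow> real ^ 'm" where
  "lmult Y Z = Log (Exp Y \<otimes> Exp Z)"

lemma Exp_lmult: "Exp (lmult Y Z) = Exp Y \<otimes> Exp Z"
  by (simp add: lmult_def)

lemma lmult_0 [simp]: "lmult Y 0 = Y" "lmult 0 Y = Y"
  by (simp_all add: lmult_def)

lemma lmult_minus [simp]: "lmult Y (- Y) = 0" "lmult (- Y) Y = 0"
  using r_inv[of "Exp Y"] l_inv[of "Exp Y"] Log_Exp[of 0] by (simp_all add: lmult_def)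

lemma lmult_assoc: "lmult (lmult W Y) Z = lmult W (lmult Y Z)"
  by (simp add: lmult_def m_assoc)

lemma minus_lmult: "- lmult Y Z = lmult (- Z) (- Y)"
proof -
  have "inv (Exp Y \<otimes> Exp Z) = Exp (- Z) \<otimes> Exp (- Y)" by (simp add: inv_mult_group)
  then have "Exp (- lmult Y Z) = Exp (lmult (- Z) (- Y))"
    by (simp add: Exp_lmult flip: inv_Exp)
  then show ?thesis by (metis Log_Exp)
qed

definition dmult :: "(real ^ 'm) \<times> (real ^ 'm) \<Rightarrow> (real ^ 'm) \<times> (real ^ 'm) \<Rightarrow> real ^ 'm" where
  "dmult p = frechet_derivative (\<lambda>(Y, Z). lmult Y Z) (at p)"

lemma lmult_C_k: "C_k k (\<lambda>(Y, Z). lmult Y Z)"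
  using mult_smooth[of k] by (simp add: lmult_def Log_def)

lemma lmult_has_derivative: "((\<lambda>(Y, Z). lmult Y Z) has_derivative dmult p) (at p)"
proof -
  have "(\<lambda>(Y, Z). lmult Y Z) differentiable (at p)" using lmult_C_k[of "Suc 0"] by (simp del: split_paired_All)
  then show ?thesis unfolding dmult_def by (simp add: frechet_derivative_works)
qed

lemma linear_dmult: "linear (dmult p)"
  using has_derivative_linear[OF lmult_has_derivative] .

lemma dmult_differentiable: "(\<lambda>p. dmult p v) differentiable (at p)"
  using lmult_C_k[of "Suc (Suc 0)"] unfolding dmult_def by (simp del: split_paired_All)

lemma lmult_continuous: "continuous_on UNIV (\<lambda>p. lmult (fst p) (snd p))"
  using lmult_C_k[of 0] by (simp add: case_prod_unfold)

lemma lmult_continuous' [continuous_intros]: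
  assumes "continuous_on S f" "continuous_on S g"
  shows "continuous_on S (\<lambda>x. lmult (f x) (g x))"
  using continuous_on_compose2[OF lmult_continuous continuous_on_Pair[OF assms]] by simp

section \<open>The adjoint action and the bracket in the chart\<close>

definition conjugation :: "real ^ 'm \<Rightarrow> real ^ 'm \<Rightarrow> real ^ 'm" where
  "conjugation Y Z = lmult (lmult Y Z) (- Y)"

text \<open>The derivative of \<open>conjugation Y\<close> at 0 in the form produced by the chain
  rule, from which differentiability in \<open>Y\<close> can be read off.\<close>

definition AD :: "real ^ 'm \<Rightarrow> real ^ 'm \<Rightarrow> real ^ 'm" where
  "AD Y v = dmult (Y, - Y) (dmult (Y, 0) (0, v), 0)"

lemma conjugation_has_derivative: "(conjugation Y has_derivative AD Y) (at 0)"
proof -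
  have "((\<lambda>Z. (Y, Z)) has_derivative (\<lambda>v. (0, v))) (at 0)" by (auto intro!: derivative_eq_intros)
  from has_derivative_compose[OF this lmult_has_derivative]
  have 1: "(lmult Y has_derivative (\<lambda>v. dmult (Y, 0) (0, v))) (at 0)" by simp
  then have "((\<lambda>Z. (lmult Y Z, - Y)) has_derivative (\<lambda>v. (dmult (Y, 0) (0, v), 0))) (at 0)"
    by (auto intro!: derivative_eq_intros)
  from has_derivative_compose[OF this lmult_has_derivative]
  show ?thesis by (simp add: conjugation_def[abs_def] AD_def[abs_def])
qed

lemma linear_AD: "linear (AD Y)"
  by (rule has_derivative_linear[OF conjugation_has_derivative])

lemma bounded_linear_AD: "bounded_linear (AD Y)"
  by (rule has_derivative_bounded_linear[OF conjugation_has_derivative])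

lemma Ad_Exp: "Ad (Exp Y) Z = AD Y Z"
proof -
  have "((\<lambda>t. t *\<^sub>R Z) has_derivative (\<lambda>t. t *\<^sub>R Z)) (at 0)" by (auto intro!: derivative_eq_intros)
  from has_derivative_compose[OF this, of "conjugation Y" "AD Y"] conjugation_has_derivative[of Y]
  have "((\<lambda>t. conjugation Y (t *\<^sub>R Z)) has_derivative (\<lambda>t. AD Y (t *\<^sub>R Z))) (at 0)" by simp
  then have "((\<lambda>t. conjugation Y (t *\<^sub>R Z)) has_vector_derivative AD Y Z) (at 0)"
    by (simp add: has_vector_derivative_def linear_scale[OF linear_AD])
  then have "vector_derivative (\<lambda>t. conjugation Y (t *\<^sub>R Z)) (at 0) = AD Y Z" by (rule vector_derivative_at)
  then show ?thesis by (simp add: Ad_def conjugation_def lmult_def)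
qed

lemma AD_differentiable: "(\<lambda>Y. AD Y v) differentiable (at Y)"
proof -
  have p: "(\<lambda>Y. (Y, 0)) differentiable (at Y)" "(\<lambda>Y. (Y, - Y)) differentiable (at Y)" for Y :: "real ^ 'm"
    by (auto intro!: bounded_linear_imp_differentiable bounded_linear_Pair bounded_linear_ident
        bounded_linear_zero bounded_linear_minus)
  have 1: "(\<lambda>Y. dmult (Y, 0) (0, v)) differentiable (at Y)"
    using differentiable_chain_at[OF p(1) dmult_differentiable[of "(0, v)"]] by (simp add: o_def)
  then have "(\<lambda>Y. (dmult (Y, 0) (0, v), 0::real ^ 'm)) differentiable (at Y)"
    unfolding differentiable_def using has_derivative_Pair[OF _ has_derivative_const] by blast
  then show ?thesis unfolding AD_def
    by (rule differentiable_bilinear_sum[OF linear_dmult dmult_differentiable p(2)])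
qed

lemma AD_continuous: "continuous_on UNIV (\<lambda>Y. AD Y v)"
  using AD_differentiable by (intro differentiable_imp_continuous_on) (simp add: differentiable_on_def)

lemma conjugation_0 [simp]: "conjugation Y 0 = 0"
  by (simp add: conjugation_def)

lemma conjugation_lmult: "conjugation (lmult Y Z) W = conjugation Y (conjugation Z W)"
  by (simp add: conjugation_def minus_lmult lmult_assoc)

lemma AD_lmult: "AD (lmult Y Z) v = AD Y (AD Z v)"
proof -
  have "(conjugation Y has_derivative AD Y) (at (conjugation Z 0))" by (simp add: conjugation_has_derivative)
  from has_derivative_compose[OF conjugation_has_derivative this]
  have "(conjugation (lmult Y Z) has_derivative (\<lambda>v. AD Y (AD Z v))) (at 0)"
    by (simp add: conjugation_lmult[abs_def])
  from has_derivative_unique[OF this conjugation_has_derivative] show ?thesis by metis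
qed

lemma AD_0: "AD 0 v = v"
proof -
  have "conjugation 0 = id" by (simp add: conjugation_def fun_eq_iff)
  then have "(conjugation 0 has_derivative id) (at 0)" by (simp add: has_derivative_id)
  from has_derivative_unique[OF this conjugation_has_derivative] show ?thesis by (metis id_apply)
qed

text \<open>\<open>bracket\<close> is defined by derivatives along lines. Since Y -> AD Y Z is
  differentiable, these assemble into a full derivative, which makes the bracket linear and
  continuous in its first argument.\<close>

lemma bracket_has_derivative: "((\<lambda>Y. AD Y Z) has_derivative (\<lambda>Y. bracket Y Z)) (at 0)"
proof -
  obtain D where D: "((\<lambda>Y. AD Y Z) has_derivative D) (at 0)"
    using AD_differentiable[of Z 0] by (auto simp: differentiable_def)
  have "bracket Y Z = D Y" for Y
  proof -
    have "((\<lambda>t. t *\<^sub>R Y) has_derivative (\<lambda>t. t *\<^sub>R Y)) (at 0)" by (auto intro!: derivative_eq_intros)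
    from has_derivative_compose[OF this, of "\<lambda>Y. AD Y Z" D] D
    have "((\<lambda>t. AD (t *\<^sub>R Y) Z) has_derivative (\<lambda>t. D (t *\<^sub>R Y))) (at 0)" by simp
    then have "((\<lambda>t. AD (t *\<^sub>R Y) Z) has_vector_derivative D Y) (at 0)"
      by (simp add: has_vector_derivative_def linear_scale[OF has_derivative_linear[OF D]])
    then show ?thesis unfolding bracket_def Ad_Exp by (rule vector_derivative_at)
  qed
  then show ?thesis using D by presburger
qed

lemma bracket_linear_right: "linear (bracket Y)"
proof (rule linearI)
  note d = bracket_has_derivative
  show "bracket Y (Z + Z') = bracket Y Z + bracket Y Z'" for Z Z'
  proof -
    have "((\<lambda>Y. AD Y (Z + Z')) has_derivative (\<lambda>Y. bracket Y Z + bracket Y Z')) (at 0)"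
      using has_derivative_add[OF d d] by (simp add: linear_add[OF linear_AD])
    from has_derivative_unique[OF this d] show ?thesis by metis
  qed
  show "bracket Y (c *\<^sub>R Z) = c *\<^sub>R bracket Y Z" for c Z
  proof -
    have "((\<lambda>Y. AD Y (c *\<^sub>R Z)) has_derivative (\<lambda>Y. c *\<^sub>R bracket Y Z)) (at 0)"
      using has_derivative_scaleR_right[OF d] by (simp add: linear_scale[OF linear_AD])
    from has_derivative_unique[OF this d] show ?thesis by metis
  qed
qed

lemma bracket_power_continuous: "continuous_on UNIV (\<lambda>Z. (bracket Z ^^ k) V)"
proof (induction k)
  case (Suc k)
  have eq: "bracket Z W = (\<Sum>b\<in>Basis. (W \<bullet> b) *\<^sub>R bracket Z b)" for Z W
    by (subst euclidean_representation[of W, symmetric])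
       (simp add: linear_sum[OF bracket_linear_right] linear_scale[OF bracket_linear_right] del: euclidean_representation)
  have "continuous_on UNIV (\<lambda>Z. bracket Z b)" for b
    by (intro linear_continuous_on has_derivative_bounded_linear[OF bracket_has_derivative])
  then have "continuous_on UNIV (\<lambda>Z. \<Sum>b\<in>Basis. ((bracket Z ^^ k) V \<bullet> b) *\<^sub>R bracket Z b)"
    by (intro continuous_intros Suc)
  then show ?case by (simp add: eq[symmetric])
qed simp

lemma \<Theta>_measurable [measurable]: "\<Theta> \<in> borel_measurable borel"
proof -
  have e: "(\<lambda>Z. (\<Sum>k. (1 / fact (Suc k)) *\<^sub>R (bracket Z ^^ k) V)) \<in> borel_measurable borel" for V
    by (intro borel_measurable_suminf borel_measurable_scaleR borel_measurable_const
        borel_measurable_continuous_onI bracket_power_continuous)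
  have c: "(\<lambda>v::real ^ 'm. v $ i) \<in> borel_measurable borel" for i
    by (intro borel_measurable_continuous_onI continuous_intros)
  have [measurable]: "(\<lambda>Z. (\<Sum>k. (1 / fact (Suc k)) *\<^sub>R (bracket Z ^^ k) V) $ i) \<in> borel_measurable borel" for V i
    by (rule measurable_compose[OF e c])
  show ?thesis unfolding \<Theta>_def[abs_def] det_def matrix_def by (simp only: vec_lambda_beta) measurable
qed

lemma \<Theta>_nonneg: "0 \<le> \<Theta> Z"
  by (simp add: \<Theta>_def)

section \<open>Borel structure of the group and of the orbit\<close>

lemma space_borel_G [simp]: "space borel_G = carrier G"
  by (simp add: borel_G_def)

lemma Log_measurable [measurable]: "Log \<in> borel_measurable borel_G"
  unfolding borel_G_def by (rule measurable_vimage_algebra1) simp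

lemma Exp_measurable [measurable]: "Exp \<in> measurable borel borel_G"
  unfolding borel_G_def by (rule measurable_vimage_algebra2) auto

lemma measurable_borel_G_iff:
  "f \<in> measurable borel_G N \<longleftrightarrow> (\<lambda>Z. f (Exp Z)) \<in> measurable borel N"
proof
  assume "f \<in> measurable borel_G N"
  then show "(\<lambda>Z. f (Exp Z)) \<in> measurable borel N" by (rule measurable_compose[OF Exp_measurable])
next
  assume "(\<lambda>Z. f (Exp Z)) \<in> measurable borel N"
  from measurable_compose[OF Log_measurable this]
  show "f \<in> measurable borel_G N" by (rule measurable_cong[THEN iffD1, rotated]) simp
qed

lemma Exp_image_measurable:
  assumes "A \<in> sets borel" shows "Exp ` A \<in> sets borel_G"
proof -
  have "Exp ` A = Log -` A \<inter> space borel_G" by (auto simp: image_iff) (metis Exp_Log)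
  then show ?thesis using measurable_sets[OF Log_measurable assms] by simp
qed

lemma K_Exp:
  fixes F :: "(real ^ 'm) \<Rightarrow>\<^sub>L real"
  shows "blinfun_apply (K (Exp W) F) Z = F (AD (- W) Z)"
proof -
  have "bounded_linear (\<lambda>Z. F (AD (- W) Z))"
    by (rule bounded_linear_compose[OF blinfun.bounded_linear_right bounded_linear_AD])
  then show ?thesis by (simp add: K_def Ad_Exp bounded_linear_Blinfun_apply)
qed

lemma \<kappa>_Exp: "blinfun_apply (\<kappa> F (Exp W)) Z = F (AD W Z)"
  by (simp add: \<kappa>_def K_Exp)

lemma \<kappa>_continuous: "continuous_on UNIV (\<lambda>W. \<kappa> F (Exp W))"
proof -
  have "continuous (at W) (\<lambda>W. \<kappa> F (Exp W))" for W
  proof (rule continuous_blinfun_componentwiseI1)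
    fix i
    have "continuous_on UNIV (\<lambda>W. F (AD W i))" by (intro continuous_intros AD_continuous)
    then show "continuous (at W) (\<lambda>W. blinfun_apply (\<kappa> F (Exp W)) i)"
      by (simp add: \<kappa>_Exp continuous_on_eq_continuous_at)
  qed
  then show ?thesis by (simp add: continuous_on_eq_continuous_at)
qed

lemma \<kappa>_measurable [measurable]: "\<kappa> F \<in> borel_measurable borel_G"
  unfolding measurable_borel_G_iff by (intro borel_measurable_continuous_onI \<kappa>_continuous)

text \<open>If x = Exp W and y = Exp Y have the same image, multiplicativity of the adjoint action
  shows that y x^-1 fixes F, so the trivial stabilizer gives x = y.\<close>

lemma \<kappa>_injective:
  assumes "{g \<in> carrier G. K g F = F} = {\<one>}" and eq: "\<kappa> F (Exp W) = \<kappa> F (Exp Y)"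
  shows "W = Y"
proof -
  have "K (Exp (lmult Y (- W))) F = F"
  proof (rule blinfun_eqI)
    fix Z
    have "blinfun_apply (K (Exp (lmult Y (- W))) F) Z = F (AD (lmult W (- Y)) Z)"
      by (simp add: K_Exp minus_lmult)
    also have "\<dots> = blinfun_apply (\<kappa> F (Exp W)) (AD (- Y) Z)" by (simp add: AD_lmult \<kappa>_Exp)
    also have "\<dots> = F (AD (lmult Y (- Y)) Z)" unfolding eq by (simp only: AD_lmult \<kappa>_Exp)
    also have "\<dots> = F Z" by (simp add: AD_0)
    finally show "blinfun_apply (K (Exp (lmult Y (- W))) F) Z = blinfun_apply F Z" .
  qed
  then have "Exp (lmult Y (- W)) \<in> {g \<in> carrier G. K g F = F}" by simp
  then have "Exp (lmult Y (- W)) = \<one>" unfolding assms(1) by (rule singletonD)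
  then have "lmult Y (- W) = 0" by (metis Exp_0 Log_Exp)
  then have "lmult (lmult Y (- W)) W = W" by simp
  then show ?thesis by (simp add: lmult_assoc)
qed

lemma inj_on_\<kappa>:
  assumes "{g \<in> carrier G. K g F = F} = {\<one>}" shows "inj_on (\<kappa> F) (carrier G)"
proof (rule inj_onI)
  fix x y assume "x \<in> carrier G" "y \<in> carrier G" "\<kappa> F x = \<kappa> F y"
  then have "Log x = Log y" using \<kappa>_injective[OF assms, of "Log x" "Log y"] by simp
  then show "x = y" using Exp_Log \<open>x \<in> carrier G\<close> \<open>y \<in> carrier G\<close> by metis
qed

lemma orbit_eq: "orbit F = range (\<lambda>W. \<kappa> F (Exp W))"
proof -
  have "range (\<lambda>W. \<kappa> F (Exp W)) = range (\<lambda>W. K (Exp W) F)"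
    unfolding \<kappa>_def inv_Exp by (auto simp: image_iff) (metis minus_minus)
  also have "\<dots> = (\<lambda>g. K g F) ` range Exp" by (simp add: image_image)
  also have "range Exp = carrier G" using Exp_bij by (simp add: bij_betw_def)
  finally show ?thesis by (simp add: orbit_def)
qed

text \<open>A continuous image of a closed set need not be closed, but a closed set in the chart is
  a countable union of compact sets, whose images are compact.\<close>

lemma \<kappa>_image_closed_measurable:
  assumes "closed C" shows "(\<lambda>W. \<kappa> F (Exp W)) ` C \<in> sets borel"
proof -
  have "(\<lambda>W. \<kappa> F (Exp W)) ` C = (\<Union>k::nat. (\<lambda>W. \<kappa> F (Exp W)) ` (C \<inter> cball 0 (real k)))"
  proof -
    have "\<exists>k::nat. W \<in> cball 0 (real k)" for W :: "real ^ 'm" using real_arch_simple[of "norm W"] by auto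
    then show ?thesis by blast
  qed
  moreover have "(\<lambda>W. \<kappa> F (Exp W)) ` (C \<inter> cball 0 (real k)) \<in> sets borel" for k :: nat
    by (intro borel_closed compact_imp_closed compact_continuous_image continuous_on_subset[OF \<kappa>_continuous])
       (auto intro: closed_Int_compact assms)
  ultimately show ?thesis by auto
qed

lemma orbit_measurable: "orbit F \<in> sets borel"
  unfolding orbit_eq by (rule \<kappa>_image_closed_measurable) simp

text \<open>By injectivity, the preimage of an open set under the inverse is the orbit minus the
  image of a closed set.\<close>

lemma \<kappa>_inverse_measurable:
  assumes stab: "{g \<in> carrier G. K g F = F} = {\<one>}"
  shows "(\<lambda>Y. inv_into (carrier G) (\<kappa> F) Y) \<in> measurable (restrict_space borel (orbit F)) borel_G"
proof -
  have inv: "inv_into (carrier G) (\<kappa> F) (\<kappa> F (Exp W)) = Exp W" for W by (rule inv_into_f_f[OF inj_on_\<kappa>[OF stab]]) simp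
  have sp: "space (restrict_space borel (orbit F)) = orbit F" by (simp add: space_restrict_space)
  define j where "j Y = Log (inv_into (carrier G) (\<kappa> F) Y)" for Y
  have j: "j \<in> measurable (restrict_space borel (orbit F)) borel"
  proof (rule borel_measurableI)
    fix S :: "(real ^ 'm) set" assume "open S"
    have "j -` S \<inter> orbit F = orbit F - (\<lambda>W. \<kappa> F (Exp W)) ` (- S)"
      unfolding orbit_eq by (auto simp: j_def inv dest: \<kappa>_injective[OF stab])
    also have "\<dots> \<in> sets borel"
      using \<open>open S\<close> by (intro sets.Diff orbit_measurable \<kappa>_image_closed_measurable) (simp add: closed_Compl)
    finally show "j -` S \<inter> space (restrict_space borel (orbit F)) \<in> sets (restrict_space borel (orbit F))"
      unfolding sp by (subst sets_restrict_space_iff) (auto simp: orbit_measurable)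
  qed
  have "(\<lambda>Y. Exp (j Y)) \<in> measurable (restrict_space borel (orbit F)) borel_G"
    by (rule measurable_compose[OF j Exp_measurable])
  moreover have "Exp (j Y) = inv_into (carrier G) (\<kappa> F) Y" if "Y \<in> space (restrict_space borel (orbit F))" for Y
    using that unfolding sp unfolding orbit_eq by (auto simp: j_def inv)
  ultimately show ?thesis by (simp cong: measurable_cong)
qed

end

lemma adj_unitary:
  assumes "unitary_op U" shows "cinner x (adj U y) = cinner (U x) y"
proof -
  have n: "norm (U x) = norm x" for x
  proof -
    have "complex_of_real ((norm (U x))\<^sup>2) = complex_of_real ((norm x)\<^sup>2)"
      using assms unfolding unitary_op_def by (metis cinner_self)
    then have "(norm (U x))\<^sup>2 = (norm x)\<^sup>2" using of_real_eq_iff by blast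
    then show ?thesis by (simp add: power2_eq_iff_nonneg)
  qed
  then have "\<exists>C. \<forall>x. norm (U x) \<le> C * norm x" by (intro exI[of _ 1]) simp
  then have "bounded_op U" using assms by (simp add: bounded_op_def unitary_op_def)
  then obtain B where B: "\<And>x y. cinner (U x) y = cinner x (B y)" using bounded_op_adjoint_exists by metis
  have "adj U = B" unfolding adj_def
  proof (rule the_equality)
    show "\<forall>x y. cinner (U x) y = cinner x (B y)" using B by blast
    fix B' assume "\<forall>x y. cinner (U x) y = cinner x (B' y)"
    then show "B' = B" using B by (intro ext cinner_eqI') metis
  qed
  then show ?thesis by (simp add: B)
qed

context based_exponential_lie_group
begin

lemma \<mu>\<^sub>r_eq: "\<mu>\<^sub>r = distr (density dX (\<lambda>Z. ennreal (\<Theta> Z))) borel_G Exp"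
  by (rule \<mu>\<^sub>r_def)

lemma sets_\<mu>\<^sub>r [simp, measurable_cong]: "sets \<mu>\<^sub>r = sets borel_G"
  by (simp add: \<mu>\<^sub>r_eq)

lemma space_\<mu>\<^sub>r [simp]: "space \<mu>\<^sub>r = carrier G"
  by (simp add: \<mu>\<^sub>r_eq)

lemma nn_integral_\<mu>\<^sub>r:
  assumes [measurable]: "f \<in> borel_measurable borel_G"
  shows "(\<integral>\<^sup>+x. f x \<partial>\<mu>\<^sub>r) = (\<integral>\<^sup>+Z. ennreal (\<Theta> Z) * f (Exp Z) \<partial>dX)"
proof -
  have "(\<integral>\<^sup>+x. f x \<partial>\<mu>\<^sub>r) = (\<integral>\<^sup>+Z. f (Exp Z) \<partial>density dX (\<lambda>Z. ennreal (\<Theta> Z)))"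
    unfolding \<mu>\<^sub>r_eq by (rule nn_integral_distr) measurable
  also have "\<dots> = (\<integral>\<^sup>+Z. ennreal (\<Theta> Z) * f (Exp Z) \<partial>dX)"
    by (rule nn_integral_density) measurable
  finally show ?thesis .
qed

text \<open>The density \<open>\<Theta>\<close> hides whatever happens on its zero set, hence the
  guard. Functions pulled back with the factor sqrt \<Theta> vanish there in any case.\<close>

lemma AE_\<mu>\<^sub>r_chart:
  assumes "AE x in \<mu>\<^sub>r. P x" shows "AE Z in dX. \<Theta> Z > 0 \<longrightarrow> P (Exp Z)"
proof -
  obtain N where N: "N \<in> null_sets \<mu>\<^sub>r" "{x \<in> space \<mu>\<^sub>r. \<not> P x} \<subseteq> N" using assms by (auto simp: eventually_ae_filter)
  have Nm [measurable]: "N \<in> sets borel_G" using N by auto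
  have "AE x in \<mu>\<^sub>r. x \<notin> N" using N(1) by (rule AE_not_in)
  then have "AE Z in density dX (\<lambda>Z. ennreal (\<Theta> Z)). Exp Z \<notin> N"
    unfolding \<mu>\<^sub>r_eq by (subst (asm) AE_distr_iff) measurable
  then have "AE Z in dX. 0 < ennreal (\<Theta> Z) \<longrightarrow> Exp Z \<notin> N"
    by (subst (asm) AE_density) measurable
  moreover have "P x" if "x \<in> carrier G" "x \<notin> N" for x using N(2) that by auto
  ultimately show ?thesis by (auto elim!: eventually_mono)
qed

end

section \<open>Haar measure: the modular function and null sets\<close>

context orbit_method_setting
begin

lemma sets_\<mu>\<^sub>l [simp, measurable_cong]: "sets \<mu>\<^sub>l = sets borel_G"
  using left_haar by (simp add: left_haar_def)

lemma space_\<mu>\<^sub>l [simp]: "space \<mu>\<^sub>l = carrier G"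
  using sets_eq_imp_space_eq[OF sets_\<mu>\<^sub>l] by simp

lemma \<Delta>_pos: "x \<in> carrier G \<Longrightarrow> \<Delta> x > 0"
  using modular by (auto simp: modular_def)

text \<open>Left Haar measure read in the chart, where closed balls exhaust the space by sets of
  finite measure.\<close>

definition \<nu> :: "(real ^ 'm) measure" where
  "\<nu> = distr \<mu>\<^sub>l borel Log"

lemma emeasure_\<nu>: "B \<in> sets borel \<Longrightarrow> emeasure \<nu> B = emeasure \<mu>\<^sub>l (Exp ` B)"
proof -
  assume B: "B \<in> sets borel"
  have "Log -` B \<inter> space \<mu>\<^sub>l = Exp ` B" by (auto simp: image_iff) (metis Exp_Log)
  then show ?thesis unfolding \<nu>_def by (subst emeasure_distr) (use B in auto)
qed

lemma sigma_finite_\<nu>: "sigma_finite_measure \<nu>"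
proof
  show "\<exists>A. countable A \<and> A \<subseteq> sets \<nu> \<and> \<Union>A = space \<nu> \<and> (\<forall>a\<in>A. emeasure \<nu> a \<noteq> \<infinity>)"
  proof (intro exI conjI)
    show "countable (range (\<lambda>k::nat. cball (0::real ^ 'm) (real k)))" by simp
    have "\<exists>k::nat. W \<in> cball 0 (real k)" for W :: "real ^ 'm" using real_arch_simple[of "norm W"] by auto
    then show "\<Union>(range (\<lambda>k::nat. cball (0::real ^ 'm) (real k))) = space \<nu>" by (auto simp: \<nu>_def)
    have "emeasure \<nu> (cball 0 (real k)) \<noteq> \<infinity>" for k :: nat
      using left_haar unfolding left_haar_def by (subst emeasure_\<nu>) (auto simp: less_top)
    then show "\<forall>a\<in>range (\<lambda>k::nat. cball (0::real ^ 'm) (real k)). emeasure \<nu> a \<noteq> \<infinity>" by blast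
  qed (auto simp: \<nu>_def)
qed

lemma \<mu>\<^sub>l_nonzero: "emeasure \<mu>\<^sub>l (carrier G) \<noteq> 0"
proof -
  obtain A where A: "A \<in> sets \<mu>\<^sub>l" "emeasure \<mu>\<^sub>l A \<noteq> 0" using left_haar by (auto simp: left_haar_def)
  have "emeasure \<mu>\<^sub>l A \<le> emeasure \<mu>\<^sub>l (space \<mu>\<^sub>l)" by (rule emeasure_space)
  then show ?thesis using A by auto
qed

text \<open>Fix one ball B of positive finite measure. Then \<Delta> x is the measure of the right
  translate B x divided by that of B, and in the chart the numerator is the integral over one
  variable of a jointly measurable indicator.\<close>

lemma \<Delta>_measurable [measurable]: "\<Delta> \<in> borel_measurable borel_G"
proof -
  interpret N: sigma_finite_measure \<nu> by (rule sigma_finite_\<nu>)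
  have sets_\<nu> [measurable_cong]: "sets \<nu> = sets borel" by (simp add: \<nu>_def)
  have "\<exists>k::nat. emeasure \<nu> (cball 0 (real k)) \<noteq> 0"
  proof (rule ccontr)
    assume "\<nexists>k::nat. emeasure \<nu> (cball 0 (real k)) \<noteq> 0"
    then have "emeasure \<nu> (\<Union>k::nat. cball 0 (real k)) = 0"
      by (intro emeasure_UN_eq_0) (auto simp: sets_\<nu>)
    moreover have "(\<Union>k::nat. cball 0 (real k)) = (UNIV :: (real ^ 'm) set)"
      using real_arch_simple[of "norm _"] by auto
    ultimately have "emeasure \<nu> UNIV = 0" by simp
    then show False using \<mu>\<^sub>l_nonzero Exp_bij by (simp add: emeasure_\<nu> bij_betw_def)
  qed
  then obtain k :: nat where k: "emeasure \<nu> (cball 0 (real k)) \<noteq> 0" by blast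
  define B where "B = cball (0::real ^ 'm) (real k)"
  have B [measurable]: "B \<in> sets borel" by (simp add: B_def)
  have fin: "emeasure \<nu> B < \<infinity>"
    using left_haar unfolding left_haar_def B_def by (subst emeasure_\<nu>) auto
  define b where "b = enn2real (emeasure \<nu> B)"
  have b: "b > 0" using k fin by (simp add: b_def B_def enn2real_positive_iff zero_less_iff_neq_zero)
  have nub: "emeasure \<nu> B = ennreal b" using fin by (simp add: b_def less_top)
  have key: "\<Delta> (Exp W) = enn2real (\<integral>\<^sup>+Z. indicator B (lmult Z (- W)) \<partial>\<nu>) / b" for W
  proof -
    define S where "S = (\<lambda>Z. lmult Z (- W)) -` B"
    have S: "S \<in> sets borel"
    proof -
      have "(\<lambda>Z. lmult Z (- W)) \<in> borel_measurable borel"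
        by (intro borel_measurable_continuous_onI continuous_intros)
      from measurable_sets[OF this B] show ?thesis by (simp add: S_def)
    qed
    have im: "Exp ` S = (\<lambda>x. x \<otimes> Exp W) ` (Exp ` B)"
    proof (intro equalityI subsetI)
      fix x assume "x \<in> Exp ` S"
      then obtain Z where "lmult Z (- W) \<in> B" "x = Exp Z" by (auto simp: S_def)
      moreover have "Exp (lmult Z (- W)) \<otimes> Exp W = Exp Z" by (simp flip: Exp_lmult add: lmult_assoc)
      ultimately show "x \<in> (\<lambda>x. x \<otimes> Exp W) ` (Exp ` B)" by (metis imageI)
    next
      fix x assume "x \<in> (\<lambda>x. x \<otimes> Exp W) ` (Exp ` B)"
      then obtain Z where Z: "Z \<in> B" "x = Exp Z \<otimes> Exp W" by blast
      then have "x = Exp (lmult Z W)" by (simp add: Exp_lmult)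
      moreover have "lmult Z W \<in> S" using Z by (simp add: S_def lmult_assoc)
      ultimately show "x \<in> Exp ` S" by blast
    qed
    have "(\<integral>\<^sup>+Z. indicator B (lmult Z (- W)) \<partial>\<nu>) = (\<integral>\<^sup>+Z. indicator S Z \<partial>\<nu>)"
      by (rule nn_integral_cong) (simp add: S_def indicator_def)
    also have "\<dots> = emeasure \<nu> S" using S by (simp add: sets_\<nu>)
    also have "\<dots> = emeasure \<mu>\<^sub>l ((\<lambda>x. x \<otimes> Exp W) ` (Exp ` B))" using S by (simp add: emeasure_\<nu> im)
    also have "\<dots> = ennreal (\<Delta> (Exp W)) * emeasure \<mu>\<^sub>l (Exp ` B)"
      using modular Exp_image_measurable[OF B] by (simp add: modular_def)
    also have "\<dots> = ennreal (\<Delta> (Exp W) * b)"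
      using b \<Delta>_pos[of "Exp W"] nub by (simp add: emeasure_\<nu>[OF B, symmetric] ennreal_mult)
    finally have "enn2real (\<integral>\<^sup>+Z. indicator B (lmult Z (- W)) \<partial>\<nu>) = \<Delta> (Exp W) * b"
      using b \<Delta>_pos[of "Exp W"] by simp
    then show ?thesis using b by simp
  qed
  have c: "(\<lambda>p. lmult (snd p) (- fst p)) \<in> borel_measurable (borel \<Otimes>\<^sub>M borel)"
    unfolding borel_prod by (intro borel_measurable_continuous_onI continuous_intros)
  have "(\<lambda>p. indicator B (lmult (snd p) (- fst p)) :: ennreal) \<in> borel_measurable (borel \<Otimes>\<^sub>M borel)"
    by (rule measurable_compose[OF c]) measurable
  then have "(\<lambda>(W, Z). indicator B (lmult Z (- W)) :: ennreal) \<in> borel_measurable (borel \<Otimes>\<^sub>M \<nu>)"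
    by (simp add: case_prod_unfold cong: measurable_cong_sets sets_pair_measure_cong[OF refl sets_\<nu>])
  then have [measurable]: "(\<lambda>W. \<integral>\<^sup>+Z. indicator B (lmult Z (- W)) \<partial>\<nu>) \<in> borel_measurable borel"
    by (rule N.borel_measurable_nn_integral)
  show ?thesis unfolding measurable_borel_G_iff key by measurable
qed

lemma \<mu>\<^sub>r_null_imp_\<mu>\<^sub>l_null:
  assumes "A \<in> sets borel_G" "emeasure \<mu>\<^sub>r A = 0" shows "emeasure \<mu>\<^sub>l A = 0"
proof -
  have "AE x in \<mu>\<^sub>r. x \<notin> A" using assms by (intro AE_not_in) auto
  then have "(\<integral>\<^sup>+x. ennreal (\<Delta> x) * indicator A x \<partial>\<mu>\<^sub>r) = (\<integral>\<^sup>+x. 0 \<partial>\<mu>\<^sub>r)"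
    by (intro nn_integral_cong_AE) (auto elim!: eventually_mono)
  then show ?thesis using assms(1) unfolding left_right by (subst emeasure_density) auto
qed

lemma lmult_cancel: "lmult (- Y) (lmult Y Z) = Z"
  by (simp flip: lmult_assoc)

text \<open>Countably many left translates of a nonempty open set cover the group.\<close>

lemma open_not_null:
  assumes U: "open U" "U \<noteq> {}" shows "emeasure \<mu>\<^sub>r (Exp ` U) \<noteq> 0"
proof
  assume "emeasure \<mu>\<^sub>r (Exp ` U) = 0"
  moreover have EU: "Exp ` U \<in> sets borel_G" by (rule Exp_image_measurable) (simp add: U)
  ultimately have nullU: "emeasure \<mu>\<^sub>l (Exp ` U) = 0" by (intro \<mu>\<^sub>r_null_imp_\<mu>\<^sub>l_null)
  obtain Y where Y: "Y \<in> U" using U by blast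
  \<comment> \<open>The left translate of U by W Y^-1, which moves the point Y of U to W; left
    invariance makes it as null as U.\<close>
  define S where "S W = (\<lambda>Z. lmult (- lmult W (- Y)) Z) -` U" for W
  have openS: "open (S W)" for W
    unfolding S_def by (rule open_vimage[OF U(1)]) (intro continuous_intros)
  have WS: "W \<in> S W" for W using Y by (simp add: S_def minus_lmult lmult_assoc)
  have null: "emeasure \<nu> (S W) = 0" for W
  proof -
    have im: "Exp ` S W = (\<lambda>x. Exp (lmult W (- Y)) \<otimes> x) ` (Exp ` U)"
    proof (intro equalityI subsetI)
      fix x assume "x \<in> Exp ` S W"
      then obtain Z where Z: "lmult (- lmult W (- Y)) Z \<in> U" "x = Exp Z" by (auto simp: S_def)
      have "Exp (lmult W (- Y)) \<otimes> Exp (lmult (- lmult W (- Y)) Z) = Exp (lmult (lmult W (- Y)) (lmult (- lmult W (- Y)) Z))"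
        by (simp only: Exp_lmult)
      also have "\<dots> = Exp Z" by (simp flip: lmult_assoc)
      finally show "x \<in> (\<lambda>x. Exp (lmult W (- Y)) \<otimes> x) ` (Exp ` U)" using Z by (metis imageI)
    next
      fix x assume "x \<in> (\<lambda>x. Exp (lmult W (- Y)) \<otimes> x) ` (Exp ` U)"
      then obtain Z where Z: "Z \<in> U" "x = Exp (lmult W (- Y)) \<otimes> Exp Z" by blast
      then have "x = Exp (lmult (lmult W (- Y)) Z)" by (simp only: Exp_lmult)
      moreover have "lmult (lmult W (- Y)) Z \<in> S W" using Z(1) by (simp add: S_def lmult_cancel)
      ultimately show "x \<in> Exp ` S W" by blast
    qed
    have "emeasure \<nu> (S W) = emeasure \<mu>\<^sub>l (Exp ` S W)" by (rule emeasure_\<nu>) (simp add: openS)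
    also have "\<dots> = emeasure \<mu>\<^sub>l (Exp ` U)"
      unfolding im using left_haar EU by (simp add: left_haar_def)
    finally show ?thesis using nullU by simp
  qed
  obtain \<C> where C: "\<C> \<subseteq> range S" "countable \<C>" "\<Union>\<C> = \<Union>(range S)"
    using Lindelof[of "range S"] openS by blast
  have "emeasure \<nu> (\<Union>\<C>) = 0"
  proof -
    have "A \<in> null_sets \<nu>" if A: "A \<in> \<C>" for A
    proof -
      obtain W where "A = S W" using A C(1) by blast
      then show ?thesis using null[of W] openS[of W] by (simp add: null_sets_def \<nu>_def)
    qed
    then have "\<Union>\<C> \<in> null_sets \<nu>" using null_sets_UN'[OF C(2), of "\<lambda>A. A" \<nu>] by simp
    then show ?thesis by auto
  qed
  moreover have "\<Union>\<C> = UNIV" using C(3) WS by auto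
  ultimately have "emeasure \<mu>\<^sub>l (range Exp) = 0" using emeasure_\<nu>[of UNIV] by simp
  then show False using \<mu>\<^sub>l_nonzero Exp_bij by (simp add: bij_betw_def)
qed

lemma unitary_\<pi>: "x \<in> carrier G \<Longrightarrow> unitary_op (\<pi> x)"
  using unitary by (simp add: unitary_rep_def)

lemma matrix_coeff_eq: "x \<in> carrier G \<Longrightarrow> matrix_coeff \<pi> \<phi> \<psi> x = cinner (\<pi> x \<psi>) \<phi>"
  by (simp add: matrix_coeff_def adj_unitary unitary_\<pi>)

lemma \<pi>_one: "\<pi> \<one> v = v"
proof -
  have "surj (\<pi> \<one>)" using unitary_\<pi>[of \<one>] by (simp add: unitary_op_def)
  then obtain w where w: "v = \<pi> \<one> w" by blast
  have "\<pi> (\<one> \<otimes> \<one>) = \<pi> \<one> \<circ> \<pi> \<one>" using unitary unfolding unitary_rep_def by blast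
  then show ?thesis unfolding w by (metis comp_apply one_closed r_one)
qed

section \<open>The inverse Duflo-Moore operator: injectivity and dense range\<close>

lemma selfadjoint_T: "positive_selfadjoint V T"
  using duflo_moore by (simp add: duflo_moore_inverse_def)

lemma matrix_coeff_L2: "\<phi> \<in> V \<Longrightarrow> matrix_coeff \<pi> \<phi> \<psi> \<in> L2 \<mu>\<^sub>r"
  using duflo_moore by (simp add: duflo_moore_inverse_def)

lemma matrix_coeff_inner:
  "\<phi>\<^sub>1 \<in> V \<Longrightarrow> \<phi>\<^sub>2 \<in> V \<Longrightarrow> L2_inner \<mu>\<^sub>r (matrix_coeff \<pi> \<phi>\<^sub>1 \<psi>\<^sub>1) (matrix_coeff \<pi> \<phi>\<^sub>2 \<psi>\<^sub>2)
    = cinner \<psi>\<^sub>1 \<psi>\<^sub>2 * cnj (cinner (T \<phi>\<^sub>1) (T \<phi>\<^sub>2))"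
  using duflo_moore by (simp add: duflo_moore_inverse_def)

lemma L2sq_matrix_coeff:
  assumes "\<phi> \<in> V" shows "L2sq \<mu>\<^sub>r (matrix_coeff \<pi> \<phi> \<psi>) = (norm \<psi>)\<^sup>2 * (norm (T \<phi>))\<^sup>2"
proof -
  have "L2_inner \<mu>\<^sub>r (matrix_coeff \<pi> \<phi> \<psi>) (matrix_coeff \<pi> \<phi> \<psi>) = complex_of_real (L2sq \<mu>\<^sub>r (matrix_coeff \<pi> \<phi> \<psi>))"
    unfolding L2_inner_def L2sq_def by (simp only: complex_norm_square[symmetric] integral_complex_of_real)
  then have "complex_of_real (L2sq \<mu>\<^sub>r (matrix_coeff \<pi> \<phi> \<psi>)) = complex_of_real ((norm \<psi>)\<^sup>2 * (norm (T \<phi>))\<^sup>2)"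
    unfolding matrix_coeff_inner[OF assms assms] cinner_self by simp
  then show ?thesis using of_real_eq_iff by blast
qed

text \<open>By the orthogonality relations, T \<phi> = 0 makes the coefficient <pi(x) \<phi>,
  \<phi>> vanish almost everywhere. It is continuous and equals |\<phi>|^2 at the identity, so for
  \<phi> other than 0 it is nonzero on an open set, which is not null.\<close>

lemma T_injective:
  assumes \<phi>: "\<phi> \<in> V" "T \<phi> = 0" shows "\<phi> = 0"
proof (rule ccontr)
  assume n0: "\<phi> \<noteq> 0"
  have "L2sq \<mu>\<^sub>r (matrix_coeff \<pi> \<phi> \<phi>) = 0" by (simp add: L2sq_matrix_coeff \<phi>)
  then have AE: "AE x in \<mu>\<^sub>r. matrix_coeff \<pi> \<phi> \<phi> x = 0"
    using L2sq_eq_0_iff[OF matrix_coeff_L2[OF \<phi>(1)]] by simp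
  define U where "U = {W. cinner (\<pi> (Exp W) \<phi>) \<phi> \<noteq> 0}"
  have "continuous_on UNIV (\<lambda>W. cinner (\<pi> (Exp W) \<phi>) \<phi>)"
    using unitary unfolding unitary_rep_def
    by (intro continuous_on_compose2[OF linear_continuous_on[OF bounded_linear_cinner_left[of \<phi>], of UNIV]]) auto
  then have "open U" unfolding U_def by (intro open_Collect_neq) auto
  moreover have "0 \<in> U" using n0 by (simp add: U_def \<pi>_one cinner_eq_zero_iff)
  ultimately have "emeasure \<mu>\<^sub>r (Exp ` U) \<noteq> 0" by (intro open_not_null) auto
  moreover have "emeasure \<mu>\<^sub>r (Exp ` U) = 0"
  proof (rule AE_iff_measurable[THEN iffD1, rotated 2])
    show "AE x in \<mu>\<^sub>r. x \<notin> Exp ` U"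
      using AE AE_space by eventually_elim (auto simp: matrix_coeff_eq U_def)
    show "{x \<in> space \<mu>\<^sub>r. \<not> x \<notin> Exp ` U} = Exp ` U" by auto
    show "Exp ` U \<in> sets \<mu>\<^sub>r" using Exp_image_measurable[of U] \<open>open U\<close> by simp
  qed
  ultimately show False by blast
qed

lemma csubspace_V: "csubspace V" and clinear_T: "clinear_on V T"
  using selfadjoint_T by (simp_all add: positive_selfadjoint_def)

lemma T_adjoint_iff: "(\<forall>x\<in>V. cinner (T x) y = cinner x z) \<longleftrightarrow> y \<in> V \<and> z = T y"
  using selfadjoint_T unfolding positive_selfadjoint_def by blast

lemma T_symmetric: "x \<in> V \<Longrightarrow> y \<in> V \<Longrightarrow> cinner (T x) y = cinner x (T y)"
  using T_adjoint_iff[of y "T y"] by blast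

lemma T_diff: "x \<in> V \<Longrightarrow> y \<in> V \<Longrightarrow> T (x - y) = T x - T y"
proof -
  assume V: "x \<in> V" "y \<in> V"
  have "(-1) *\<^sub>C y \<in> V" using csubspace_V V by (auto simp: csubspace_def)
  then have "T (x + (-1) *\<^sub>C y) = T x + (-1) *\<^sub>C T y" using clinear_T V by (simp add: clinear_on_def)
  then show ?thesis by (simp add: scaleC_uminus1)
qed

lemma T_inj_on: "inj_on T V"
proof (rule inj_onI)
  fix x y assume "x \<in> V" "y \<in> V" "T x = T y"
  then show "x = y" using T_injective[of "x - y"] csubspace_diff[OF csubspace_V, of x y] by (simp add: T_diff)
qed

text \<open>A vector orthogonal to the range lies, by self-adjointness, in the domain and in the
  kernel of \<open>T\<close>, hence is 0. Thus every \<phi> is a limit of vectors T v with v in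
  \<open>V\<close>.\<close>

lemma range_T_dense: "closure (T ` V) = UNIV"
proof (rule dense_if_orthogonal_trivial)
  have c: "T (c *\<^sub>C x) = c *\<^sub>C T x" "T (x + y) = T x + T y" if "x \<in> V" "y \<in> V" for c x y
    using clinear_T that by (auto simp: clinear_on_def)
  have V: "0 \<in> V" "\<And>x y. x \<in> V \<Longrightarrow> y \<in> V \<Longrightarrow> x + y \<in> V" "\<And>c x. x \<in> V \<Longrightarrow> c *\<^sub>C x \<in> V"
    using csubspace_V by (auto simp: csubspace_def)
  have "T 0 = 0" using c(1)[OF V(1) V(1), of 0] by simp
  then show "csubspace (T ` V)" unfolding csubspace_def
  proof (intro conjI ballI allI)
    show "0 \<in> T ` V" if "T 0 = 0" using that V(1) by force
    fix x y assume "x \<in> T ` V" "y \<in> T ` V"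
    then show "x + y \<in> T ` V" using c(2) V(2) by (metis (no_types, lifting) imageE imageI)
  next
    fix a x assume "x \<in> T ` V"
    then show "a *\<^sub>C x \<in> T ` V" using c(1) V(3) by (metis (no_types, lifting) imageE imageI)
  qed
  fix y assume "\<forall>s\<in>T ` V. cinner s y = 0"
  then have "\<forall>x\<in>V. cinner (T x) y = cinner x 0" by simp
  then have "y \<in> V \<and> 0 = T y" by (simp only: T_adjoint_iff)
  then show "y = 0" using T_injective by simp
qed

end

section \<open>The Fourier-Wigner transform of rank-one operators\<close>

lemma has_sum_finite_sum:
  fixes f :: "'i \<Rightarrow> 'a \<Rightarrow> 'b::topological_comm_monoid_add"
  assumes "\<And>j. j \<in> J \<Longrightarrow> (f j has_sum s j) A"
  shows "((\<lambda>x. \<Sum>j\<in>J. f j x) has_sum (\<Sum>j\<in>J. s j)) A"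
  using assms by (induction J rule: infinite_finite_induct) (auto intro: has_sum_add)

text \<open>Half of the invariance of the Hilbert-Schmidt norm under adjoints: Parseval expands each
  A' f, the moduli <A' f, e> and <A e, f> agree, and Bessel's inequality bounds the sum over f for
  each e.\<close>

lemma sum_adjoint_norm_le:
  assumes E: "onb E" and adj: "\<And>x y. cinner (A x) y = cinner x (A' y)"
    and hs: "((\<lambda>e. (norm (A e))\<^sup>2) has_sum s) E" and J: "finite J" "J \<subseteq> E"
  shows "(\<Sum>f\<in>J. (norm (A' f))\<^sup>2) \<le> s"
proof -
  have ons: "ons J" using ons_subset[OF onb_imp_ons[OF E] J(2)] .
  have sw: "cmod (cinner (A' f) e) = cmod (cinner (A e) f)" for e f
    by (metis adj cinner_commute complex_mod_cnj)
  have "((\<lambda>e. \<Sum>f\<in>J. (cmod (cinner (A' f) e))\<^sup>2) has_sum (\<Sum>f\<in>J. (norm (A' f))\<^sup>2)) E"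
    by (intro has_sum_finite_sum parseval_norm E)
  then show ?thesis
    by (rule has_sum_mono[OF _ hs]) (use bessel[OF ons J(1)] in \<open>simp add: sw\<close>)
qed

lemma bounded_op_diff: "bounded_op A \<Longrightarrow> bounded_op B \<Longrightarrow> bounded_op (\<lambda>x. A x - B x)"
  using bounded_op_lincomb[of A B 1 "-1"] by (simp add: scaleC_uminus1)

lemma norm_rank_one: "norm (rank_one \<psi> \<phi> x) = cmod (cinner x \<phi>) * norm \<psi>"
  by (simp add: rank_one_def norm_scaleC)

lemma bounded_op_rank_one: "bounded_op (rank_one \<psi> \<phi>)"
proof -
  have "norm (rank_one \<psi> \<phi> x) \<le> (norm \<phi> * norm \<psi>) * norm x" for x
    unfolding norm_rank_one using mult_right_mono[OF cmod_cinner_le[of x \<phi>] norm_ge_zero[of \<psi>]]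
    by (simp add: mult_ac)
  then have "\<exists>C. \<forall>x. norm (rank_one \<psi> \<phi> x) \<le> C * norm x" by blast
  then show ?thesis unfolding bounded_op_def clinear_on_def
    by (simp add: rank_one_def cinner_add_left cinner_scaleC_left scaleC_add_left scaleC_scaleC)
qed

lemma rank_one_has_sum:
  assumes "onb E" shows "((\<lambda>e. (norm (rank_one \<psi> \<phi> e))\<^sup>2) has_sum ((norm \<psi>)\<^sup>2 * (norm \<phi>)\<^sup>2)) E"
proof -
  have "((\<lambda>e. (norm \<psi>)\<^sup>2 * (cmod (cinner \<phi> e))\<^sup>2) has_sum ((norm \<psi>)\<^sup>2 * (norm \<phi>)\<^sup>2)) E"
    by (intro has_sum_cmult_right parseval_norm assms)
  moreover have "cmod (cinner e \<phi>) = cmod (cinner \<phi> e)" for e by (metis cinner_commute complex_mod_cnj)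
  ultimately show ?thesis by (simp add: norm_rank_one power_mult_distrib mult.commute)
qed

lemma hilbert_schmidt_rank_one: "hilbert_schmidt (rank_one \<psi> \<phi>)"
  unfolding hilbert_schmidt_def using bounded_op_rank_one rank_one_has_sum has_sum_imp_summable by blast

lemma hs_norm_rank_one: "hs_norm (rank_one \<psi> \<phi>) = norm \<psi> * norm \<phi>"
  unfolding hs_norm_def infsumI[OF rank_one_has_sum[OF onb_exists]] by (simp flip: power_mult_distrib)

lemma rank_one_diag_abs_summable:
  assumes E: "onb E" shows "(\<lambda>e. cmod (cinner (rank_one \<psi> \<phi> e) e)) summable_on E"
proof -
  have s: "(\<lambda>e. (cmod (cinner x e))\<^sup>2) summable_on E" for x :: 'a
    using parseval_norm[OF E] has_sum_imp_summable by blast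
  have le: "norm (cinner (rank_one \<psi> \<phi> e) e) \<le> norm ((cmod (cinner \<phi> e))\<^sup>2 + (cmod (cinner \<psi> e))\<^sup>2)" for e
  proof -
    have sym: "cmod (cinner e \<phi>) = cmod (cinner \<phi> e)" by (metis cinner_commute complex_mod_cnj)
    have "2 * (cmod (cinner \<phi> e) * cmod (cinner \<psi> e)) \<le> (cmod (cinner \<phi> e))\<^sup>2 + (cmod (cinner \<psi> e))\<^sup>2"
      using sum_squares_bound[of "cmod (cinner \<phi> e)" "cmod (cinner \<psi> e)"] by simp
    moreover have "0 \<le> cmod (cinner \<phi> e) * cmod (cinner \<psi> e)" by simp
    ultimately have "cmod (cinner \<phi> e) * cmod (cinner \<psi> e) \<le> (cmod (cinner \<phi> e))\<^sup>2 + (cmod (cinner \<psi> e))\<^sup>2"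
      by linarith
    then show ?thesis by (simp add: rank_one_def cinner_scaleC_left norm_mult sym)
  qed
  have "(\<lambda>e. norm ((cmod (cinner \<phi> e))\<^sup>2 + (cmod (cinner \<psi> e))\<^sup>2)) summable_on E"
    using summable_on_add[OF s s, of \<phi> \<psi>] by simp
  from Infinite_Sum.abs_summable_on_comparison_test[OF this, of "\<lambda>e. cinner (rank_one \<psi> \<phi> e) e"]
  show ?thesis using le by blast
qed

lemma trace_class_rank_one: "trace_class (rank_one \<psi> \<phi>)"
  unfolding trace_class_def using bounded_op_rank_one rank_one_diag_abs_summable by blast

lemma L2_cong_space: "(\<And>x. x \<in> space M \<Longrightarrow> f x = g x) \<Longrightarrow> f \<in> L2 M \<longleftrightarrow> g \<in> L2 M"
  unfolding L2_def using measurable_cong[of M f g borel]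
  by (auto cong: Bochner_Integration.integrable_cong)

lemma L2sq_cong_space: "(\<And>x. x \<in> space M \<Longrightarrow> f x = g x) \<Longrightarrow> L2sq M f = L2sq M g"
  unfolding L2sq_def by (rule Bochner_Integration.integral_cong) auto

lemma L2_tendsto_cong_space:
  assumes "\<And>k x. x \<in> space M \<Longrightarrow> f k x = f' k x" "\<And>x. x \<in> space M \<Longrightarrow> g x = g' x" "L2_tendsto M f g"
  shows "L2_tendsto M f' g'"
proof -
  have "L2sq M (\<lambda>x. f k x - g x) = L2sq M (\<lambda>x. f' k x - g' x)" for k
    by (rule L2sq_cong_space) (simp add: assms)
  then show ?thesis
    using assms(3) L2_cong_space[OF assms(1), of "M"] L2_cong_space[OF assms(2), of "M"]
    unfolding L2_tendsto_iff by simp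
qed

lemma hs_norm_square: "(hs_norm A)\<^sup>2 = (\<Sum>\<^sub>\<infinity>e\<in>(SOME E. onb E). (norm (A e))\<^sup>2)"
  unfolding hs_norm_def by (rule real_sqrt_pow2) (simp add: infsum_nonneg)

context orbit_method_setting
begin

text \<open>The hypotheses on \<open>B\<close> are boundedness and summable rotated diagonals,
  because the bound will be applied to a difference of two extensions, which inherits these
  properties term by term. Finite partial sums of the trace are orthogonal sums of matrix
  coefficients, and Fatou's lemma carries their bound to the trace.\<close>

lemma fourier_wigner_bound:
  fixes A B :: "'h \<Rightarrow> 'h"
  defines "E \<equiv> SOME E::'h set. onb E"
  assumes A: "bounded_op A" "(\<lambda>e. (norm (A e))\<^sup>2) summable_on E" and B: "bounded_op B"
    and BT: "\<And>v. v \<in> V \<Longrightarrow> B (T v) = A v"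
    and sumB: "\<And>x. x \<in> carrier G \<Longrightarrow> (\<lambda>e. cmod (cinner (B (\<pi> x e)) e)) summable_on E"
  shows "(\<integral>\<^sup>+x. ennreal ((cmod (trace_op (B \<circ> \<pi> x)))\<^sup>2) \<partial>\<mu>\<^sub>r) \<le> ennreal ((hs_norm A)\<^sup>2)"
proof -
  have E: "onb E" unfolding E_def by (rule onb_exists)
  obtain A' where A': "\<And>x y. cinner (A x) y = cinner x (A' y)" using bounded_op_adjoint_exists[OF A(1)] by metis
  obtain B' where B': "\<And>x y. cinner (B x) y = cinner x (B' y)" using bounded_op_adjoint_exists[OF B] by metis
  have TB: "B' y \<in> V \<and> A' y = T (B' y)" for y
  proof -
    have "\<forall>v\<in>V. cinner (T v) (B' y) = cinner v (A' y)" by (simp add: BT A' flip: B')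
    then show ?thesis by (simp only: T_adjoint_iff)
  qed
  define c where "c e = matrix_coeff \<pi> (B' e) e" for e
  have c: "c e x = cinner (B (\<pi> x e)) e" if "x \<in> carrier G" for e x
    by (simp add: c_def matrix_coeff_eq that B')
  have cL2: "c e \<in> L2 \<mu>\<^sub>r" for e unfolding c_def using TB by (intro matrix_coeff_L2) blast
  have csq: "L2sq \<mu>\<^sub>r (c e) = (norm (A' e))\<^sup>2" if "e \<in> E" for e
    unfolding c_def using L2sq_matrix_coeff[of "B' e" e] TB[of e] ons_norm[OF onb_imp_ons[OF E] that] by simp
  have corth: "L2_inner \<mu>\<^sub>r (c e) (c f) = 0" if "e \<in> E" "f \<in> E" "e \<noteq> f" for e f
    using matrix_coeff_inner[of "B' e" "B' f" e f] TB onb_imp_ons[OF E] that by (simp add: c_def ons_def)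
  have hs: "((\<lambda>e. (norm (A e))\<^sup>2) has_sum (hs_norm A)\<^sup>2) E"
    unfolding hs_norm_square E_def[symmetric] using A(2) by (rule has_sum_infsum)
  have finA: "(\<Sum>f\<in>J. (norm (A' f))\<^sup>2) \<le> (hs_norm A)\<^sup>2" if "finite J" "J \<subseteq> E" for J
    by (rule sum_adjoint_norm_le[OF E A' hs that])
  \<comment> \<open>The basis may be uncountable, whereas Fatou's lemma speaks of sequences. Only
    countably many basis vectors have A' e other than 0; for all others B' e = 0 by injectivity of
    \<open>T\<close>, and the coefficient vanishes on the whole group.\<close>
  define S where "S = {e \<in> E. (norm (A' e))\<^sup>2 \<noteq> 0}"
  have "(\<lambda>e. (norm (A' e))\<^sup>2) summable_on E"
    by (rule nonneg_bdd_above_summable_on) (auto intro!: bdd_aboveI2 finA)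
  then have countS: "countable S" unfolding S_def by (rule summable_countable_real)
  have c0: "c e x = 0" if "e \<in> E - S" "x \<in> carrier G" for e x
  proof -
    have "T (B' e) = 0" using that TB[of e] by (simp add: S_def)
    then have "B' e = 0" using T_injective TB[of e] by blast
    then show ?thesis using that by (simp add: c B')
  qed
  define Fk where "Fk k = S \<inter> {e. to_nat_on S e < k}" for k
  have Ffin: "finite (Fk k)" for k
  proof (rule finite_imageD)
    show "finite (to_nat_on S ` Fk k)" by (rule finite_subset[of _ "{..<k}"]) (auto simp: Fk_def)
    show "inj_on (to_nat_on S) (Fk k)" using inj_on_to_nat_on[OF countS] by (rule inj_on_subset) (auto simp: Fk_def)
  qed
  have FE: "Fk k \<subseteq> E" for k by (auto simp: Fk_def S_def)
  \<comment> \<open>The sets \<open>Fk k\<close> eventually contain any given finite part of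
    \<open>S\<close>, so the net limit in \<open>has_sum\<close> becomes a limit along a
    sequence.\<close>
  have flim: "filterlim Fk (finite_subsets_at_top S) sequentially"
    unfolding filterlim_iff eventually_finite_subsets_at_top
  proof (intro allI impI)
    fix P assume "\<exists>X. finite X \<and> X \<subseteq> S \<and> (\<forall>Y. finite Y \<and> X \<subseteq> Y \<and> Y \<subseteq> S \<longrightarrow> P Y)"
    then obtain X where X: "finite X" "X \<subseteq> S" "\<forall>Y. finite Y \<and> X \<subseteq> Y \<and> Y \<subseteq> S \<longrightarrow> P Y"
      by (elim exE conjE)
    obtain N where N: "\<forall>n\<in>to_nat_on S ` X. n < N"
      using finite_nat_set_iff_bounded[of "to_nat_on S ` X"] X(1) by auto
    have "P (Fk k)" if k: "k \<ge> N" for k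
    proof (rule X(3)[rule_format, OF conjI[OF Ffin conjI]])
      show "X \<subseteq> Fk k"
      proof
        fix e assume "e \<in> X"
        then show "e \<in> Fk k" using N X(2) k unfolding Fk_def by fastforce
      qed
      show "Fk k \<subseteq> S" by (simp add: Fk_def)
    qed
    then show "eventually (\<lambda>k. P (Fk k)) sequentially" by (rule eventually_sequentiallyI)
  qed
  have lim: "(\<lambda>k. \<Sum>e\<in>Fk k. c e x) \<longlonglongrightarrow> trace_op (B \<circ> \<pi> x)" if x: "x \<in> carrier G" for x
  proof -
    have "(\<lambda>e. cinner (B (\<pi> x e)) e) summable_on E" by (rule abs_summable_summable[OF sumB[OF x]])
    then have "((\<lambda>e. cinner (B (\<pi> x e)) e) has_sum trace_op (B \<circ> \<pi> x)) E"
      unfolding trace_op_def E_def[symmetric] comp_apply by (rule has_sum_infsum)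
    then have "((\<lambda>e. c e x) has_sum trace_op (B \<circ> \<pi> x)) S"
      by (rule has_sum_cong_neutral[THEN iffD1, rotated -1]) (use c0 x in \<open>auto simp: c S_def\<close>)
    then show ?thesis unfolding has_sum_def using flim by (rule filterlim_compose)
  qed
  have m: "(\<lambda>x. \<Sum>e\<in>Fk k. c e x) \<in> L2 \<mu>\<^sub>r" for k by (rule L2_sum) (rule cL2)
  note [measurable] = L2_measurable[OF m]
  show ?thesis
  proof (rule nn_integral_limit_le)
    show "AE x in \<mu>\<^sub>r. (\<lambda>k. (cmod (\<Sum>e\<in>Fk k. c e x))\<^sup>2) \<longlonglongrightarrow> (cmod (trace_op (B \<circ> \<pi> x)))\<^sup>2"
      by (intro AE_I2 tendsto_intros lim) simp
    show "\<forall>\<^sub>F k in sequentially. (\<integral>\<^sup>+x. ennreal ((cmod (\<Sum>e\<in>Fk k. c e x))\<^sup>2) \<partial>\<mu>\<^sub>r) \<le> ennreal ((hs_norm A)\<^sup>2)"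
    proof (intro always_eventually allI)
      fix k
      have "L2sq \<mu>\<^sub>r (\<lambda>x. \<Sum>e\<in>Fk k. c e x) = (\<Sum>e\<in>Fk k. L2sq \<mu>\<^sub>r (c e))"
        by (rule L2sq_orthogonal_sum[OF Ffin cL2]) (use corth FE in blast)
      also have "\<dots> = (\<Sum>e\<in>Fk k. (norm (A' e))\<^sup>2)" using csq FE by (intro sum.cong) auto
      also have "\<dots> \<le> (hs_norm A)\<^sup>2" by (rule finA[OF Ffin FE])
      finally show "(\<integral>\<^sup>+x. ennreal ((cmod (\<Sum>e\<in>Fk k. c e x))\<^sup>2) \<partial>\<mu>\<^sub>r) \<le> ennreal ((hs_norm A)\<^sup>2)"
        unfolding nn_integral_L2sq[OF m] by (rule ennreal_leI)
    qed
  qed measurable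
qed

section \<open>Approximation and uniqueness for rank-one operators\<close>

lemma trace_rank_one:
  assumes x: "x \<in> carrier G"
  shows "trace_op (rank_one \<psi> v \<circ> \<pi> x) = matrix_coeff \<pi> v \<psi> x"
proof -
  have "((\<lambda>e. cinner \<psi> e * cinner e (adj (\<pi> x) v)) has_sum cinner \<psi> (adj (\<pi> x) v)) (SOME E. onb E)"
    by (rule parseval_cinner[OF onb_exists])
  then have "((\<lambda>e. cinner (rank_one \<psi> v (\<pi> x e)) e) has_sum cinner \<psi> (adj (\<pi> x) v)) (SOME E. onb E)"
    by (simp add: rank_one_def cinner_scaleC_left adj_unitary[OF unitary_\<pi>[OF x]] mult.commute)
  then show ?thesis unfolding trace_op_def matrix_coeff_def comp_apply by (rule infsumI)
qed

text \<open>The bounded extension of \<open>rank_one \<psi> (T v)\<close> composed with D is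
  \<open>rank_one \<psi> v\<close>, because <D u, T v> = <u, v> by symmetry of T.\<close>

lemma rank_one_fourier_wigner_dense:
  assumes v: "v \<in> V"
  shows "is_fourier_wigner_dense \<pi> V T (rank_one \<psi> (T v)) (\<lambda>x. trace_op (rank_one \<psi> v \<circ> \<pi> x))"
  unfolding is_fourier_wigner_dense_def
proof (intro conjI exI[of _ "rank_one \<psi> v"] refl hilbert_schmidt_rank_one trace_class_rank_one ballI)
  fix u assume "u \<in> T ` V"
  then have "inv_into V T u \<in> V" "T (inv_into V T u) = u" by (simp_all add: inv_into_into f_inv_into_f)
  then have "cinner (inv_into V T u) (T v) = cinner u v" using T_symmetric[of _ v] v by metis
  then show "rank_one \<psi> v u = rank_one \<psi> (T v) (inv_into V T u)" by (simp add: rank_one_def)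
qed

text \<open>The predicate under the choice in \<open>fourier_wigner\<close>, named so that existence
  and uniqueness of the chosen function can be stated.\<close>

definition fw_limit :: "('h \<Rightarrow> 'h) \<Rightarrow> ('g \<Rightarrow> complex) \<Rightarrow> bool" where
  "fw_limit A f \<longleftrightarrow> (\<exists>As fs. (\<forall>k. is_fourier_wigner_dense \<pi> V T (As k) (fs k)) \<and>
     (\<lambda>k. hs_norm (\<lambda>v. As k v - A v)) \<longlonglongrightarrow> 0 \<and> L2_tendsto \<mu>\<^sub>r fs f)"

lemma matrix_coeff_diff:
  "x \<in> carrier G \<Longrightarrow> matrix_coeff \<pi> (v - w) \<psi> x = matrix_coeff \<pi> v \<psi> x - matrix_coeff \<pi> w \<psi> x"
  by (simp add: matrix_coeff_eq cinner_diff_right)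

text \<open>By the orthogonality relations the square distance of two coefficients is |\<psi>|^2 |T
  (v j) - T (v k)|^2, so convergence of T (v k) makes the coefficients Cauchy even where v k itself
  diverges.\<close>

lemma matrix_coeff_limit_exists:
  assumes v: "\<And>k. v k \<in> V" "(\<lambda>k. T (v k)) \<longlonglongrightarrow> \<phi>"
  obtains g where "L2_tendsto \<mu>\<^sub>r (\<lambda>k. matrix_coeff \<pi> (v k) \<psi>) g"
proof (rule L2_complete)
  show "matrix_coeff \<pi> (v k) \<psi> \<in> L2 \<mu>\<^sub>r" for k by (rule matrix_coeff_L2[OF v(1)])
  have eq: "L2sq \<mu>\<^sub>r (\<lambda>x. matrix_coeff \<pi> (v j) \<psi> x - matrix_coeff \<pi> (v k) \<psi> x) = (norm \<psi>)\<^sup>2 * (norm (T (v j) - T (v k)))\<^sup>2" for j k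
  proof -
    have "L2sq \<mu>\<^sub>r (\<lambda>x. matrix_coeff \<pi> (v j) \<psi> x - matrix_coeff \<pi> (v k) \<psi> x) = L2sq \<mu>\<^sub>r (matrix_coeff \<pi> (v j - v k) \<psi>)"
      by (rule L2sq_cong_space) (simp add: matrix_coeff_diff)
    then show ?thesis using L2sq_matrix_coeff[OF csubspace_diff[OF csubspace_V v(1) v(1)]] T_diff[OF v(1) v(1)] by simp
  qed
  fix \<epsilon> :: real assume \<epsilon>: "\<epsilon> > 0"
  \<comment> \<open>The summand 1 avoids a division by zero when \<psi> = 0 and yields a strict
    inequality.\<close>
  define \<delta> where "\<delta> = sqrt (\<epsilon> / (1 + (norm \<psi>)\<^sup>2))"
  have pos: "1 + (norm \<psi>)\<^sup>2 > 0" by (simp add: add_pos_nonneg)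
  have \<delta>: "\<delta> > 0" "\<delta>\<^sup>2 = \<epsilon> / (1 + (norm \<psi>)\<^sup>2)" using \<epsilon> pos by (simp_all add: \<delta>_def)
  obtain N where N: "\<And>j k. j \<ge> N \<Longrightarrow> k \<ge> N \<Longrightarrow> dist (T (v j)) (T (v k)) < \<delta>"
    using LIMSEQ_imp_Cauchy[OF v(2)] \<delta>(1) unfolding Cauchy_def by blast
  have "(norm \<psi>)\<^sup>2 * (norm (T (v j) - T (v k)))\<^sup>2 < \<epsilon>" if "j \<ge> N" "k \<ge> N" for j k
  proof -
    have "(norm (T (v j) - T (v k)))\<^sup>2 \<le> \<delta>\<^sup>2"
      using N[OF that] by (intro power_mono) (auto simp: dist_norm)
    then have "(norm \<psi>)\<^sup>2 * (norm (T (v j) - T (v k)))\<^sup>2 \<le> (norm \<psi>)\<^sup>2 * \<delta>\<^sup>2" by (rule mult_left_mono) simp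
    also have "\<dots> < (1 + (norm \<psi>)\<^sup>2) * \<delta>\<^sup>2" using \<delta>(1) by (intro mult_strict_right_mono) auto
    also have "\<dots> = \<epsilon>" using pos by (simp add: \<delta>(2))
    finally show ?thesis .
  qed
  then show "\<exists>N. \<forall>j\<ge>N. \<forall>k\<ge>N. L2sq \<mu>\<^sub>r (\<lambda>x. matrix_coeff \<pi> (v j) \<psi> x - matrix_coeff \<pi> (v k) \<psi> x) < \<epsilon>"
    unfolding eq by blast
qed (use that in blast)

lemma rank_one_diff: "rank_one \<psi> \<phi> u - rank_one \<psi> \<phi>' u = rank_one \<psi> (\<phi> - \<phi>') u"
  by (simp add: rank_one_def cinner_diff_right scaleC_diff_left)

lemma fw_limit_matrix_coeff:
  assumes v: "\<And>k. v k \<in> V" "(\<lambda>k. T (v k)) \<longlonglongrightarrow> \<phi>" and g: "L2_tendsto \<mu>\<^sub>r (\<lambda>k. matrix_coeff \<pi> (v k) \<psi>) g"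
  shows "fw_limit (rank_one \<psi> \<phi>) g"
  unfolding fw_limit_def
proof (intro exI conjI allI)
  show "is_fourier_wigner_dense \<pi> V T (rank_one \<psi> (T (v k))) (\<lambda>x. trace_op (rank_one \<psi> (v k) \<circ> \<pi> x))" for k
    by (rule rank_one_fourier_wigner_dense[OF v(1)])
  have "(\<lambda>k. norm \<psi> * norm (T (v k) - \<phi>)) \<longlonglongrightarrow> norm \<psi> * norm (\<phi> - \<phi>)" by (intro tendsto_intros v(2))
  then show "(\<lambda>k. hs_norm (\<lambda>u. rank_one \<psi> (T (v k)) u - rank_one \<psi> \<phi> u)) \<longlonglongrightarrow> 0"
    unfolding rank_one_diff hs_norm_rank_one by simp
  show "L2_tendsto \<mu>\<^sub>r (\<lambda>k x. trace_op (rank_one \<psi> (v k) \<circ> \<pi> x)) g"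
    by (rule L2_tendsto_cong_space[OF _ _ g]) (simp_all add: trace_rank_one)
qed

text \<open>An arbitrary admissible sequence is compared with the rank-one sequence. The difference
  of the two trace class extensions extends A D for the difference A of the two operators, so
  \<open>fourier_wigner_bound\<close> estimates the distance of the functions by the Hilbert-Schmidt
  norm of A.\<close>

lemma fw_limit_unique:
  assumes f: "fw_limit (rank_one \<psi> \<phi>) f"
    and v: "\<And>k. v k \<in> V" "(\<lambda>k. T (v k)) \<longlonglongrightarrow> \<phi>" and g: "L2_tendsto \<mu>\<^sub>r (\<lambda>k. matrix_coeff \<pi> (v k) \<psi>) g"
  shows "AE x in \<mu>\<^sub>r. f x = g x"
proof -
  obtain As fs where d: "\<And>k. is_fourier_wigner_dense \<pi> V T (As k) (fs k)"
    and hs: "(\<lambda>k. hs_norm (\<lambda>v. As k v - rank_one \<psi> \<phi> v)) \<longlonglongrightarrow> 0" and fs: "L2_tendsto \<mu>\<^sub>r fs f"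
    using f unfolding fw_limit_def by blast
  define E where "E = (SOME E::'h set. onb E)"
  have E: "onb E" unfolding E_def by (rule onb_exists)
  have le: "L2sq \<mu>\<^sub>r (\<lambda>x. fs k x - matrix_coeff \<pi> (v k) \<psi> x)
      \<le> 2 * (hs_norm (\<lambda>v. As k v - rank_one \<psi> \<phi> v))\<^sup>2 + 2 * (norm \<psi> * norm (\<phi> - T (v k)))\<^sup>2" for k
  proof -
    obtain B where B: "trace_class B" "\<And>u. u \<in> T ` V \<Longrightarrow> B u = As k (inv_into V T u)"
      "fs k = (\<lambda>x. trace_op (B \<circ> \<pi> x))" and hA: "hilbert_schmidt (As k)"
      using d[of k] unfolding is_fourier_wigner_dense_def by blast
    define A where "A u = As k u - rank_one \<psi> (T (v k)) u" for u
    define C where "C u = B u - rank_one \<psi> (v k) u" for u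
    have opA: "bounded_op (As k)" and sA: "(\<lambda>e. (norm (As k e))\<^sup>2) summable_on E"
      using hA E by (auto simp: hilbert_schmidt_def)
    have sR: "(\<lambda>e. (norm (rank_one \<psi> \<eta> e))\<^sup>2) summable_on E" for \<psi> \<eta> :: 'h
      using rank_one_has_sum[OF E] has_sum_imp_summable by blast
    have summ: "(\<lambda>e. (norm (P e + Q e))\<^sup>2) summable_on E"
      and summ_le: "(\<Sum>\<^sub>\<infinity>e\<in>E. (norm (P e + Q e))\<^sup>2) \<le> 2 * (\<Sum>\<^sub>\<infinity>e\<in>E. (norm (P e))\<^sup>2) + 2 * (\<Sum>\<^sub>\<infinity>e\<in>E. (norm (Q e))\<^sup>2)"
      if "(\<lambda>e. (norm (P e))\<^sup>2) summable_on E" "(\<lambda>e. (norm (Q e))\<^sup>2) summable_on E" for P Q :: "'h \<Rightarrow> 'h"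
    proof -
      have s2: "(\<lambda>e. 2 * (norm (P e))\<^sup>2 + 2 * (norm (Q e))\<^sup>2) summable_on E"
        by (intro summable_on_add summable_on_cmult_right that)
      show s: "(\<lambda>e. (norm (P e + Q e))\<^sup>2) summable_on E"
        by (rule summable_on_comparison_test[OF s2]) (auto intro: norm_add_square_le)
      have "(\<Sum>\<^sub>\<infinity>e\<in>E. (norm (P e + Q e))\<^sup>2) \<le> (\<Sum>\<^sub>\<infinity>e\<in>E. 2 * (norm (P e))\<^sup>2 + 2 * (norm (Q e))\<^sup>2)"
        by (rule infsum_mono[OF s s2]) (rule norm_add_square_le)
      also have "\<dots> = 2 * (\<Sum>\<^sub>\<infinity>e\<in>E. (norm (P e))\<^sup>2) + 2 * (\<Sum>\<^sub>\<infinity>e\<in>E. (norm (Q e))\<^sup>2)"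
        by (subst infsum_add) (auto intro!: summable_on_cmult_right that simp: infsum_cmult_right')
      finally show "(\<Sum>\<^sub>\<infinity>e\<in>E. (norm (P e + Q e))\<^sup>2) \<le> 2 * (\<Sum>\<^sub>\<infinity>e\<in>E. (norm (P e))\<^sup>2) + 2 * (\<Sum>\<^sub>\<infinity>e\<in>E. (norm (Q e))\<^sup>2)" .
    qed
    have neg: "rank_one (- \<psi>) \<eta> u = - rank_one \<psi> \<eta> u" for \<eta> u by (simp add: rank_one_def scaleC_minus_right)
    have sD: "(\<lambda>e. (norm (As k e - rank_one \<psi> \<phi> e))\<^sup>2) summable_on E"
      using summ[OF sA sR[of "- \<psi>" \<phi>]] by (simp add: neg)
    have Asum: "(\<lambda>e. (norm (A e))\<^sup>2) summable_on E"
      using summ[OF sA sR[of "- \<psi>" "T (v k)"]] by (simp add: neg A_def)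
    \<comment> \<open>Insert \<open>rank_one \<psi> \<phi>\<close>, to which both
      \<open>As k\<close> and \<open>rank_one \<psi> (T (v k))\<close> converge in Hilbert-Schmidt
      norm.\<close>
    have "(hs_norm A)\<^sup>2 = (\<Sum>\<^sub>\<infinity>e\<in>E. (norm ((As k e - rank_one \<psi> \<phi> e) + rank_one \<psi> (\<phi> - T (v k)) e))\<^sup>2)"
      unfolding hs_norm_square E_def A_def by (simp flip: rank_one_diff)
    also have "\<dots> \<le> 2 * (hs_norm (\<lambda>u. As k u - rank_one \<psi> \<phi> u))\<^sup>2 + 2 * (hs_norm (rank_one \<psi> (\<phi> - T (v k))))\<^sup>2"
      unfolding hs_norm_square E_def[symmetric] by (rule summ_le[OF sD sR])
    finally have hsA: "(hs_norm A)\<^sup>2 \<le> 2 * (hs_norm (\<lambda>u. As k u - rank_one \<psi> \<phi> u))\<^sup>2 + 2 * (norm \<psi> * norm (\<phi> - T (v k)))\<^sup>2"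
      unfolding hs_norm_rank_one .
    have isom: "cinner (\<pi> x a) (\<pi> x b) = cinner a b" if "x \<in> carrier G" for x a b
      using unitary_\<pi>[OF that] by (simp add: unitary_op_def)
    \<comment> \<open>The trace of B pi(x) runs over a rotated diagonal of \<open>B\<close>; that it
      converges absolutely in the fixed basis is the outcome of the analysis of trace class
      operators.\<close>
    have tB: "(\<lambda>e. cmod (cinner (B (\<pi> x e)) e)) summable_on E"
      and tR: "(\<lambda>e. cmod (cinner (rank_one \<psi> (v k) (\<pi> x e)) e)) summable_on E" if x: "x \<in> carrier G" for x
      by (rule trace_class_rotated_summable[OF B(1) isom[OF x] onb_imp_ons[OF E]])
         (rule trace_class_rotated_summable[OF trace_class_rank_one isom[OF x] onb_imp_ons[OF E]])
    have tC: "(\<lambda>e. cmod (cinner (C (\<pi> x e)) e)) summable_on E" if x: "x \<in> carrier G" for x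
    proof -
      have "(\<lambda>e. cmod (cinner (B (\<pi> x e)) e) + cmod (cinner (rank_one \<psi> (v k) (\<pi> x e)) e)) summable_on E"
        by (rule summable_on_add[OF tB[OF x] tR[OF x]])
      then show ?thesis
        by (rule summable_on_comparison_test) (auto simp: C_def cinner_diff_left intro: norm_triangle_ineq4)
    qed
    have trC: "trace_op (C \<circ> \<pi> x) = fs k x - matrix_coeff \<pi> (v k) \<psi> x" if x: "x \<in> carrier G" for x
    proof -
      have "((\<lambda>e. cinner (B (\<pi> x e)) e + (-1) * cinner (rank_one \<psi> (v k) (\<pi> x e)) e) has_sum
          (trace_op (B \<circ> \<pi> x) + (-1) * trace_op (rank_one \<psi> (v k) \<circ> \<pi> x))) E"
        unfolding trace_op_def comp_apply E_def[symmetric]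
        by (intro has_sum_add has_sum_cmult_right has_sum_infsum
            abs_summable_summable[OF tB[OF x]] abs_summable_summable[OF tR[OF x]])
      then have "((\<lambda>e. cinner ((C \<circ> \<pi> x) e) e) has_sum
          (trace_op (B \<circ> \<pi> x) - trace_op (rank_one \<psi> (v k) \<circ> \<pi> x))) E"
        by (simp add: C_def cinner_diff_left)
      then show ?thesis
        unfolding trace_op_def[of "C \<circ> _"] E_def[symmetric] B(3) using trace_rank_one[OF x] infsumI by metis
    qed
    have "bounded_op A" unfolding A_def[abs_def] by (rule bounded_op_diff[OF opA bounded_op_rank_one])
    moreover have "bounded_op C" unfolding C_def[abs_def]
      by (rule bounded_op_diff[OF _ bounded_op_rank_one]) (use B(1) in \<open>simp add: trace_class_def\<close>)
    moreover have "C (T w) = A w" if w: "w \<in> V" for w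
      using B(2)[of "T w"] w inv_into_f_f[OF T_inj_on w] T_symmetric[OF w v(1)]
      by (simp add: C_def A_def rank_one_def)
    ultimately have "(\<integral>\<^sup>+x. ennreal ((cmod (trace_op (C \<circ> \<pi> x)))\<^sup>2) \<partial>\<mu>\<^sub>r) \<le> ennreal ((hs_norm A)\<^sup>2)"
      using Asum tC unfolding E_def by (intro fourier_wigner_bound) auto
    moreover have "(\<integral>\<^sup>+x. ennreal ((cmod (trace_op (C \<circ> \<pi> x)))\<^sup>2) \<partial>\<mu>\<^sub>r)
        = (\<integral>\<^sup>+x. ennreal ((cmod (fs k x - matrix_coeff \<pi> (v k) \<psi> x))\<^sup>2) \<partial>\<mu>\<^sub>r)"
      by (rule nn_integral_cong) (simp add: trC)
    moreover have L2d: "(\<lambda>x. fs k x - matrix_coeff \<pi> (v k) \<psi> x) \<in> L2 \<mu>\<^sub>r"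
      using fs v(1) by (intro L2_diff matrix_coeff_L2) (auto simp: L2_tendsto_iff)
    ultimately have "L2sq \<mu>\<^sub>r (\<lambda>x. fs k x - matrix_coeff \<pi> (v k) \<psi> x) \<le> (hs_norm A)\<^sup>2"
      using L2sq_leI(2)[OF L2_measurable[OF L2d], of "(hs_norm A)\<^sup>2"] by simp
    then show ?thesis using hsA by linarith
  qed
  have "(\<lambda>k. L2sq \<mu>\<^sub>r (\<lambda>x. fs k x - matrix_coeff \<pi> (v k) \<psi> x)) \<longlonglongrightarrow> 0"
  proof (rule tendsto_sandwich[OF _ _ tendsto_const])
    have "(\<lambda>k. 2 * (hs_norm (\<lambda>v. As k v - rank_one \<psi> \<phi> v))\<^sup>2 + 2 * (norm \<psi> * norm (\<phi> - T (v k)))\<^sup>2)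
        \<longlonglongrightarrow> 2 * 0\<^sup>2 + 2 * (norm \<psi> * norm (\<phi> - \<phi>))\<^sup>2"
      by (intro tendsto_intros hs v(2))
    then show "(\<lambda>k. 2 * (hs_norm (\<lambda>v. As k v - rank_one \<psi> \<phi> v))\<^sup>2 + 2 * (norm \<psi> * norm (\<phi> - T (v k)))\<^sup>2) \<longlonglongrightarrow> 0"
      by simp
  qed (use le in auto)
  then show ?thesis by (rule L2_tendsto_unique[OF fs g])
qed

lemma approximating_sequence: obtains v where "\<And>k. v k \<in> V" "(\<lambda>k. T (v k)) \<longlonglongrightarrow> \<phi>"
proof -
  have "\<phi> \<in> closure (T ` V)" using range_T_dense by simp
  then obtain u where u: "\<forall>k. u k \<in> T ` V" "u \<longlonglongrightarrow> \<phi>" unfolding closure_sequential by blast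
  have "\<forall>k. \<exists>w. w \<in> V \<and> u k = T w" using u(1) by (auto simp: image_iff)
  from choice[OF this] obtain v where v: "\<forall>k. v k \<in> V \<and> u k = T (v k)" ..
  then have "u = (\<lambda>k. T (v k))" by auto
  then show ?thesis using that[of v] v u by blast
qed

lemma fw_limit_fourier_wigner: "fw_limit (rank_one \<psi> \<phi>) (fourier_wigner \<pi> V T (rank_one \<psi> \<phi>))"
proof -
  obtain v where v: "\<And>k. v k \<in> V" "(\<lambda>k. T (v k)) \<longlonglongrightarrow> \<phi>" using approximating_sequence by blast
  obtain g where "L2_tendsto \<mu>\<^sub>r (\<lambda>k. matrix_coeff \<pi> (v k) \<psi>) g" using matrix_coeff_limit_exists[OF v] by blast
  then have "\<exists>f. fw_limit (rank_one \<psi> \<phi>) f" using fw_limit_matrix_coeff[OF v] by blast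
  then show ?thesis unfolding fourier_wigner_def fw_limit_def by (rule someI_ex)
qed

lemma fourier_wigner_rank_one_L2: "fourier_wigner \<pi> V T (rank_one \<psi> \<phi>) \<in> L2 \<mu>\<^sub>r"
  using fw_limit_fourier_wigner[of \<psi> \<phi>] by (auto simp: fw_limit_def L2_tendsto_iff)

lemma fourier_wigner_rank_one_AE:
  assumes "\<And>k. v k \<in> V" "(\<lambda>k. T (v k)) \<longlonglongrightarrow> \<phi>" "L2_tendsto \<mu>\<^sub>r (\<lambda>k. matrix_coeff \<pi> (v k) \<psi>) g"
  shows "AE x in \<mu>\<^sub>r. fourier_wigner \<pi> V T (rank_one \<psi> \<phi>) x = g x"
  by (rule fw_limit_unique[OF fw_limit_fourier_wigner assms])

text \<open>The sequence v depends on \<phi> alone, so one sequence serves all three operators, and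
  linearity in \<psi> already holds for each coefficient.\<close>

lemma fourier_wigner_linear_left:
  "AE x in \<mu>\<^sub>r. fourier_wigner \<pi> V T (rank_one (a *\<^sub>C \<psi>\<^sub>1 + b *\<^sub>C \<psi>\<^sub>2) \<phi>) x
     = a * fourier_wigner \<pi> V T (rank_one \<psi>\<^sub>1 \<phi>) x + b * fourier_wigner \<pi> V T (rank_one \<psi>\<^sub>2 \<phi>) x"
proof -
  obtain v where v: "\<And>k. v k \<in> V" "(\<lambda>k. T (v k)) \<longlonglongrightarrow> \<phi>" using approximating_sequence by blast
  obtain g1 where g1: "L2_tendsto \<mu>\<^sub>r (\<lambda>k. matrix_coeff \<pi> (v k) \<psi>\<^sub>1) g1" using matrix_coeff_limit_exists[OF v] by blast
  obtain g2 where g2: "L2_tendsto \<mu>\<^sub>r (\<lambda>k. matrix_coeff \<pi> (v k) \<psi>\<^sub>2) g2" using matrix_coeff_limit_exists[OF v] by blast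
  have "L2_tendsto \<mu>\<^sub>r (\<lambda>k. matrix_coeff \<pi> (v k) (a *\<^sub>C \<psi>\<^sub>1 + b *\<^sub>C \<psi>\<^sub>2)) (\<lambda>x. a * g1 x + b * g2 x)"
    by (rule L2_tendsto_cong_space[OF _ _ L2_tendsto_lincomb[OF g1 g2, of a b]])
       (simp_all add: matrix_coeff_def cinner_add_left cinner_scaleC_left)
  from fourier_wigner_rank_one_AE[OF v this] fourier_wigner_rank_one_AE[OF v g1] fourier_wigner_rank_one_AE[OF v g2]
  show ?thesis by eventually_elim simp
qed

lemma T_lincomb:
  assumes "x \<in> V" "y \<in> V"
  shows "a *\<^sub>C x + b *\<^sub>C y \<in> V" "T (a *\<^sub>C x + b *\<^sub>C y) = a *\<^sub>C T x + b *\<^sub>C T y"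
  using assms csubspace_V clinear_T by (auto simp: csubspace_def clinear_on_def)

text \<open>The combination a v k + b w k stays in \<open>V\<close> and its image under
  \<open>T\<close> tends to the combined vector. The conjugates arise because v enters the
  coefficient in the second slot of the inner product.\<close>

lemma fourier_wigner_antilinear_right:
  "AE x in \<mu>\<^sub>r. fourier_wigner \<pi> V T (rank_one \<psi> (a *\<^sub>C \<phi>\<^sub>1 + b *\<^sub>C \<phi>\<^sub>2)) x
     = cnj a * fourier_wigner \<pi> V T (rank_one \<psi> \<phi>\<^sub>1) x + cnj b * fourier_wigner \<pi> V T (rank_one \<psi> \<phi>\<^sub>2) x"
proof -
  obtain v where v: "\<And>k. v k \<in> V" "(\<lambda>k. T (v k)) \<longlonglongrightarrow> \<phi>\<^sub>1" using approximating_sequence by blast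
  obtain w where w: "\<And>k. w k \<in> V" "(\<lambda>k. T (w k)) \<longlonglongrightarrow> \<phi>\<^sub>2" using approximating_sequence by blast
  obtain g1 where g1: "L2_tendsto \<mu>\<^sub>r (\<lambda>k. matrix_coeff \<pi> (v k) \<psi>) g1" using matrix_coeff_limit_exists[OF v] by blast
  obtain g2 where g2: "L2_tendsto \<mu>\<^sub>r (\<lambda>k. matrix_coeff \<pi> (w k) \<psi>) g2" using matrix_coeff_limit_exists[OF w] by blast
  have u: "a *\<^sub>C v k + b *\<^sub>C w k \<in> V" for k by (rule T_lincomb[OF v(1) w(1)])
  have lim: "(\<lambda>k. T (a *\<^sub>C v k + b *\<^sub>C w k)) \<longlonglongrightarrow> a *\<^sub>C \<phi>\<^sub>1 + b *\<^sub>C \<phi>\<^sub>2"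
    unfolding T_lincomb(2)[OF v(1) w(1)]
    by (intro tendsto_add bounded_linear.tendsto[OF bounded_linear_scaleC] v(2) w(2))
  have "L2_tendsto \<mu>\<^sub>r (\<lambda>k. matrix_coeff \<pi> (a *\<^sub>C v k + b *\<^sub>C w k) \<psi>) (\<lambda>x. cnj a * g1 x + cnj b * g2 x)"
    by (rule L2_tendsto_cong_space[OF _ _ L2_tendsto_lincomb[OF g1 g2, of "cnj a" "cnj b"]])
       (simp_all add: matrix_coeff_eq cinner_add_right cinner_scaleC_right)
  from fourier_wigner_rank_one_AE[OF u lim this] fourier_wigner_rank_one_AE[OF v g1] fourier_wigner_rank_one_AE[OF w g2]
  show ?thesis by eventually_elim simp
qed

section \<open>The Fourier-Kirillov transform\<close>

text \<open>The square root of the density makes this map isometric from square-integrable functions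
  for \<open>\<mu>\<^sub>r\<close> to those for \<open>dX\<close>.\<close>

definition chart_pullback :: "('g \<Rightarrow> complex) \<Rightarrow> real ^ 'm \<Rightarrow> complex" where
  "chart_pullback f Z = f (Exp Z) * complex_of_real (sqrt (\<Theta> Z))"

definition fourier_version :: "('g \<Rightarrow> complex) \<Rightarrow> ((real ^ 'm) \<Rightarrow>\<^sub>L real) \<Rightarrow> complex" where
  "fourier_version f = (SOME H. is_fourier_L2 (chart_pullback f) H)"

lemma fourier_kirillov_eq:
  "fourier_kirillov \<Delta> F f x = complex_of_real (1 / sqrt (\<bar>Pf F\<bar> * \<Delta> x)) * fourier_version f (\<kappa> F x)"
  by (simp add: fourier_kirillov_def fourier_version_def chart_pullback_def[abs_def])

lemma chart_pullback_L2:
  assumes f: "f \<in> L2 \<mu>\<^sub>r" shows "chart_pullback f \<in> L2 dX"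
proof (rule L2I_nn)
  have [measurable]: "f \<in> borel_measurable borel_G" using L2_measurable[OF f] by simp
  show "chart_pullback f \<in> borel_measurable dX" unfolding chart_pullback_def[abs_def] by measurable
  have "(\<integral>\<^sup>+Z. ennreal ((cmod (chart_pullback f Z))\<^sup>2) \<partial>dX) = (\<integral>\<^sup>+Z. ennreal (\<Theta> Z) * ennreal ((cmod (f (Exp Z)))\<^sup>2) \<partial>dX)"
    by (simp add: chart_pullback_def norm_mult power_mult_distrib \<Theta>_nonneg mult.commute flip: ennreal_mult)
  also have "\<dots> = (\<integral>\<^sup>+x. ennreal ((cmod (f x))\<^sup>2) \<partial>\<mu>\<^sub>r)" by (rule nn_integral_\<mu>\<^sub>r[symmetric]) measurable
  also have "\<dots> < \<infinity>" by (simp add: nn_integral_L2sq[OF f])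
  finally show "(\<integral>\<^sup>+Z. ennreal ((cmod (chart_pullback f Z))\<^sup>2) \<partial>dX) < \<infinity>" .
qed

lemma fourier_version: "f \<in> L2 \<mu>\<^sub>r \<Longrightarrow> is_fourier_L2 (chart_pullback f) (fourier_version f)"
  unfolding fourier_version_def by (rule someI_ex[OF is_fourier_L2_exists[OF chart_pullback_L2]])

lemma inv_\<kappa>: "x \<in> carrier G \<Longrightarrow> inv_into (carrier G) (\<kappa> F) (\<kappa> F x) = x"
  by (rule inv_into_f_f[OF inj_on_\<kappa>[OF trivial_stabilizer]])

lemma orbit_function_measurable:
  assumes [measurable]: "h \<in> borel_measurable borel_G"
  shows "(\<lambda>Y. indicator (orbit F) Y * (h (inv_into (carrier G) (\<kappa> F) Y) :: ennreal)) \<in> borel_measurable borel"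
proof -
  have "(\<lambda>Y. h (inv_into (carrier G) (\<kappa> F) Y)) \<in> borel_measurable (restrict_space borel (orbit F))"
    by (rule measurable_compose[OF \<kappa>_inverse_measurable[OF trivial_stabilizer] assms])
  then show ?thesis
    by (subst (asm) borel_measurable_restrict_space_iff_ennreal) (auto simp: orbit_measurable mult.commute)
qed

lemma density_measurable [measurable]:
  "(\<lambda>Y. indicator (orbit F) Y * ennreal (\<bar>Pf F\<bar> * \<Delta> (inv_into (carrier G) (\<kappa> F) Y))) \<in> borel_measurable borel"
  by (rule orbit_function_measurable) measurable

text \<open>The image of \<open>\<mu>\<^sub>r\<close> under \<open>\<kappa> F\<close> has a density
  with respect to \<open>dY\<close>, so null sets of \<open>dY\<close> pull back to null sets;
  composition with \<open>\<kappa> F\<close> therefore respects equality almost everywhere.\<close>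

lemma AE_\<kappa>:
  assumes "AE Y in dY. P Y" shows "AE x in \<mu>\<^sub>r. P (\<kappa> F x)"
proof -
  obtain N where N: "N \<in> null_sets dY" "{Y \<in> space dY. \<not> P Y} \<subseteq> N" using assms by (auto simp: eventually_ae_filter)
  have [measurable]: "N \<in> sets borel" using N by auto
  have "AE Y in dY. Y \<notin> N" using N(1) by (rule AE_not_in)
  then have "AE Y in distr \<mu>\<^sub>r borel (\<kappa> F). Y \<notin> N"
    unfolding kappa_measure by (subst AE_density) (auto elim!: eventually_mono)
  then have "AE x in \<mu>\<^sub>r. \<kappa> F x \<notin> N" by (subst (asm) AE_distr_iff) measurable
  moreover have "P Y" if "Y \<notin> N" for Y
  proof -
    have "space dY = UNIV" using sets_eq_imp_space_eq[OF sets_dY] by simp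
    then show ?thesis using N(2) that by auto
  qed
  ultimately show ?thesis by (auto elim!: eventually_mono)
qed

text \<open>The squared prefactor is the reciprocal of the density of the transported measure. After
  the change of variables the two cancel, leaving at most the integral of |H|^2 over the
  orbit.\<close>

lemma fourier_kirillov_L2:
  assumes f: "f \<in> L2 \<mu>\<^sub>r" shows "fourier_kirillov \<Delta> F f \<in> L2 \<mu>\<^sub>r"
proof -
  define H where "H = fourier_version f"
  have H: "H \<in> L2 dY" using fourier_version[OF f] unfolding H_def by (auto simp: is_fourier_L2_def L2_tendsto_iff)
  have [measurable]: "H \<in> borel_measurable borel" using L2_measurable[OF H] by simp
  define j where "j = inv_into (carrier G) (\<kappa> F)"
  define p where "p Y = indicator (orbit F) Y * ennreal (1 / (\<bar>Pf F\<bar> * \<Delta> (j Y)))" for Y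
  have p [measurable]: "p \<in> borel_measurable borel"
    unfolding p_def[abs_def] j_def by (rule orbit_function_measurable) measurable
  have orb: "\<kappa> F x \<in> orbit F" if "x \<in> carrier G" for x
    unfolding orbit_def \<kappa>_def using that by auto
  have "(\<integral>\<^sup>+x. ennreal ((cmod (fourier_kirillov \<Delta> F f x))\<^sup>2) \<partial>\<mu>\<^sub>r) = (\<integral>\<^sup>+x. p (\<kappa> F x) * ennreal ((cmod (H (\<kappa> F x)))\<^sup>2) \<partial>\<mu>\<^sub>r)"
  proof (rule nn_integral_cong)
    fix x assume "x \<in> space \<mu>\<^sub>r"
    then have x: "x \<in> carrier G" by simp
    have sq: "(cmod (fourier_kirillov \<Delta> F f x))\<^sup>2 = 1 / (\<bar>Pf F\<bar> * \<Delta> x) * (cmod (H (\<kappa> F x)))\<^sup>2"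
      using \<Delta>_pos[OF x] unfolding fourier_kirillov_eq H_def
      by (simp add: norm_mult power_mult_distrib norm_divide power_divide del: of_real_divide)
    have "p (\<kappa> F x) = ennreal (1 / (\<bar>Pf F\<bar> * \<Delta> x))" by (simp add: p_def j_def inv_\<kappa>[OF x] orb[OF x])
    then show "ennreal ((cmod (fourier_kirillov \<Delta> F f x))\<^sup>2) = p (\<kappa> F x) * ennreal ((cmod (H (\<kappa> F x)))\<^sup>2)"
      unfolding sq using \<Delta>_pos[OF x] by (subst ennreal_mult) auto
  qed
  also have "\<dots> = (\<integral>\<^sup>+Y. p Y * ennreal ((cmod (H Y))\<^sup>2) \<partial>distr \<mu>\<^sub>r borel (\<kappa> F))"
    by (rule nn_integral_distr[symmetric]) measurable
  also have "\<dots> = (\<integral>\<^sup>+Y. (indicator (orbit F) Y * ennreal (\<bar>Pf F\<bar> * \<Delta> (j Y))) * (p Y * ennreal ((cmod (H Y))\<^sup>2)) \<partial>dY)"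
    unfolding kappa_measure j_def by (rule nn_integral_density) measurable
  also have "\<dots> \<le> (\<integral>\<^sup>+Y. ennreal ((cmod (H Y))\<^sup>2) \<partial>dY)"
  proof (rule nn_integral_mono)
    fix Y
    \<comment> \<open>Since 1 / 0 = 0, the product of the density and its reciprocal is at most 1
      even where the density is 0; hence an inequality instead of an identity.\<close>
    have "ennreal t * ennreal (1 / t) \<le> 1" if "t \<ge> 0" for t :: real
      using that by (cases "t = 0") (simp_all flip: ennreal_mult)
    moreover have "\<bar>Pf F\<bar> * \<Delta> (j Y) \<ge> 0" if "Y \<in> orbit F"
    proof -
      have "Y \<in> \<kappa> F ` carrier G" using that unfolding orbit_eq by auto
      then have "j Y \<in> carrier G" unfolding j_def by (rule inv_into_into)
      then show ?thesis using \<Delta>_pos[of "j Y"] by simp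
    qed
    ultimately have "indicator (orbit F) Y * ennreal (\<bar>Pf F\<bar> * \<Delta> (j Y)) * p Y \<le> 1"
      by (cases "Y \<in> orbit F") (auto simp: p_def)
    from mult_right_mono[OF this, of "ennreal ((cmod (H Y))\<^sup>2)"]
    show "(indicator (orbit F) Y * ennreal (\<bar>Pf F\<bar> * \<Delta> (j Y))) * (p Y * ennreal ((cmod (H Y))\<^sup>2)) \<le> ennreal ((cmod (H Y))\<^sup>2)"
      by (simp add: mult.assoc)
  qed
  also have "\<dots> < \<infinity>" by (simp add: nn_integral_L2sq[OF H])
  finally have fin: "(\<integral>\<^sup>+x. ennreal ((cmod (fourier_kirillov \<Delta> F f x))\<^sup>2) \<partial>\<mu>\<^sub>r) < \<infinity>" .
  have "fourier_kirillov \<Delta> F f \<in> borel_measurable \<mu>\<^sub>r"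
    unfolding fourier_kirillov_eq[abs_def] H_def[symmetric] by measurable
  then show ?thesis using fin by (rule L2I_nn)
qed

text \<open>An identity almost everywhere on the group passes to the chart, then through uniqueness
  of Fourier versions to the dual space, and back to the group along \<open>\<kappa> F\<close>.
  Stated for any \<open>f\<close> that agrees almost everywhere with the combination, it absorbs the
  arbitrary choice of representatives made by \<open>fourier_wigner\<close>.\<close>

lemma fourier_kirillov_lincomb:
  assumes L2: "f \<in> L2 \<mu>\<^sub>r" "f\<^sub>1 \<in> L2 \<mu>\<^sub>r" "f\<^sub>2 \<in> L2 \<mu>\<^sub>r" and AE: "AE x in \<mu>\<^sub>r. f x = a * f\<^sub>1 x + b * f\<^sub>2 x"
  shows "AE x in \<mu>\<^sub>r. fourier_kirillov \<Delta> F f x = a * fourier_kirillov \<Delta> F f\<^sub>1 x + b * fourier_kirillov \<Delta> F f\<^sub>2 x"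
proof -
  have "AE Z in dX. chart_pullback f Z = a * chart_pullback f\<^sub>1 Z + b * chart_pullback f\<^sub>2 Z"
    using AE_\<mu>\<^sub>r_chart[OF AE]
  proof eventually_elim
    case (elim Z)
    show ?case
    proof (cases "\<Theta> Z = 0")
      case True then show ?thesis by (simp add: chart_pullback_def)
    next
      case False
      then have "f (Exp Z) = a * f\<^sub>1 (Exp Z) + b * f\<^sub>2 (Exp Z)" using elim \<Theta>_nonneg[of Z] by simp
      then show ?thesis by (simp add: chart_pullback_def algebra_simps)
    qed
  qed
  then have "AE Y in dY. fourier_version f Y = a * fourier_version f\<^sub>1 Y + b * fourier_version f\<^sub>2 Y"
    by (rule is_fourier_L2_unique[OF fourier_version[OF L2(1)]
          is_fourier_L2_lincomb[OF fourier_version[OF L2(2)] fourier_version[OF L2(3)]]])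
  from AE_\<kappa>[OF this] show ?thesis by eventually_elim (simp add: fourier_kirillov_eq algebra_simps)
qed

end

theorem proposition4p13:
  fixes G :: "('g, 'b) monoid_scheme"
    and Exp :: "real ^ 'm \<Rightarrow> 'g"
    and n :: nat
    and X :: "nat \<Rightarrow> real ^ 'm"
    and \<mu>\<^sub>l :: "'g measure"
    and \<Delta> :: "'g \<Rightarrow> real"
    and F :: "(real ^ 'm) \<Rightarrow>\<^sub>L real"
    and \<hh> :: "(real ^ 'm) set"
    and \<pi> :: "'g \<Rightarrow> 'h::chilbert_space \<Rightarrow> 'h"
    and V :: "'h set"
    and T :: "'h \<Rightarrow> 'h"
    and \<mu>\<^sub>r :: "'g measure"
    and W :: "'h \<Rightarrow> 'h \<Rightarrow> 'g \<Rightarrow> complex"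
  defines "\<mu>\<^sub>r \<equiv> based_exponential_lie_group.\<mu>\<^sub>r G Exp n X"
    and "W \<equiv> based_exponential_lie_group.wigner G Exp n X \<Delta> F \<pi> V T"
  assumes "orbit_method_setting G Exp n X \<mu>\<^sub>l \<Delta> F \<hh> \<pi> V T"
  shows "(\<forall>\<psi> \<phi>. W \<psi> \<phi> \<in> L2 \<mu>\<^sub>r) \<and>
    (\<forall>a b \<psi>\<^sub>1 \<psi>\<^sub>2 \<phi>. AE x in \<mu>\<^sub>r.
       W (a *\<^sub>C \<psi>\<^sub>1 + b *\<^sub>C \<psi>\<^sub>2) \<phi> x = a * W \<psi>\<^sub>1 \<phi> x + b * W \<psi>\<^sub>2 \<phi> x) \<and>
    (\<forall>a b \<psi> \<phi>\<^sub>1 \<phi>\<^sub>2. AE x in \<mu>\<^sub>r.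
       W \<psi> (a *\<^sub>C \<phi>\<^sub>1 + b *\<^sub>C \<phi>\<^sub>2) x = cnj a * W \<psi> \<phi>\<^sub>1 x + cnj b * W \<psi> \<phi>\<^sub>2 x)"
proof -
  interpret orbit_method_setting G Exp n X \<mu>\<^sub>l \<Delta> F \<hh> \<pi> V T by (rule assms(3))
  note L2 = fourier_wigner_rank_one_L2
  show ?thesis unfolding assms(1,2) wigner_def dequantization_def
    using fourier_kirillov_L2[OF L2] fourier_kirillov_lincomb[OF L2 L2 L2 fourier_wigner_linear_left]
      fourier_kirillov_lincomb[OF L2 L2 L2 fourier_wigner_antilinear_right] by blast
qed

end
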